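(* Let $n\ge1$ and let $V,W:\mathbb R\to\mathbb R$ be convex functions for which there are constants $v_*>0$ and $w^*<\infty$ with $V''(x)\ge v_*$ and $W''(x)\le w^*$ for all $x\in\mathbb R$. Let $0<\beta<\infty$ and let $\vec\omega=(\omega_i)_{i\in\mathbb Z^n}$ be the equilibrium state at inverse temperature $\beta$ of the real-valued spin model on $\mathbb Z^n$ with formal Hamiltonian $$H(\vec\omega)=\sum_{i\in\mathbb Z^n}V(\omega_i)+\frac12\sum_{i\sim j}W(\omega_j-\omega_i).$$ Then this model is exponentially $\rho$-mixing.
   Context: $i\sim j$ means that $i,j\in\mathbb Z^n$ are neighbours ($\ell^1$ distance $1$). The equilibrium state is the law on $\mathbb R^{\mathbb Z^n}$ whose density is formally proportional to $\exp(-\beta H)$ (Gibbs measure), which the paper takes to exist and be unique under these convexity assumptions; the law conditioned by $\vec\omega_K=\hat\omega_K$ is the Gibbs measure with density formally proportional to $\exp(-\beta H)$ in the remaining variables, the spins on $K$ being frozen. For $\sigma$-algebras, $\{\mathcal F:\mathcal G\}_{\mathcal H}$ is the smallest $\epsilon\in[0,1]$ such that $|\mathbf E[fg]|\le\epsilon\operatorname{sd}(f)\operatorname{sd}(g)$ for all real square-integrable $f$ ($\mathcal F\vee\mathcal H$-measurable) and $g$ ($\mathcal G\vee\mathcal H$-measurable) with $\mathbf E[f|\mathcal H]=\mathbf E[g|\mathcal H]=0$ a.s. ($\operatorname{sd}$ is the standard deviation); and $\{\omega_i:\omega_j\}_*=\sup_{K\subset\mathbb Z^n}\{\sigma(\omega_i):\sigma(\omega_j)\}_{\sigma(\vec\omega_K)}$,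 with $\vec\omega_K=(\omega_k)_{k\in K}$. The model is exponentially $\rho$-mixing if there are $k_0<1$ and $\epsilon:\mathbb Z^n\setminus\{0\}\to[0,1]$ with $\sum_{z\ne0}\epsilon(z)<\infty$ and with exponential decay (there is $b>0$ such that $\epsilon(z)=O(e^{-b'|z|})$ as $|z|\to\infty$ for all $b'<b$) such that $\{\omega_i:\omega_j\}_*\le\min(\epsilon(j-i),k_0)$ for all distinct $i,j\in\mathbb Z^n$.
   Formalization: The equilibrium state is read as any Gibbs measure whose spins almost surely grow at most polynomially in the site; among all Gibbs measures uniqueness, and with it the claim, already fails for V(x)=W(x)=x²/2. *)

theory Defs
  imports "HOL-Probability.Probability" "HOL-Library.Landau_Symbols"
begin

section \<open>Conditional maximal correlation\<close>

text \<open>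
  A $\sigma$-algebra on the sample space of a probability measure \<open>M\<close> is represented, as in the
  library's theory of conditional expectation, by a measure with the same space, of which only
  the measurable sets matter.
\<close>

definition join_sigma :: "'a measure \<Rightarrow> 'a measure \<Rightarrow> 'a measure" where
  "join_sigma F H = sigma (space F) (sets F \<union> sets H)"

definition sd :: "'a measure \<Rightarrow> ('a \<Rightarrow> real) \<Rightarrow> real" where
  "sd M f = sqrt (prob_space.variance M f)"

definition centred_L2 :: "'a measure \<Rightarrow> 'a measure \<Rightarrow> 'a measure \<Rightarrow> ('a \<Rightarrow> real) set" where
  "centred_L2 M F H =
    {f \<in> borel_measurable (join_sigma F H).
       integrable M (\<lambda>x. (f x)\<^sup>2) \<and> (AE x in M. real_cond_exp M H f x = 0)}"

text \<open>
  The set below is closed and contains 1 by the Cauchy--Schwarz inequality, so the infimum is its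
  smallest element.
\<close>

definition rho_cond :: "'a measure \<Rightarrow> 'a measure \<Rightarrow> 'a measure \<Rightarrow> 'a measure \<Rightarrow> real" where
  "rho_cond M F G H =
    Inf {\<epsilon> \<in> {0..1}. \<forall>f \<in> centred_L2 M F H. \<forall>g \<in> centred_L2 M G H.
           \<bar>\<integral>x. f x * g x \<partial>M\<bar> \<le> \<epsilon> * sd M f * sd M g}"


section \<open>Real spins on the lattice\<close>

text \<open>
  The lattice $\mathbb{Z}^n$ is \<open>int ^ 'n\<close> with \<open>n = CARD('n)\<close>; configurations are functions
  \<open>int ^ 'n \<Rightarrow> real\<close>.
\<close>

definition l1_norm :: "int ^ 'n \<Rightarrow> int" where
  "l1_norm z = (\<Sum>k\<in>UNIV. \<bar>z $ k\<bar>)"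

definition neighbours :: "int ^ 'n \<Rightarrow> int ^ 'n \<Rightarrow> bool" where
  "neighbours i j \<longleftrightarrow> l1_norm (j - i) = 1"

definition config_space :: "(int ^ 'n \<Rightarrow> real) measure" where
  "config_space = (\<Pi>\<^sub>M i\<in>UNIV. borel)"

definition spin_sigma :: "int ^ 'n \<Rightarrow> (int ^ 'n \<Rightarrow> real) measure" where
  "spin_sigma i = vimage_algebra UNIV (\<lambda>\<omega>. \<omega> i) borel"

definition spins_sigma :: "(int ^ 'n) set \<Rightarrow> (int ^ 'n \<Rightarrow> real) measure" where
  "spins_sigma K = vimage_algebra UNIV (\<lambda>\<omega>. restrict \<omega> K) (\<Pi>\<^sub>M k\<in>K. borel)"

definition rho_star :: "(int ^ 'n \<Rightarrow> real) measure \<Rightarrow> int ^ 'n \<Rightarrow> int ^ 'n \<Rightarrow> real" where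
  "rho_star \<mu> i j = (SUP K. rho_cond \<mu> (spin_sigma i) (spin_sigma j) (spins_sigma K))"

definition exponentially_decaying :: "(int ^ 'n \<Rightarrow> real) \<Rightarrow> bool" where
  "exponentially_decaying \<epsilon> \<longleftrightarrow>
    (\<exists>b>0. \<forall>b'<b. \<epsilon> \<in> O[filtercomap (\<lambda>z. real_of_int (l1_norm z)) at_top](
                   \<lambda>z. exp (- b' * real_of_int (l1_norm z))))"

definition exponentially_rho_mixing :: "(int ^ 'n \<Rightarrow> real) measure \<Rightarrow> bool" where
  "exponentially_rho_mixing \<mu> \<longleftrightarrow>
    (\<exists>k0<1. \<exists>\<epsilon> :: int ^ 'n \<Rightarrow> real.
       (\<forall>z. z \<noteq> 0 \<longrightarrow> \<epsilon> z \<in> {0..1}) \<and>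
       \<epsilon> summable_on (- {0}) \<and>
       exponentially_decaying \<epsilon> \<and>
       (\<forall>i j. i \<noteq> j \<longrightarrow> rho_star \<mu> i j \<le> min (\<epsilon> (j - i)) k0))"


section \<open>Gibbs measures\<close>

text \<open>
  The part of the formal Hamiltonian that depends on the spins in the finite set \<open>\<Lambda>\<close>. The factor
  1/2 goes with summation over ordered pairs of neighbours, \<open>W\<close> not being assumed even.
\<close>

definition local_hamiltonian ::
  "(real \<Rightarrow> real) \<Rightarrow> (real \<Rightarrow> real) \<Rightarrow> (int ^ 'n) set \<Rightarrow> (int ^ 'n \<Rightarrow> real) \<Rightarrow> real" where
  "local_hamiltonian V W \<Lambda> \<omega> =
    (\<Sum>i\<in>\<Lambda>. V (\<omega> i)) +
    (1/2) * (\<Sum>(i, j) \<in> {(i, j). neighbours i j \<and> (i \<in> \<Lambda> \<or> j \<in> \<Lambda>)}. W (\<omega> j - \<omega> i))"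

definition boltzmann_weight ::
  "(real \<Rightarrow> real) \<Rightarrow> (real \<Rightarrow> real) \<Rightarrow> real \<Rightarrow> (int ^ 'n) set \<Rightarrow>
   (int ^ 'n \<Rightarrow> real) \<Rightarrow> (int ^ 'n \<Rightarrow> real) \<Rightarrow> ennreal" where
  "boltzmann_weight V W \<beta> \<Lambda> \<eta> x =
    ennreal (exp (- \<beta> * local_hamiltonian V W \<Lambda> (merge \<Lambda> (- \<Lambda>) (x, \<eta>))))"

text \<open>
  The Gibbs measure in the finite volume \<open>\<Lambda>\<close>, the spins outside \<open>\<Lambda>\<close> being frozen to those of
  \<open>\<eta>\<close>; it is a law on all configurations.
\<close>

definition gibbs_kernel ::
  "(real \<Rightarrow> real) \<Rightarrow> (real \<Rightarrow> real) \<Rightarrow> real \<Rightarrow> (int ^ 'n) set \<Rightarrow>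
   (int ^ 'n \<Rightarrow> real) \<Rightarrow> (int ^ 'n \<Rightarrow> real) measure" where
  "gibbs_kernel V W \<beta> \<Lambda> \<eta> =
    distr
      (density (\<Pi>\<^sub>M i\<in>\<Lambda>. lborel)
        (\<lambda>x. boltzmann_weight V W \<beta> \<Lambda> \<eta> x /
             (\<integral>\<^sup>+y. boltzmann_weight V W \<beta> \<Lambda> \<eta> y \<partial>(\<Pi>\<^sub>M i\<in>\<Lambda>. lborel))))
      config_space
      (\<lambda>x. merge \<Lambda> (- \<Lambda>) (x, \<eta>))"

text \<open>The Dobrushin--Lanford--Ruelle equations.\<close>

definition gibbs_measure ::
  "(real \<Rightarrow> real) \<Rightarrow> (real \<Rightarrow> real) \<Rightarrow> real \<Rightarrow> (int ^ 'n \<Rightarrow> real) measure \<Rightarrow> bool" where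
  "gibbs_measure V W \<beta> \<mu> \<longleftrightarrow>
    prob_space \<mu> \<and> sets \<mu> = sets config_space \<and>
    (\<forall>\<Lambda>. finite \<Lambda> \<longrightarrow>
      (\<forall>A \<in> sets config_space.
        AE \<eta> in \<mu>. real_cond_exp \<mu> (spins_sigma (- \<Lambda>)) (indicator A) \<eta> =
                    measure (gibbs_kernel V W \<beta> \<Lambda> \<eta>) A))"

text \<open>
  As always with unbounded spins, "the" Gibbs measure is meant among the tempered ones, those
  carried by configurations of at most polynomial growth. Without this, uniqueness fails already
  for quadratic \<open>V\<close> and \<open>W\<close>: translating a solution of the DLR equations by an exponentially
  growing function in the kernel of the massive lattice Laplacian gives another one, and a
  mixture of the two has spins whose correlations do not decay.
\<close>

definition equilibrium_state ::
  "(real \<Rightarrow> real) \<Rightarrow> (real \<Rightarrow> real) \<Rightarrow> real \<Rightarrow> (int ^ 'n \<Rightarrow> real) measure \<Rightarrow> bool" where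
  "equilibrium_state V W \<beta> \<mu> \<longleftrightarrow>
    gibbs_measure V W \<beta> \<mu> \<and>
    (AE \<omega> in \<mu>. \<exists>(C::real) (p::nat). \<forall>i. \<bar>\<omega> i\<bar> \<le> C * (1 + real_of_int (l1_norm i)) ^ p)"

end

theory Submission
  imports Defs
begin

text \<open>
  Freeze the spins in \<open>K\<close>. The four functions theorem on \<open>\<real>\<^sup>\<Lambda>\<close>, applied to the Boltzmann weights with
  one of the two configurations shifted by \<open>d \<ge> 0\<close>, shows that the finite-volume Gibbs measures with
  boundary conditions \<open>\<eta>' \<le> \<eta> + d\<close> are stochastically ordered up to the shift \<open>d\<close>, as long as \<open>d\<close>
  grows by at most a fixed factor \<open>q > 1\<close> per bond: the convexity of \<open>V\<close> then absorbs what the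
  interaction loses. Taking \<open>d\<close> exponentially small away from \<open>j\<close>, the conditional expectation given
  the spins at \<open>j\<close> and in \<open>K\<close> maps increasing \<open>L\<close>-Lipschitz functions of the spin at \<open>i\<close> to increasing
  functions of the spin at \<open>j\<close> with Lipschitz constant \<open>L / q ^ |i - j|\<close>; temperedness lets the volume tend to
  infinity. The same theorem with constant \<open>d\<close> bounds conditional variances, so the alternating
  conditional expectations at \<open>i\<close> and \<open>j\<close> of a Lipschitz function converge in \<open>L\<^sup>2\<close> to their
  conditional mean, each step gaining a factor \<open>1 / q ^ |i - j|\<close>. Their norms form a log-convex sequence, hence already the
  first step contracts by this factor, and by density so does it on all of \<open>L\<^sup>2\<close>.
\<close>

section \<open>The four functions theorem\<close>

text \<open>The admissible factor \<open>q\<close> is a balance. At each site the convexity of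
  \<open>V\<close> gains \<open>v * u i * d i\<close>, and each of the 2n bonds at that site may
  lose \<open>w * (q - 1) * u i * d i\<close>, so \<open>q - 1\<close> has to be at most
  \<open>v / (2n * w)\<close>. Convexity of \<open>W\<close> makes the loss proportional to the
  variation of \<open>d\<close> along a bond and not to \<open>d\<close> itself.

  Two obstacles shape the passage to infinite volume. And a conditional expectation is determined
  only almost everywhere, whereas the iteration needs an order and Lipschitz bound for every pair of
  configurations; hence versions are built as limits of box means.

  A smaller Lipschitz constant does not by itself make an L2 norm smaller by the same factor: the
  variance bound has a prefactor unrelated to the actual variance. Iterating removes it, since a
  prefactor does not affect an exponential rate.\<close>

lemma ennreal_add_le_of_mult_le:
  fixes a b c e :: ennreal
  assumes "a \<le> c" "b \<le> c" "a * b \<le> c * e"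
  shows "a + b \<le> c + e"
proof (cases "c = 0 \<or> c = \<top> \<or> e = \<top>")
  case True
  then show ?thesis using assms by auto
next
  case False
  then have c: "c < \<top>" "c \<noteq> 0" and e: "e < \<top>" by (auto simp: less_top)
  then have "a < \<top>" "b < \<top>" using assms by (auto intro: le_less_trans)
  with c e obtain a' b' c' e' where *: "a = ennreal a'" "b = ennreal b'" "c = ennreal c'" "e = ennreal e'"
      "a' \<ge> 0" "b' \<ge> 0" "c' \<ge> 0" "e' \<ge> 0"
    by (metis ennreal_cases less_irrefl)
  with assms c have **: "a' \<le> c'" "b' \<le> c'" "a' * b' \<le> c' * e'" "c' > 0"
    by (auto simp flip: ennreal_mult')
  \<comment> \<open>Expanding this product gives \<open>c' * (a' + b') \<le> c'^2 + a' * b'\<close>,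
    and the last term is at most \<open>c' * e'\<close>.\<close>
  have "0 \<le> (c' - a') * (c' - b')" using ** by simp
  then have "c' * (a' + b') \<le> c' * (c' + e')"
    using ** by (simp add: algebra_simps)
  then have "a' + b' \<le> c' + e'" using \<open>c' > 0\<close> by simp
  then show ?thesis using * by (simp flip: ennreal_plus)
qed

text \<open>Symmetrising the double integral in \<open>x\<close> and \<open>y\<close> reduces the
  claim to the two-point lattice formed by \<open>x \<le> y\<close>. There
  \<open>f3 x * f4 y\<close> dominates both terms on the left, and the product of the two sides'
  terms is compared through the hypothesis on the diagonal.\<close>

lemma four_functions_real_0:
  fixes f1 f2 f3 f4 :: "real \<Rightarrow> ennreal"
  assumes [measurable]: "f1 \<in> borel_measurable lborel" "f2 \<in> borel_measurable lborel"
    "f3 \<in> borel_measurable lborel" "f4 \<in> borel_measurable lborel"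
    and le: "\<And>x y. f1 x * f2 y \<le> f3 (min x y) * f4 (max x y)"
  shows "(\<integral>\<^sup>+x. f1 x \<partial>lborel) * (\<integral>\<^sup>+x. f2 x \<partial>lborel) \<le>
         (\<integral>\<^sup>+x. f3 x \<partial>lborel) * (\<integral>\<^sup>+x. f4 x \<partial>lborel)"
proof -
  have *: "f1 x * f2 y + f1 y * f2 x \<le> f3 x * f4 y + f3 y * f4 x" if "x \<le> y" for x y
  proof (rule ennreal_add_le_of_mult_le)
    show "f1 x * f2 y \<le> f3 x * f4 y" "f1 y * f2 x \<le> f3 x * f4 y"
      using le[of x y] le[of y x] that by (auto simp: min_def max_def split: if_splits)
    have "(f1 x * f2 x) * (f1 y * f2 y) \<le> (f3 x * f4 x) * (f3 y * f4 y)"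
      using le[of x x] le[of y y] by (intro mult_mono[of "f1 x * f2 x" _ "f1 y * f2 y"]) auto
    then show "f1 x * f2 y * (f1 y * f2 x) \<le> f3 x * f4 y * (f3 y * f4 x)"
      by (simp add: mult_ac)
  qed
  have sym: "f1 x * f2 y + f1 y * f2 x \<le> f3 x * f4 y + f3 y * f4 x" for x y
    using *[of x y] *[of y x] by (cases "x \<le> y") (auto simp: add_ac)
  have expand: "(\<integral>\<^sup>+x. \<integral>\<^sup>+y. f x * g y + f y * g x \<partial>lborel \<partial>lborel) =
      2 * ((\<integral>\<^sup>+x. f x \<partial>lborel) * (\<integral>\<^sup>+x. g x \<partial>lborel))"
    if [measurable]: "f \<in> borel_measurable lborel" "g \<in> borel_measurable lborel"
    for f g :: "real \<Rightarrow> ennreal"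
    by (simp add: nn_integral_add nn_integral_cmult nn_integral_multc mult_2)
  have "2 * ((\<integral>\<^sup>+x. f1 x \<partial>lborel) * (\<integral>\<^sup>+x. f2 x \<partial>lborel)) \<le>
        2 * ((\<integral>\<^sup>+x. f3 x \<partial>lborel) * (\<integral>\<^sup>+x. f4 x \<partial>lborel))"
    unfolding expand[symmetric, OF assms(1,2)] expand[symmetric, OF assms(3,4)]
    by (intro nn_integral_mono sym)
  then show ?thesis
    by (simp add: ennreal_mult_le_mult_iff)
qed

text \<open>Translation invariance of Lebesgue measure: replacing \<open>y\<close> by
  \<open>y - d\<close> in \<open>f2\<close> and \<open>f4\<close> turns the shifted meet and join
  into the plain ones.\<close>

lemma four_functions_real:
  fixes f1 f2 f3 f4 :: "real \<Rightarrow> ennreal"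
  assumes [measurable]: "f1 \<in> borel_measurable lborel" "f2 \<in> borel_measurable lborel"
    "f3 \<in> borel_measurable lborel" "f4 \<in> borel_measurable lborel"
    and le: "\<And>x y. f1 x * f2 y \<le> f3 (min x (y + d)) * f4 (max x (y + d) - d)"
  shows "(\<integral>\<^sup>+x. f1 x \<partial>lborel) * (\<integral>\<^sup>+x. f2 x \<partial>lborel) \<le>
         (\<integral>\<^sup>+x. f3 x \<partial>lborel) * (\<integral>\<^sup>+x. f4 x \<partial>lborel)"
proof -
  have shift: "(\<integral>\<^sup>+x. f x \<partial>lborel) = (\<integral>\<^sup>+x. f (x - d) \<partial>lborel)"
    if [measurable]: "f \<in> borel_measurable lborel" for f :: "real \<Rightarrow> ennreal"
    using nn_integral_real_affine[of f 1 "- d"] that by simp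
  have "(\<integral>\<^sup>+x. f1 x \<partial>lborel) * (\<integral>\<^sup>+x. f2 (x - d) \<partial>lborel) \<le>
         (\<integral>\<^sup>+x. f3 x \<partial>lborel) * (\<integral>\<^sup>+x. f4 (x - d) \<partial>lborel)"
  proof (rule four_functions_real_0)
    show "f1 x * f2 (y - d) \<le> f3 (min x y) * f4 (max x y - d)" for x y
      using le[of x "y - d"] by simp
  qed measurable
  then show ?thesis by (simp flip: shift)
qed

text \<open>
  The hypothesis is quantified over arbitrary \<open>m\<close> and \<open>M\<close> that agree on \<open>L\<close> with the shifted
  meet and join, because the points of the product space are undefined outside \<open>L\<close>.
\<close>

lemma four_functions_PiM:
  fixes f1 f2 f3 f4 :: "('i \<Rightarrow> real) \<Rightarrow> ennreal"
  assumes "finite L"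
    and "f1 \<in> borel_measurable (PiM L (\<lambda>_. lborel))" "f2 \<in> borel_measurable (PiM L (\<lambda>_. lborel))"
    "f3 \<in> borel_measurable (PiM L (\<lambda>_. lborel))" "f4 \<in> borel_measurable (PiM L (\<lambda>_. lborel))"
    and "\<And>x y m M. (\<And>i. i \<in> L \<Longrightarrow> m i = min (x i) (y i + d i) \<and> M i = max (x i) (y i + d i) - d i)
           \<Longrightarrow> f1 x * f2 y \<le> f3 m * f4 M"
  shows "(\<integral>\<^sup>+x. f1 x \<partial>PiM L (\<lambda>_. lborel)) * (\<integral>\<^sup>+x. f2 x \<partial>PiM L (\<lambda>_. lborel)) \<le>
         (\<integral>\<^sup>+x. f3 x \<partial>PiM L (\<lambda>_. lborel)) * (\<integral>\<^sup>+x. f4 x \<partial>PiM L (\<lambda>_. lborel))"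
  using assms
proof (induction L arbitrary: f1 f2 f3 f4 rule: finite_induct)
  case empty
  interpret product_sigma_finite "\<lambda>_. lborel :: real measure" ..
  show ?case
    using empty(5)[of "\<lambda>_. undefined" "\<lambda>_. undefined"  "\<lambda>_. undefined" "\<lambda>_. undefined"]
    by (simp add: PiM_empty nn_integral_count_space_finite)
next
  case (insert k L)
  interpret product_sigma_finite "\<lambda>_. lborel :: real measure" ..
  note [measurable] = insert.prems(1-4)
  have upd: "(\<lambda>x. f (x(k := s))) \<in> borel_measurable (PiM L (\<lambda>_. lborel))"
    if [measurable]: "f \<in> borel_measurable (PiM (insert k L) (\<lambda>_. lborel))"
    for f :: "('i \<Rightarrow> real) \<Rightarrow> ennreal" and s
    by measurable
  have meas: "(\<lambda>s. \<integral>\<^sup>+x. f (x(k := s)) \<partial>PiM L (\<lambda>_. lborel)) \<in> borel_measurable lborel"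
    if [measurable]: "f \<in> borel_measurable (PiM (insert k L) (\<lambda>_. lborel))"
    for f :: "('i \<Rightarrow> real) \<Rightarrow> ennreal"
  proof -
    interpret sigma_finite_measure "PiM L (\<lambda>_. lborel :: real measure)"
      by (rule sigma_finite) (rule insert)
    have "(\<lambda>(s, x). x(k := s)) \<in> lborel \<Otimes>\<^sub>M PiM L (\<lambda>_. lborel) \<rightarrow>\<^sub>M PiM (insert k L) (\<lambda>_. lborel)"
      by measurable
    then show ?thesis
      by measurable
  qed
  show ?case
    unfolding product_nn_integral_insert_rev[OF insert.hyps insert.prems(1)]
      product_nn_integral_insert_rev[OF insert.hyps insert.prems(2)]
      product_nn_integral_insert_rev[OF insert.hyps insert.prems(3)]
      product_nn_integral_insert_rev[OF insert.hyps insert.prems(4)]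
  \<comment> \<open>With coordinate \<open>k\<close> frozen at \<open>s\<close> and
    \<open>t\<close>, the induction hypothesis on \<open>L\<close> is exactly the one-dimensional
    hypothesis for the partial integrals over \<open>L\<close>.\<close>
  proof (rule four_functions_real[where d = "d k"])
    fix s t
    show "(\<integral>\<^sup>+x. f1 (x(k := s)) \<partial>PiM L (\<lambda>_. lborel)) * (\<integral>\<^sup>+x. f2 (x(k := t)) \<partial>PiM L (\<lambda>_. lborel)) \<le>
       (\<integral>\<^sup>+x. f3 (x(k := min s (t + d k))) \<partial>PiM L (\<lambda>_. lborel)) *
       (\<integral>\<^sup>+x. f4 (x(k := max s (t + d k) - d k)) \<partial>PiM L (\<lambda>_. lborel))"
      by (rule insert.IH; (intro upd insert.prems)?) auto
  qed (intro meas insert.prems)+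
qed

section \<open>Lattice and energy\<close>

lemma l1_norm_nonneg: "0 \<le> l1_norm z"
  by (simp add: l1_norm_def sum_nonneg)

lemma l1_norm_minus: "l1_norm (- z) = l1_norm z"
  by (simp add: l1_norm_def)

lemma l1_norm_minus_commute: "l1_norm (x - y) = l1_norm (y - x)"
  using l1_norm_minus[of "x - y"] by simp

lemma l1_norm_triangle: "l1_norm (x + y) \<le> l1_norm x + l1_norm y"
  unfolding l1_norm_def sum.distrib[symmetric] by (intro sum_mono) (simp add: abs_triangle_ineq)

lemma l1_norm_pos: "z \<noteq> 0 \<Longrightarrow> 0 < l1_norm z"
proof -
  assume "z \<noteq> 0"
  then obtain k where "z $ k \<noteq> 0" by (auto simp: vec_eq_iff)
  then show ?thesis unfolding l1_norm_def by (intro sum_pos2[of _ k]) auto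
qed

lemma finite_l1_ball: "finite {z :: int ^ 'n. l1_norm z \<le> N}"
proof (rule finite_subset)
  show "{z :: int ^ 'n. l1_norm z \<le> N} \<subseteq> vec_lambda ` (PiE UNIV (\<lambda>_. {-N..N}))"
  proof
    fix z :: "int ^ 'n" assume z: "z \<in> {z. l1_norm z \<le> N}"
    have "\<bar>z $ k\<bar> \<le> l1_norm z" for k
      unfolding l1_norm_def by (rule member_le_sum) auto
    then have "\<bar>z $ k\<bar> \<le> N" for k
      using z order_trans by blast
    then have "vec_nth z \<in> PiE UNIV (\<lambda>_. {-N..N})"
      by (auto simp: PiE_def abs_le_iff minus_le_iff)
    then show "z \<in> vec_lambda ` (PiE UNIV (\<lambda>_. {-N..N}))"
      by (intro image_eqI[of _ _ "vec_nth z"]) auto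
  qed
qed (intro finite_imageI finite_PiE, auto)

lemma neighbours_commute: "neighbours i j \<longleftrightarrow> neighbours j i"
  by (simp add: neighbours_def l1_norm_minus_commute[of i])

text \<open>The degree of the lattice graph, 2n; the \<open>itself\<close> argument carries the
  dimension.\<close>

definition coordination_number :: "'n::finite itself \<Rightarrow> nat" where
  "coordination_number _ = card {z :: int ^ 'n. l1_norm z = 1}"

lemma neighbours_translate: "{j. neighbours i j} = (\<lambda>z. i + z) ` {z. l1_norm z = 1}"
  by (force simp: neighbours_def image_iff intro: exI[of _ "_ - i"])

lemma finite_neighbours: "finite {j. neighbours i j}"
  unfolding neighbours_translate
  by (intro finite_imageI finite_subset[OF _ finite_l1_ball[of 1]]) auto

lemma card_neighbours: "card {j. neighbours (i :: int ^ 'n) j} = coordination_number TYPE('n)"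
  unfolding neighbours_translate coordination_number_def by (rule card_image) (auto simp: inj_on_def)

lemma finite_bonds:
  assumes "finite \<Lambda>"
  shows "finite {(i, j). neighbours i j \<and> (i \<in> \<Lambda> \<or> j \<in> \<Lambda>)}"
proof (rule finite_subset)
  show "{(i, j). neighbours i j \<and> (i \<in> \<Lambda> \<or> j \<in> \<Lambda>)} \<subseteq>
      (SIGMA i:\<Lambda>. {j. neighbours i j}) \<union> prod.swap ` (SIGMA i:\<Lambda>. {j. neighbours i j})"
    by (auto simp: image_iff neighbours_commute)
qed (use assms finite_neighbours in auto)

text \<open>Bonds are ordered pairs, so each site of \<Lambda> is the first endpoint of as many of
  them as its degree, those leaving \<Lambda> included.\<close>

lemma sum_bonds_fst:
  fixes g :: "int ^ 'n \<Rightarrow> real"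
  assumes "finite \<Lambda>" and g: "\<And>i. i \<notin> \<Lambda> \<Longrightarrow> g i = 0"
  shows "(\<Sum>(i, j) \<in> {(i, j). neighbours i j \<and> (i \<in> \<Lambda> \<or> j \<in> \<Lambda>)}. g i) =
    coordination_number TYPE('n) * (\<Sum>i\<in>\<Lambda>. g i)"
proof -
  have "(\<Sum>(i, j) \<in> {(i, j). neighbours i j \<and> (i \<in> \<Lambda> \<or> j \<in> \<Lambda>)}. g i) =
      (\<Sum>(i, j) \<in> (SIGMA i:\<Lambda>. {j. neighbours i j}). g i)"
    by (rule sum.mono_neutral_right) (use assms finite_bonds in auto)
  also have "\<dots> = (\<Sum>i\<in>\<Lambda>. \<Sum>j\<in>{j. neighbours i j}. g i)"
    by (rule sum.Sigma[symmetric]) (use assms finite_neighbours in auto)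
  finally show ?thesis
    by (simp add: card_neighbours sum_distrib_left)
qed

lemma sum_bonds_swap:
  "(\<Sum>(i, j) \<in> {(i, j). neighbours i j \<and> (i \<in> \<Lambda> \<or> j \<in> \<Lambda>)}. f i j) =
   (\<Sum>(i, j) \<in> {(i, j). neighbours i j \<and> (i \<in> \<Lambda> \<or> j \<in> \<Lambda>)}. f j i)"
  by (rule sum.reindex_bij_witness[of _ prod.swap prod.swap]) (auto simp: neighbours_commute)

text \<open>The bounds on the second derivatives appear integrated, as bounds on the increments of
  \<open>V'\<close> and \<open>W'\<close>; this is the form in which the mean value theorem consumes
  them.\<close>

locale convex_spins =
  fixes V V' W W' :: "real \<Rightarrow> real" and v w \<beta> :: real
  assumes V: "\<And>x. (V has_real_derivative V' x) (at x)"
    and W: "\<And>x. (W has_real_derivative W' x) (at x)"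
    and V'_incr: "\<And>x y. x \<le> y \<Longrightarrow> v * (y - x) \<le> V' y - V' x"
    and W'_mono: "\<And>x y. x \<le> y \<Longrightarrow> W' x \<le> W' y"
    and W'_lip: "\<And>x y. x \<le> y \<Longrightarrow> W' y - W' x \<le> w * (y - x)"
    and v_pos: "0 < v" and \<beta>_pos: "0 < \<beta>"
begin

lemma w_nonneg: "0 \<le> w"
  using W'_lip[of 0 1] W'_mono[of 0 1] by simp

text \<open>The mean value theorem in \<open>u\<close>, applied to the increment of \<open>V\<close>
  over \<open>d\<close>, reduces this mixed second difference to an increment of \<open>V'\<close>
  over \<open>d\<close>.\<close>

lemma V_exchange:
  assumes "0 \<le> u" "0 \<le> d"
  shows "v * u * d \<le> V (y + d + u) - V (y + u) - V (y + d) + V y"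
proof (cases "u = 0")
  case False
  then have "0 < u" using assms by simp
  have "\<exists>z>0. z < u \<and> (V (y + d + u) - V (y + u)) - (V (y + d + 0) - V (y + 0)) =
      (u - 0) * (V' (y + d + z) - V' (y + z))"
    by (rule MVT2[OF \<open>0 < u\<close>])
      (auto intro!: derivative_eq_intros DERIV_chain'[where g = V] V)
  then obtain z where z: "V (y + d + u) - V (y + u) - (V (y + d) - V y) = u * (V' (y + d + z) - V' (y + z))"
    by auto
  have "v * d \<le> V' (y + d + z) - V' (y + z)"
    using V'_incr[of "y + z" "y + d + z"] assms by simp
  then have "u * (v * d) \<le> u * (V' (y + d + z) - V' (y + z))"
    using assms by (intro mult_left_mono)
  then show ?thesis using z by (simp add: algebra_simps)
qed simp

text \<open>If \<delta> does not exceed \<open>X - Y\<close>, the new arguments lie between the old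
  ones and convexity makes the right-hand side nonnegative. Otherwise the overshoot
  \<open>Y - X + \<delta>\<close> is at most \<open>e\<close>, and over it \<open>W'\<close> grows
  by at most \<open>w * e\<close>.\<close>

lemma W_exchange:
  assumes "0 \<le> \<delta>" "0 \<le> e" "Y - X + \<delta> \<le> e"
  shows "- w * \<delta> * e \<le> W X + W Y - W (X - \<delta>) - W (Y + \<delta>)"
proof (cases "\<delta> = 0")
  case False
  then have "0 < \<delta>" using assms by simp
  have "\<exists>z>0. z < \<delta> \<and> (W (X - \<delta> + \<delta>) - W (Y + \<delta>)) - (W (X - \<delta> + 0) - W (Y + 0)) =
      (\<delta> - 0) * (W' (X - \<delta> + z) - W' (Y + z))"
    by (rule MVT2[OF \<open>0 < \<delta>\<close>])
      (auto intro!: derivative_eq_intros DERIV_chain'[where g = W] W)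
  then obtain z where z: "W X - W (Y + \<delta>) - (W (X - \<delta>) - W Y) = \<delta> * (W' (X - \<delta> + z) - W' (Y + z))"
    by auto
  have "- w * e \<le> W' (X - \<delta> + z) - W' (Y + z)"
  proof (cases "X - \<delta> \<le> Y")
    case True
    have "W' (Y + z) - W' (X - \<delta> + z) \<le> w * ((Y + z) - (X - \<delta> + z))"
      using True by (intro W'_lip) simp
    also have "\<dots> \<le> w * e"
      using assms w_nonneg by (intro mult_left_mono) auto
    finally show ?thesis by simp
  next
    case False
    then have "0 \<le> W' (X - \<delta> + z) - W' (Y + z)" using W'_mono by simp
    then show ?thesis using mult_nonneg_nonneg[OF w_nonneg \<open>0 \<le> e\<close>] by linarith
  qed
  then have "\<delta> * (- w * e) \<le> \<delta> * (W' (X - \<delta> + z) - W' (Y + z))"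
    using assms by (intro mult_left_mono)
  then show ?thesis using z by (simp add: algebra_simps)
qed simp

text \<open>The excess \<open>u\<close> encodes the shifted lattice operations:
  \<open>x - u = min x (y + d)\<close> and \<open>y + u = max x (y + d) - d\<close>.\<close>

lemma V_exchange_max:
  assumes "0 \<le> d" "u = max 0 (x - y - d)"
  shows "v * u * d \<le> V x + V y - V (x - u) - V (y + u)"
proof (cases "x - y - d \<le> 0")
  case False
  then have u: "0 \<le> u" and x: "x = y + d + u" using assms by simp_all
  show ?thesis using V_exchange[OF u \<open>0 \<le> d\<close>, of y] unfolding x by (simp add: algebra_simps)
qed (use assms in simp)

text \<open>If the two excesses differ, the larger one is positive and equals its untruncated value,
  while the smaller one is at least its untruncated value. This bounds the overshoot in
  \<open>W_exchange\<close> by a difference of \<open>di\<close> and \<open>dj\<close>, the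
  variation of the shift along the bond. The bound is written symmetrically so that it can be summed
  over ordered bonds.\<close>

lemma W_exchange_max:
  assumes u: "ui = max 0 (xi - yi - di)" "uj = max 0 (xj - yj - dj)"
    and e: "0 \<le> ei" "0 \<le> ej" "dj - di \<le> ei" "di - dj \<le> ej"
  shows "- w * (ui * ei + uj * ej) \<le>
    W (xj - xi) + W (yj - yi) - W ((xj - uj) - (xi - ui)) - W ((yj + uj) - (yi + ui))"
proof -
  have pos: "0 \<le> w * (ui * ei)" "0 \<le> w * (uj * ej)"
    using u e w_nonneg by auto
  show ?thesis
  proof (cases "ui \<le> uj")
    case True
    have "- w * (uj - ui) * ej \<le> W (xj - xi) + W (yj - yi) -
        W (xj - xi - (uj - ui)) - W (yj - yi + (uj - ui))"
    proof (cases "uj = ui")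
      case False
      then have "uj = xj - yj - dj" using True u by (auto simp: max_def split: if_splits)
      then show ?thesis using True u e by (intro W_exchange) (auto simp: max_def)
    qed simp
    moreover have "w * (uj - ui) * ej \<le> w * (uj * ej)"
      using mult_nonneg_nonneg[OF w_nonneg mult_nonneg_nonneg[of ui ej]] u e by (simp add: algebra_simps)
    ultimately show ?thesis using pos by (simp add: algebra_simps)
  next
    case False
    have "ui = xi - yi - di" using False u by (auto simp: max_def split: if_splits)
    then have "- w * (ui - uj) * ei \<le> W (yj - yi) + W (xj - xi) -
        W (yj - yi - (ui - uj)) - W (xj - xi + (ui - uj))"
      using False u e by (intro W_exchange) (auto simp: max_def)
    moreover have "w * (ui - uj) * ei \<le> w * (ui * ei)"
      using mult_nonneg_nonneg[OF w_nonneg mult_nonneg_nonneg[of uj ei]] u e by (simp add: algebra_simps)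
    ultimately show ?thesis using pos by (simp add: algebra_simps)
  qed
qed

text \<open>
  Replacing the pair \<open>(x, y)\<close> by the shifted meet and join \<open>(x - u, y + u)\<close> lowers the energy: what
  the interaction loses because \<open>d\<close> is not constant is compensated by the convexity of \<open>V\<close>.
\<close>

lemma local_hamiltonian_exchange:
  fixes x y d u :: "int ^ 'n \<Rightarrow> real"
  assumes "finite \<Lambda>" and "1 \<le> r" and d: "\<And>i. 0 \<le> d i" "\<And>i j. neighbours i j \<Longrightarrow> d j \<le> r * d i"
    and u: "u = (\<lambda>i. max 0 (x i - y i - d i))" and out: "\<And>i. i \<notin> \<Lambda> \<Longrightarrow> x i \<le> y i + d i"
  shows "(v - w * coordination_number TYPE('n) * (r - 1)) * (\<Sum>i\<in>\<Lambda>. u i * d i) \<le>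
    local_hamiltonian V W \<Lambda> x + local_hamiltonian V W \<Lambda> y -
    local_hamiltonian V W \<Lambda> (\<lambda>i. x i - u i) - local_hamiltonian V W \<Lambda> (\<lambda>i. y i + u i)"
proof -
  let ?E = "{(i, j). neighbours i j \<and> (i \<in> \<Lambda> \<or> j \<in> \<Lambda>)}"
  let ?N = "real (coordination_number TYPE('n))"
  let ?S = "\<Sum>i\<in>\<Lambda>. u i * d i"
  have u0: "u i * d i = 0" if "i \<notin> \<Lambda>" for i
    using out[OF that] u by simp
  have "v * ?S \<le> (\<Sum>i\<in>\<Lambda>. V (x i) + V (y i) - V (x i - u i) - V (y i + u i))"
    unfolding sum_distrib_left using d u
    by (intro sum_mono) (simp add: mult.assoc[symmetric] V_exchange_max)
  moreover have "- w * (r - 1) * (2 * ?N * ?S) \<le> (\<Sum>(i, j) \<in> ?E. W (x j - x i) + W (y j - y i)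
      - W ((x j - u j) - (x i - u i)) - W ((y j + u j) - (y i + u i)))"
  proof -
    \<comment> \<open>Each ordered bond contributes at both ends; the resulting factor 2 cancels the
      1/2 in front of the interaction.\<close>
    have sum_eq: "(\<Sum>(i, j) \<in> ?E. u i * d i + u j * d j) = 2 * ?N * ?S"
      using sum_bonds_fst[of \<Lambda> "\<lambda>i. u i * d i", OF \<open>finite \<Lambda>\<close> u0]
        sum_bonds_swap[of "\<lambda>i j. u i * d i" \<Lambda>]
      by (simp add: sum.distrib case_prod_unfold)
    have "- w * (r - 1) * (2 * ?N * ?S) = (\<Sum>(i, j) \<in> ?E. - w * (u i * ((r - 1) * d i) + u j * ((r - 1) * d j)))"
      unfolding sum_eq[symmetric] by (simp add: sum_distrib_left case_prod_unfold algebra_simps)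
    also have "\<dots> \<le> (\<Sum>(i, j) \<in> ?E. W (x j - x i) + W (y j - y i)
      - W ((x j - u j) - (x i - u i)) - W ((y j + u j) - (y i + u i)))"
    proof (rule sum_mono, clarify)
      fix i j :: "int ^ 'n" assume "neighbours i j"
      then have "d j \<le> r * d i" "d i \<le> r * d j"
        using d(2) neighbours_commute by blast+
      then show "- w * (u i * ((r - 1) * d i) + u j * ((r - 1) * d j)) \<le> W (x j - x i) + W (y j - y i)
      - W ((x j - u j) - (x i - u i)) - W ((y j + u j) - (y i + u i))"
        using mult_right_mono[OF \<open>1 \<le> r\<close> d(1)[of i]] mult_right_mono[OF \<open>1 \<le> r\<close> d(1)[of j]] u
          by (intro W_exchange_max) (auto simp: algebra_simps)
    qed
    finally show ?thesis .
  qed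
  ultimately show ?thesis
    unfolding local_hamiltonian_def
    by (simp add: case_prod_unfold sum.distrib sum_subtractf algebra_simps)
qed

end

section \<open>Finite-volume Gibbs measures\<close>

lemma space_config_space [simp]: "space config_space = UNIV"
  by (auto simp: config_space_def space_PiM)

lemma measurable_config_component: "(\<lambda>\<omega>. \<omega> i) \<in> borel_measurable config_space"
  unfolding config_space_def by measurable

lemma measurable_config_space:
  assumes "\<And>i. (\<lambda>x. f x i) \<in> borel_measurable M"
  shows "f \<in> M \<rightarrow>\<^sub>M config_space"
  unfolding config_space_def using assms by (intro measurable_PiM_single') auto

lemma measurable_merge_config [measurable]:
  assumes [measurable]: "f \<in> M \<rightarrow>\<^sub>M PiM \<Lambda> (\<lambda>_. lborel)" "g \<in> M \<rightarrow>\<^sub>M config_space"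
  shows "(\<lambda>x. merge \<Lambda> (- \<Lambda>) (f x, g x)) \<in> M \<rightarrow>\<^sub>M config_space"
proof (rule measurable_config_space)
  fix i
  note [measurable] = measurable_compose[OF assms(2) measurable_config_component]
  have "(\<lambda>x. f x i) \<in> borel_measurable M" if "i \<in> \<Lambda>"
    using measurable_compose[OF assms(1) measurable_component_singleton[OF that]] by simp
  then show "(\<lambda>x. merge \<Lambda> (- \<Lambda>) (f x, g x) i) \<in> borel_measurable M"
    by (cases "i \<in> \<Lambda>") (auto simp: merge_def)
qed

lemma sets_gibbs_kernel [simp, measurable_cong]: "sets (gibbs_kernel V W \<beta> \<Lambda> \<eta>) = sets config_space"
  by (simp add: gibbs_kernel_def)

lemma space_gibbs_kernel [simp]: "space (gibbs_kernel V W \<beta> \<Lambda> \<eta>) = UNIV"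
  by (simp add: gibbs_kernel_def)

lemma integral_gibbs_kernel_cong:
  fixes f g :: "(int ^ 'n \<Rightarrow> real) \<Rightarrow> real"
  assumes [measurable]: "f \<in> borel_measurable config_space" "g \<in> borel_measurable config_space"
    and "\<And>x. (\<And>i. i \<notin> \<Lambda> \<Longrightarrow> x i = \<eta> i) \<Longrightarrow> f x = g x"
  shows "(\<integral>x. f x \<partial>gibbs_kernel V W \<beta> \<Lambda> \<eta>) = (\<integral>x. g x \<partial>gibbs_kernel V W \<beta> \<Lambda> \<eta>)"
  unfolding gibbs_kernel_def using assms(3)
  by (subst (1 2) integral_distr) (auto intro!: Bochner_Integration.integral_cong)

lemma space_PiM_lborel_not_null:
  assumes "finite L"
  shows "emeasure (PiM L (\<lambda>_. lborel :: real measure)) (space (PiM L (\<lambda>_. lborel))) \<noteq> 0"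
proof -
  interpret product_sigma_finite "\<lambda>_. lborel :: real measure" ..
  show ?thesis using assms by (simp add: space_PiM emeasure_PiM)
qed

lemma boltzmann_weight_cong:
  assumes "\<And>i. i \<notin> \<Lambda> \<Longrightarrow> \<eta> i = \<eta>' i"
  shows "boltzmann_weight V W \<beta> \<Lambda> \<eta> x = boltzmann_weight V W \<beta> \<Lambda> \<eta>' x"
proof -
  have "merge \<Lambda> (- \<Lambda>) (x, \<eta>) = merge \<Lambda> (- \<Lambda>) (x, \<eta>')"
    using assms by (auto simp: merge_def)
  then show ?thesis by (simp add: boltzmann_weight_def)
qed

lemma gibbs_kernel_cong:
  assumes "\<And>i. i \<notin> \<Lambda> \<Longrightarrow> \<eta> i = \<eta>' i"
  shows "gibbs_kernel V W \<beta> \<Lambda> \<eta> = gibbs_kernel V W \<beta> \<Lambda> \<eta>'"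
proof -
  have "merge \<Lambda> (- \<Lambda>) (x, \<eta>) = merge \<Lambda> (- \<Lambda>) (x, \<eta>')" for x
    using assms by (auto simp: merge_def)
  moreover have "boltzmann_weight V W \<beta> \<Lambda> \<eta> = boltzmann_weight V W \<beta> \<Lambda> \<eta>'"
    using assms by (intro ext boltzmann_weight_cong) auto
  ultimately show ?thesis by (simp add: gibbs_kernel_def)
qed

context convex_spins
begin

lemma measurable_V [measurable]: "V \<in> borel_measurable borel"
  by (intro borel_measurable_continuous_onI DERIV_continuous_on) (rule V)

lemma measurable_W [measurable]: "W \<in> borel_measurable borel"
  by (intro borel_measurable_continuous_onI DERIV_continuous_on) (rule W)

lemma measurable_local_hamiltonian [measurable]:
  "local_hamiltonian V W \<Lambda> \<in> borel_measurable config_space"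
proof -
  note [measurable] = measurable_config_component
  show ?thesis unfolding local_hamiltonian_def[abs_def] case_prod_unfold by measurable
qed

lemma measurable_boltzmann_weight [measurable]:
  assumes [measurable]: "f \<in> M \<rightarrow>\<^sub>M PiM \<Lambda> (\<lambda>_. lborel)" "g \<in> M \<rightarrow>\<^sub>M config_space"
  shows "(\<lambda>x. boltzmann_weight V W \<beta> \<Lambda> (g x) (f x)) \<in> borel_measurable M"
  unfolding boltzmann_weight_def by measurable

section \<open>Normalisability of the Boltzmann weight\<close>

lemma V_ge_quadratic: "V 0 + V' 0 * x + v * x\<^sup>2 / 2 \<le> V x"
proof -
  define G where "G y = V y - V' 0 * y - v * y\<^sup>2 / 2" for y
  have G: "(G has_real_derivative (V' y - V' 0 - v * y)) (at y)" for y
    unfolding G_def[abs_def] by (auto intro!: derivative_eq_intros V)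
  have "G 0 \<le> G x"
  proof (cases "0 \<le> x")
    case True
    show ?thesis
    proof (rule DERIV_nonneg_imp_nondecreasing[OF True])
      fix y assume "0 \<le> y" "y \<le> x"
      then show "\<exists>z. (G has_real_derivative z) (at y) \<and> 0 \<le> z"
        using G[of y] V'_incr[of 0 y] by auto
    qed
  next
    case False
    show ?thesis
    proof (rule DERIV_nonpos_imp_nonincreasing[of x 0 G])
      show "x \<le> 0" using False by simp
      fix y assume "x \<le> y" "y \<le> 0"
      then show "\<exists>z. (G has_real_derivative z) (at y) \<and> z \<le> 0"
        using G[of y] V'_incr[of y 0] by (intro exI[of _ "V' y - V' 0 - v * y"]) simp
    qed
  qed
  then show ?thesis by (simp add: G_def)
qed

lemma integral_exp_V_finite: "(\<integral>\<^sup>+x. ennreal (exp (- \<beta> * V x)) \<partial>lborel) < \<infinity>"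
proof -
  \<comment> \<open>Completing the square in the bound of \<open>V_ge_quadratic\<close>:
    \<open>m\<close> and \<open>s\<close> are the mean and the deviation of the dominating Gaussian,
    and \<open>C\<close> collects the remaining constants.\<close>
  define m where "m = - V' 0 / v"
  define s where "s = 1 / sqrt (\<beta> * v)"
  define C where "C = exp (- \<beta> * V 0 + \<beta> * (V' 0)\<^sup>2 / (2 * v)) * sqrt (2 * pi * s\<^sup>2)"
  have s: "0 < s" "s\<^sup>2 = 1 / (\<beta> * v)"
    using v_pos \<beta>_pos by (auto simp: s_def power_divide)
  have *: "exp (- \<beta> * V x) \<le> C * normal_density m s x" for x
  proof -
    have "- \<beta> * V x \<le> - \<beta> * (V 0 + V' 0 * x + v * x\<^sup>2 / 2)"
      using V_ge_quadratic[of x] \<beta>_pos by simp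
    also have "\<dots> = - \<beta> * V 0 + \<beta> * (V' 0)\<^sup>2 / (2 * v) - (x - m)\<^sup>2 / (2 * s\<^sup>2)"
      using v_pos \<beta>_pos unfolding s(2) m_def by (simp add: field_simps power2_eq_square)
    finally have "exp (- \<beta> * V x) \<le>
        exp (- \<beta> * V 0 + \<beta> * (V' 0)\<^sup>2 / (2 * v)) * exp (- (x - m)\<^sup>2 / (2 * s\<^sup>2))"
      by (simp flip: exp_add)
    also have "\<dots> = C * normal_density m s x"
      using s(1) by (simp add: C_def normal_density_def)
    finally show ?thesis .
  qed
  have "integrable lborel (\<lambda>x. exp (- \<beta> * V x))"
  proof (rule Bochner_Integration.integrable_bound)
    show "integrable lborel (\<lambda>x. C * normal_density m s x)"
      using s by (intro integrable_mult_right integrable_normal_density)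
    have "0 \<le> C * normal_density m s x" for x by (simp add: C_def)
    then show "AE x in lborel. norm (exp (- \<beta> * V x)) \<le> norm (C * normal_density m s x)"
      using * by auto
  qed measurable
  then show ?thesis by (simp add: integrable_iff_bounded)
qed

text \<open>\<open>W\<close> itself may be unbounded below, for instance linear. Its symmetrisation
  is convex and even, hence minimal at 0, and every bond occurs in the Hamiltonian in both
  orientations.\<close>

lemma W_symmetrized_ge: "2 * W 0 \<le> W z + W (- z)"
proof -
  have *: "2 * W 0 \<le> W z + W (- z)" if "0 \<le> z" for z :: real
  proof -
    have "W 0 + W (- 0) \<le> W z + W (- z)"
    proof (rule DERIV_nonneg_imp_nondecreasing[OF that])
      fix y :: real assume "0 \<le> y"
      then have "0 \<le> W' y - W' (- y)" using W'_mono[of "- y" y] by simp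
      moreover have "((\<lambda>y::real. W y + W (- y)) has_real_derivative (W' y - W' (- y))) (at y)"
        by (auto intro!: derivative_eq_intros DERIV_chain'[where f = uminus and g = W] W)
      ultimately show "\<exists>D. ((\<lambda>y. W y + W (- y)) has_real_derivative D) (at y) \<and> 0 \<le> D" by blast
    qed
    then show ?thesis by simp
  qed
  show ?thesis using *[of z] *[of "- z"] by (cases "0 \<le> z") auto
qed

lemma local_hamiltonian_ge:
  "(\<Sum>i\<in>\<Lambda>. V (\<omega> i)) + (1/2) * (card {(i, j). neighbours i j \<and> (i \<in> \<Lambda> \<or> j \<in> \<Lambda>)} * W 0)
    \<le> local_hamiltonian V W \<Lambda> \<omega>"
proof -
  let ?E = "{(i, j). neighbours i j \<and> (i \<in> \<Lambda> \<or> j \<in> \<Lambda>)}"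
  have "2 * (card ?E * W 0) = (\<Sum>(i, j)\<in>?E. 2 * W 0)" by simp
  also have "\<dots> \<le> (\<Sum>(i, j)\<in>?E. W (\<omega> j - \<omega> i) + W (\<omega> i - \<omega> j))"
    using W_symmetrized_ge[of "\<omega> _ - \<omega> _"] by (intro sum_mono) auto
  also have "\<dots> = 2 * (\<Sum>(i, j)\<in>?E. W (\<omega> j - \<omega> i))"
    using sum_bonds_swap[of "\<lambda>i j. W (\<omega> j - \<omega> i)" \<Lambda>] by (simp add: sum.distrib case_prod_unfold)
  finally show ?thesis unfolding local_hamiltonian_def by simp
qed

lemma partition_function_finite:
  assumes "finite \<Lambda>"
  shows "(\<integral>\<^sup>+y. boltzmann_weight V W \<beta> \<Lambda> \<eta> y \<partial>(\<Pi>\<^sub>M i\<in>\<Lambda>. lborel)) < \<infinity>"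
proof -
  interpret product_sigma_finite "\<lambda>_. lborel :: real measure" ..
  define C where "C = exp (- \<beta> * ((1/2) * (card {(i, j). neighbours i j \<and> (i \<in> \<Lambda> \<or> j \<in> \<Lambda>)} * W 0)))"
  have *: "boltzmann_weight V W \<beta> \<Lambda> \<eta> y \<le> ennreal C * (\<Prod>i\<in>\<Lambda>. ennreal (exp (- \<beta> * V (y i))))" for y
  proof -
    let ?\<omega> = "merge \<Lambda> (- \<Lambda>) (y, \<eta>)"
    have "(\<Sum>i\<in>\<Lambda>. V (?\<omega> i)) = (\<Sum>i\<in>\<Lambda>. V (y i))" by (simp add: merge_def)
    then have "- \<beta> * local_hamiltonian V W \<Lambda> ?\<omega> \<le> - \<beta> * ((\<Sum>i\<in>\<Lambda>. V (y i)) +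
        (1/2) * (card {(i, j). neighbours i j \<and> (i \<in> \<Lambda> \<or> j \<in> \<Lambda>)} * W 0))"
      using local_hamiltonian_ge[where \<Lambda>=\<Lambda> and \<omega>="?\<omega>"] \<beta>_pos by simp
    then have "exp (- \<beta> * local_hamiltonian V W \<Lambda> ?\<omega>) \<le> exp (- \<beta> * ((\<Sum>i\<in>\<Lambda>. V (y i)) +
        (1/2) * (card {(i, j). neighbours i j \<and> (i \<in> \<Lambda> \<or> j \<in> \<Lambda>)} * W 0)))"
      by (subst exp_le_cancel_iff)
    also have "\<dots> = C * (\<Prod>i\<in>\<Lambda>. exp (- \<beta> * V (y i)))"
      unfolding C_def using \<open>finite \<Lambda>\<close>
      by (simp add: exp_sum[symmetric] exp_add[symmetric] sum_distrib_left algebra_simps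
          flip: sum_negf)
    finally show ?thesis
      unfolding boltzmann_weight_def using \<open>finite \<Lambda>\<close>
      by (simp add: C_def prod_ennreal flip: ennreal_mult') (simp add: ennreal_leI)
  qed
  have "(\<integral>\<^sup>+y. boltzmann_weight V W \<beta> \<Lambda> \<eta> y \<partial>(\<Pi>\<^sub>M i\<in>\<Lambda>. lborel)) \<le>
     (\<integral>\<^sup>+y. ennreal C * (\<Prod>i\<in>\<Lambda>. ennreal (exp (- \<beta> * V (y i)))) \<partial>(\<Pi>\<^sub>M i\<in>\<Lambda>. lborel))"
    by (intro nn_integral_mono *)
  also have "\<dots> = ennreal C * (\<Prod>i\<in>\<Lambda>. (\<integral>\<^sup>+x. ennreal (exp (- \<beta> * V x)) \<partial>lborel))"
  proof (subst nn_integral_cmult)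
    have "(\<lambda>y. ennreal (exp (- \<beta> * V (y i)))) \<in> borel_measurable (\<Pi>\<^sub>M i\<in>\<Lambda>. lborel)" if "i \<in> \<Lambda>" for i
      using measurable_compose[OF measurable_component_singleton[OF that, of "\<lambda>_. lborel"],
          of "\<lambda>x. ennreal (exp (- \<beta> * V x))" borel] by simp
    then show "(\<lambda>y. \<Prod>i\<in>\<Lambda>. ennreal (exp (- \<beta> * V (y i)))) \<in> borel_measurable (\<Pi>\<^sub>M i\<in>\<Lambda>. lborel)"
      by (rule borel_measurable_prod_ennreal)
  qed (subst product_nn_integral_prod[OF \<open>finite \<Lambda>\<close>, of "\<lambda>_ x. ennreal (exp (- \<beta> * V x))"], simp_all)
  also have "\<dots> < \<infinity>"
    using integral_exp_V_finite by (simp add: ennreal_mult_less_top power_less_top_ennreal)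
  finally show ?thesis .
qed

lemma partition_function_pos:
  assumes "finite \<Lambda>"
  shows "(\<integral>\<^sup>+y. boltzmann_weight V W \<beta> \<Lambda> \<eta> y \<partial>(\<Pi>\<^sub>M i\<in>\<Lambda>. lborel)) \<noteq> 0"
proof
  have [measurable]: "boltzmann_weight V W \<beta> \<Lambda> \<eta> \<in> borel_measurable (\<Pi>\<^sub>M i\<in>\<Lambda>. lborel)"
    by measurable
  assume "(\<integral>\<^sup>+y. boltzmann_weight V W \<beta> \<Lambda> \<eta> y \<partial>(\<Pi>\<^sub>M i\<in>\<Lambda>. lborel)) = 0"
  then have "AE y in (\<Pi>\<^sub>M i\<in>\<Lambda>. lborel :: real measure). boltzmann_weight V W \<beta> \<Lambda> \<eta> y = 0"
    by (subst (asm) nn_integral_0_iff_AE) measurable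
  then have "AE y in (\<Pi>\<^sub>M i\<in>\<Lambda>. lborel :: real measure). False"
    by (rule AE_mp) (auto simp: boltzmann_weight_def)
  then have "emeasure (\<Pi>\<^sub>M i\<in>\<Lambda>. lborel :: real measure) (space (\<Pi>\<^sub>M i\<in>\<Lambda>. lborel)) = 0"
    by (simp add: AE_iff_measurable[OF sets.top])
  then show False
    using space_PiM_lborel_not_null[OF assms] by simp
qed

lemma nn_integral_gibbs_kernel:
  assumes [measurable]: "f \<in> borel_measurable config_space"
  shows "(\<integral>\<^sup>+x. f x \<partial>gibbs_kernel V W \<beta> \<Lambda> \<eta>) =
    (\<integral>\<^sup>+x. boltzmann_weight V W \<beta> \<Lambda> \<eta> x * f (merge \<Lambda> (- \<Lambda>) (x, \<eta>)) \<partial>(\<Pi>\<^sub>M i\<in>\<Lambda>. lborel)) /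
    (\<integral>\<^sup>+x. boltzmann_weight V W \<beta> \<Lambda> \<eta> x \<partial>(\<Pi>\<^sub>M i\<in>\<Lambda>. lborel))"
proof -
  have [measurable]: "(\<lambda>x. merge \<Lambda> (- \<Lambda>) (x, \<eta>)) \<in> (\<Pi>\<^sub>M i\<in>\<Lambda>. lborel) \<rightarrow>\<^sub>M config_space"
     "boltzmann_weight V W \<beta> \<Lambda> \<eta> \<in> borel_measurable (\<Pi>\<^sub>M i\<in>\<Lambda>. lborel)"
    by measurable
  show ?thesis
    unfolding gibbs_kernel_def
    by (subst nn_integral_distr, measurable, subst nn_integral_density, measurable,
        subst nn_integral_divide[symmetric], measurable, simp add: divide_ennreal_def mult_ac)
qed

lemma prob_space_gibbs_kernel:
  assumes "finite \<Lambda>"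
  shows "prob_space (gibbs_kernel V W \<beta> \<Lambda> \<eta>)"
proof
  have "emeasure (gibbs_kernel V W \<beta> \<Lambda> \<eta>) (space (gibbs_kernel V W \<beta> \<Lambda> \<eta>)) =
      (\<integral>\<^sup>+x. 1 \<partial>gibbs_kernel V W \<beta> \<Lambda> \<eta>)" by simp
  also have "\<dots> = 1"
    by (subst nn_integral_gibbs_kernel)
      (use partition_function_finite[OF assms] partition_function_pos[OF assms] in
        \<open>auto simp: ennreal_divide_self less_top\<close>)
  finally show "emeasure (gibbs_kernel V W \<beta> \<Lambda> \<eta>) (space (gibbs_kernel V W \<beta> \<Lambda> \<eta>)) = 1" .
qed

lemma measurable_gibbs_kernel:
  fixes \<Lambda> :: "(int ^ 'n) set"
  assumes "finite \<Lambda>"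
  shows "gibbs_kernel V W \<beta> \<Lambda> \<in> config_space \<rightarrow>\<^sub>M subprob_algebra config_space"
proof (rule measurable_subprob_algebra)
  fix A :: "(int ^ 'n \<Rightarrow> real) set" assume A: "A \<in> sets config_space"
  interpret product_sigma_finite "\<lambda>_. lborel :: real measure" ..
  interpret sigma_finite_measure "\<Pi>\<^sub>M i\<in>\<Lambda>. lborel :: real measure"
    by (rule sigma_finite) (rule assms)
  have "emeasure (gibbs_kernel V W \<beta> \<Lambda> \<eta>) A =
    (\<integral>\<^sup>+x. boltzmann_weight V W \<beta> \<Lambda> \<eta> x * indicator A (merge \<Lambda> (- \<Lambda>) (x, \<eta>)) \<partial>(\<Pi>\<^sub>M i\<in>\<Lambda>. lborel)) /
    (\<integral>\<^sup>+x. boltzmann_weight V W \<beta> \<Lambda> \<eta> x \<partial>(\<Pi>\<^sub>M i\<in>\<Lambda>. lborel))" for \<eta>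
    using A nn_integral_gibbs_kernel[of "indicator A" \<Lambda> \<eta>] by simp
  moreover note A[measurable]
  ultimately show "(\<lambda>\<eta>. emeasure (gibbs_kernel V W \<beta> \<Lambda> \<eta>) A) \<in> borel_measurable config_space"
    by simp
qed (use prob_space_gibbs_kernel[OF assms] in \<open>auto intro: prob_space_imp_subprob_space\<close>)

text \<open>The energy exchange leaves a factor
  \<open>exp (c r * (\<Sum>i\<in>\<Lambda>. u i * d i))\<close> to spare, which is offered to the
  test functions. \<open>nn_integral_gibbs_kernel_mono\<close> only uses that it is at least 1;
  \<open>gibbs_kernel_exp_le\<close> spends it.\<close>

lemma four_functions_gibbs_kernel:
  fixes d \<eta> \<eta>' :: "int ^ 'n \<Rightarrow> real" and f1 f2 f3 f4 :: "(int ^ 'n \<Rightarrow> real) \<Rightarrow> ennreal"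
  defines "c r \<equiv> \<beta> * (v - w * coordination_number TYPE('n) * (r - 1))"
  assumes "finite \<Lambda>" and "1 \<le> r" and d: "\<And>i. 0 \<le> d i" "\<And>i j. neighbours i j \<Longrightarrow> d j \<le> r * d i"
    and out: "\<And>i. i \<notin> \<Lambda> \<Longrightarrow> \<eta>' i \<le> \<eta> i + d i"
    and [measurable]: "f1 \<in> borel_measurable config_space" "f2 \<in> borel_measurable config_space"
      "f3 \<in> borel_measurable config_space" "f4 \<in> borel_measurable config_space"
    and le: "\<And>x y u. (\<And>i. i \<notin> \<Lambda> \<Longrightarrow> x i = \<eta>' i \<and> y i = \<eta> i) \<Longrightarrow> u = (\<lambda>i. max 0 (x i - y i - d i)) \<Longrightarrow>
      f1 x * f2 y \<le> ennreal (exp (c r * (\<Sum>i\<in>\<Lambda>. u i * d i))) * (f3 (\<lambda>i. x i - u i) * f4 (\<lambda>i. y i + u i))"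
  shows "(\<integral>\<^sup>+x. f1 x \<partial>gibbs_kernel V W \<beta> \<Lambda> \<eta>') * (\<integral>\<^sup>+x. f2 x \<partial>gibbs_kernel V W \<beta> \<Lambda> \<eta>) \<le>
    (\<integral>\<^sup>+x. f3 x \<partial>gibbs_kernel V W \<beta> \<Lambda> \<eta>') * (\<integral>\<^sup>+x. f4 x \<partial>gibbs_kernel V W \<beta> \<Lambda> \<eta>)"
proof -
  let ?B = "boltzmann_weight V W \<beta> \<Lambda>" and ?m = "\<lambda>\<eta> x. merge \<Lambda> (- \<Lambda>) (x, \<eta>)"
    and ?I = "\<lambda>f. \<integral>\<^sup>+x. f x \<partial>(\<Pi>\<^sub>M i\<in>\<Lambda>. lborel)"
  have [measurable]: "?m \<eta> \<in> (\<Pi>\<^sub>M i\<in>\<Lambda>. lborel) \<rightarrow>\<^sub>M config_space"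
     "?B \<eta> \<in> borel_measurable (\<Pi>\<^sub>M i\<in>\<Lambda>. lborel)" for \<eta>
    by measurable
  have "?I (\<lambda>x. ?B \<eta>' x * f1 (?m \<eta>' x)) * ?I (\<lambda>x. ?B \<eta> x * f2 (?m \<eta> x)) \<le>
    ?I (\<lambda>x. ?B \<eta>' x * f3 (?m \<eta>' x)) * ?I (\<lambda>x. ?B \<eta> x * f4 (?m \<eta> x))"
  proof (rule four_functions_PiM[where d = d, OF \<open>finite \<Lambda>\<close>])
    fix x y m M :: "int ^ 'n \<Rightarrow> real"
    assume mM: "\<And>i. i \<in> \<Lambda> \<Longrightarrow> m i = min (x i) (y i + d i) \<and> M i = max (x i) (y i + d i) - d i"
    define X where "X = ?m \<eta>' x"
    define Y where "Y = ?m \<eta> y"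
    define u where "u = (\<lambda>i. max 0 (X i - Y i - d i))"
    define S where "S = (\<Sum>i\<in>\<Lambda>. u i * d i)"
    have XY: "X i = \<eta>' i \<and> Y i = \<eta> i" if "i \<notin> \<Lambda>" for i
      using that by (simp add: X_def Y_def merge_def)
    have u0: "u i = 0" if "i \<notin> \<Lambda>" for i
      using out[OF that] XY[OF that] by (simp add: u_def)
    have "?m \<eta>' m i = X i - u i \<and> ?m \<eta> M i = Y i + u i" for i
    proof (cases "i \<in> \<Lambda>")
      case True
      then show ?thesis using mM by (auto simp: merge_def u_def X_def Y_def min_def max_def)
    next
      case False
      then show ?thesis using XY u0 by (auto simp: merge_def)
    qed
    then have m: "?m \<eta>' m = (\<lambda>i. X i - u i)" and M: "?m \<eta> M = (\<lambda>i. Y i + u i)"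
      by auto
    let ?H = "local_hamiltonian V W \<Lambda>"
    have "(v - w * coordination_number TYPE('n) * (r - 1)) * S \<le>
        ?H X + ?H Y - ?H (\<lambda>i. X i - u i) - ?H (\<lambda>i. Y i + u i)"
      unfolding S_def using XY out
      by (intro local_hamiltonian_exchange \<open>finite \<Lambda>\<close> \<open>1 \<le> r\<close> d u_def) auto
    then have "\<beta> * ((v - w * coordination_number TYPE('n) * (r - 1)) * S) \<le>
        \<beta> * (?H X + ?H Y - ?H (\<lambda>i. X i - u i) - ?H (\<lambda>i. Y i + u i))"
      using \<beta>_pos by (intro mult_left_mono) auto
    then have "exp (- \<beta> * ?H X) * exp (- \<beta> * ?H Y) * exp (c r * S) \<le>
        exp (- \<beta> * ?H (\<lambda>i. X i - u i)) * exp (- \<beta> * ?H (\<lambda>i. Y i + u i))"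
      unfolding c_def exp_add[symmetric] exp_le_cancel_iff by (simp add: algebra_simps)
    then have w: "?B \<eta>' x * ?B \<eta> y * ennreal (exp (c r * S)) \<le> ?B \<eta>' m * ?B \<eta> M"
      unfolding boltzmann_weight_def m M
      unfolding X_def[symmetric] Y_def[symmetric]
      by (simp flip: ennreal_mult')
    have "?B \<eta>' x * f1 X * (?B \<eta> y * f2 Y) = ?B \<eta>' x * ?B \<eta> y * (f1 X * f2 Y)"
      by (simp add: mult_ac)
    also have "\<dots> \<le> ?B \<eta>' x * ?B \<eta> y * (ennreal (exp (c r * S)) * (f3 (\<lambda>i. X i - u i) * f4 (\<lambda>i. Y i + u i)))"
      unfolding S_def using XY by (intro mult_left_mono le u_def) auto
    also have "\<dots> \<le> ?B \<eta>' m * ?B \<eta> M * (f3 (\<lambda>i. X i - u i) * f4 (\<lambda>i. Y i + u i))"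
      using mult_right_mono[OF w, of "f3 (\<lambda>i. X i - u i) * f4 (\<lambda>i. Y i + u i)"] by (simp add: mult_ac)
    finally show "?B \<eta>' x * f1 (?m \<eta>' x) * (?B \<eta> y * f2 (?m \<eta> y)) \<le>
      ?B \<eta>' m * f3 (?m \<eta>' m) * (?B \<eta> M * f4 (?m \<eta> M))"
      unfolding m M X_def[symmetric] Y_def[symmetric] by (simp add: mult_ac)
  qed measurable
  then have "?I (\<lambda>x. ?B \<eta>' x * f1 (?m \<eta>' x)) * ?I (\<lambda>x. ?B \<eta> x * f2 (?m \<eta> x)) * (inverse (?I (?B \<eta>')) * inverse (?I (?B \<eta>)))\<le>
    ?I (\<lambda>x. ?B \<eta>' x * f3 (?m \<eta>' x)) * ?I (\<lambda>x. ?B \<eta> x * f4 (?m \<eta> x)) * (inverse (?I (?B \<eta>')) * inverse (?I (?B \<eta>)))"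
    by (intro mult_right_mono) auto
  then show ?thesis
    by (simp add: nn_integral_gibbs_kernel divide_ennreal_def mult_ac)
qed

text \<open>Holley's inequality up to a shift: two of the four functions are 1, and the shifted join
  \<open>y + u\<close> satisfies \<open>x \<le> y + u + d\<close>, so \<open>f x\<close> can be
  compared with \<open>g\<close> there.\<close>

lemma nn_integral_gibbs_kernel_mono:
  fixes d \<eta> \<eta>' :: "int ^ 'n \<Rightarrow> real" and f g :: "(int ^ 'n \<Rightarrow> real) \<Rightarrow> ennreal"
  assumes "finite \<Lambda>" and r: "1 \<le> r" "w * coordination_number TYPE('n) * (r - 1) \<le> v"
    and d: "\<And>i. 0 \<le> d i" "\<And>i j. neighbours i j \<Longrightarrow> d j \<le> r * d i"
    and out: "\<And>i. i \<notin> \<Lambda> \<Longrightarrow> \<eta>' i \<le> \<eta> i + d i"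
    and [measurable]: "f \<in> borel_measurable config_space" "g \<in> borel_measurable config_space"
    and le: "\<And>x y. (\<And>i. i \<notin> \<Lambda> \<Longrightarrow> x i = \<eta>' i \<and> y i = \<eta> i) \<Longrightarrow> (\<And>i. x i \<le> y i + d i) \<Longrightarrow> f x \<le> g y"
  shows "(\<integral>\<^sup>+x. f x \<partial>gibbs_kernel V W \<beta> \<Lambda> \<eta>') \<le> (\<integral>\<^sup>+x. g x \<partial>gibbs_kernel V W \<beta> \<Lambda> \<eta>)"
proof -
  interpret p: prob_space "gibbs_kernel V W \<beta> \<Lambda> \<eta>" by (rule prob_space_gibbs_kernel) fact
  interpret p': prob_space "gibbs_kernel V W \<beta> \<Lambda> \<eta>'" by (rule prob_space_gibbs_kernel) fact
  have "(\<integral>\<^sup>+x. f x \<partial>gibbs_kernel V W \<beta> \<Lambda> \<eta>') * (\<integral>\<^sup>+x. 1 \<partial>gibbs_kernel V W \<beta> \<Lambda> \<eta>) \<le>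
    (\<integral>\<^sup>+x. 1 \<partial>gibbs_kernel V W \<beta> \<Lambda> \<eta>') * (\<integral>\<^sup>+x. g x \<partial>gibbs_kernel V W \<beta> \<Lambda> \<eta>)"
  proof (rule four_functions_gibbs_kernel[OF \<open>finite \<Lambda>\<close> r(1) d out])
    fix x y u :: "int ^ 'n \<Rightarrow> real"
    assume xy: "\<And>i. i \<notin> \<Lambda> \<Longrightarrow> x i = \<eta>' i \<and> y i = \<eta> i" and u: "u = (\<lambda>i. max 0 (x i - y i - d i))"
    have "0 \<le> \<beta> * (v - w * real (coordination_number TYPE('n)) * (r - 1)) * (\<Sum>i\<in>\<Lambda>. u i * d i)"
      using r(2) \<beta>_pos d(1) u by (intro mult_nonneg_nonneg sum_nonneg) auto
    then have "1 \<le> ennreal (exp (\<beta> * (v - w * real (coordination_number TYPE('n)) * (r - 1)) * (\<Sum>i\<in>\<Lambda>. u i * d i)))"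
      by (simp flip: ennreal_1)
    moreover have "f x \<le> g (\<lambda>i. y i + u i)"
    proof (rule le)
      show "x i = \<eta>' i \<and> y i + u i = \<eta> i" if "i \<notin> \<Lambda>" for i
        using out[OF that] xy[OF that] u by simp
    qed (simp add: u)
    ultimately show "f x * 1 \<le> ennreal (exp (\<beta> * (v - w * real (coordination_number TYPE('n)) * (r - 1)) *
        (\<Sum>i\<in>\<Lambda>. u i * d i))) * (1 * g (\<lambda>i. y i + u i))"
      using mult_mono[of 1 "ennreal (exp (\<beta> * (v - w * real (coordination_number TYPE('n)) * (r - 1)) *
        (\<Sum>i\<in>\<Lambda>. u i * d i)))" "f x" "g (\<lambda>i. y i + u i)"] by simp
  qed auto
  then show ?thesis
    using p.emeasure_space_1 p'.emeasure_space_1 by simp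
qed

text \<open>The product is the expectation of \<open>exp (X - Y)\<close> for two independent copies
  \<open>X\<close> and \<open>Y\<close> of the spin at \<open>i\<close>. Under a constant shift the
  interaction loses nothing, so the bound is uniform in the volume and in the boundary
  condition.\<close>

lemma gibbs_kernel_exp_le:
  fixes \<Lambda> :: "(int ^ 'n) set"
  assumes "finite \<Lambda>" "i \<in> \<Lambda>"
  shows "(\<integral>\<^sup>+x. ennreal (exp (x i)) \<partial>gibbs_kernel V W \<beta> \<Lambda> \<eta>) *
    (\<integral>\<^sup>+x. ennreal (exp (- x i)) \<partial>gibbs_kernel V W \<beta> \<Lambda> \<eta>) \<le> ennreal (exp (1 / (\<beta> * v)))"
proof -
  interpret p: prob_space "gibbs_kernel V W \<beta> \<Lambda> \<eta>" by (rule prob_space_gibbs_kernel) fact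
  \<comment> \<open>With \<beta> * v * D = 1 the spare factor is the exponential of the sum of all
    \<open>u i\<close>. It absorbs \<open>exp (u i)\<close>, and of \<open>exp (x i - y i)\<close>
    only \<open>exp D\<close> remains.\<close>
  define D where "D = 1 / (\<beta> * v)"
  have D: "0 \<le> D" "\<beta> * v * D = 1" using \<beta>_pos v_pos by (auto simp: D_def)
  note [measurable] = measurable_config_component
  have "(\<integral>\<^sup>+x. ennreal (exp (x i)) \<partial>gibbs_kernel V W \<beta> \<Lambda> \<eta>) *
    (\<integral>\<^sup>+x. ennreal (exp (- x i)) \<partial>gibbs_kernel V W \<beta> \<Lambda> \<eta>) \<le>
    (\<integral>\<^sup>+x. 1 \<partial>gibbs_kernel V W \<beta> \<Lambda> \<eta>) * (\<integral>\<^sup>+x. ennreal (exp D) \<partial>gibbs_kernel V W \<beta> \<Lambda> \<eta>)"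
  proof (rule four_functions_gibbs_kernel[where d = "\<lambda>_. D" and r = 1, OF \<open>finite \<Lambda>\<close>])
    fix x y u :: "int ^ 'n \<Rightarrow> real" assume u: "u = (\<lambda>i. max 0 (x i - y i - D))"
    have "x i - y i \<le> u i + D" by (simp add: u)
    also have "u i \<le> (\<Sum>i\<in>\<Lambda>. u i)"
      using assms by (intro member_le_sum) (auto simp: u)
    also have "\<dots> = \<beta> * v * D * (\<Sum>i\<in>\<Lambda>. u i)" by (simp add: D)
    also have "\<dots> = \<beta> * v * (\<Sum>i\<in>\<Lambda>. u i * D)" by (simp add: sum_distrib_left sum_distrib_right mult_ac)
    finally have "exp (x i - y i) \<le> exp (\<beta> * v * (\<Sum>i\<in>\<Lambda>. u i * D) + D)"
      by simp
    then show "ennreal (exp (x i)) * ennreal (exp (- y i)) \<le>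
         ennreal (exp (\<beta> * (v - w * real (coordination_number TYPE('n)) * (1 - 1)) * (\<Sum>i\<in>\<Lambda>. u i * D))) *
         (1 * ennreal (exp D))"
      by (simp add: exp_add exp_diff exp_minus divide_inverse flip: ennreal_mult')
  qed (use D in auto)
  then show ?thesis using p.emeasure_space_1 by (simp add: D_def)
qed

end

section \<open>Lipschitz functions of one spin\<close>

text \<open>Another description of the \<open>spins_sigma J\<close> measurable functions, see
  \<open>spin_functions_iff_measurable\<close>. The pointwise form makes locality easy to verify for
  differences, signs and limits.\<close>

definition spin_functions :: "(int ^ 'n) set \<Rightarrow> ((int ^ 'n \<Rightarrow> real) \<Rightarrow> real) set" where
  "spin_functions J = {f \<in> borel_measurable config_space.
    \<forall>x y. (\<forall>k\<in>J. x k = y k) \<longrightarrow> f x = f y}"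

lemma spin_functionsD:
  assumes "f \<in> spin_functions J"
  shows "f \<in> borel_measurable config_space" "(\<And>k. k \<in> J \<Longrightarrow> x k = y k) \<Longrightarrow> f x = f y"
  using assms by (auto simp: spin_functions_def)

lemma spin_functions_mono: "J \<subseteq> J' \<Longrightarrow> spin_functions J \<subseteq> spin_functions J'"
  unfolding spin_functions_def by blast

lemma spin_functions_diff:
  assumes "f \<in> spin_functions J" "g \<in> spin_functions J"
  shows "(\<lambda>x. f x - g x) \<in> spin_functions J"
proof -
  note [measurable] = spin_functionsD(1)[OF assms(1)] spin_functionsD(1)[OF assms(2)]
  have "f x - g x = f y - g y" if "\<forall>k\<in>J. x k = y k" for x y
    using that spin_functionsD(2)[OF assms(1), of x y] spin_functionsD(2)[OF assms(2), of x y] by simp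
  then show ?thesis by (auto simp: spin_functions_def)
qed

lemma space_spins_sigma [simp]: "space (spins_sigma J) = UNIV"
  by (simp add: spins_sigma_def)

lemma measurable_restrict_spins: "(\<lambda>\<omega>. restrict \<omega> J) \<in> config_space \<rightarrow>\<^sub>M (\<Pi>\<^sub>M k\<in>J. borel)"
  using measurable_config_component by (intro measurable_restrict) auto

lemma sets_spins_sigma_subset: "sets (spins_sigma J) \<subseteq> sets config_space"
proof -
  have "sets (spins_sigma J) = {(\<lambda>\<omega>. restrict \<omega> J) -` A \<inter> UNIV |A. A \<in> sets (\<Pi>\<^sub>M k\<in>J. borel)}"
    unfolding spins_sigma_def by (rule sets_vimage_algebra2) (auto simp: space_PiM)
  then show ?thesis using measurable_sets[OF measurable_restrict_spins] by auto
qed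

text \<open>One direction factors \<open>f\<close> through the restriction to \<open>J\<close>
  followed by extension by 0, which is a measurable map. For the other, a level set of
  \<open>f\<close> is the preimage of a set under the restriction, so it contains with
  \<open>x\<close> every \<open>y\<close> that agrees with it on \<open>J\<close>.\<close>

lemma spin_functions_iff_measurable: "f \<in> spin_functions J \<longleftrightarrow> f \<in> borel_measurable (spins_sigma J)"
proof
  assume f: "f \<in> spin_functions J"
  let ?e = "\<lambda>z k. if k \<in> J then z k else (0::real)"
  have "?e \<in> (\<Pi>\<^sub>M k\<in>J. borel) \<rightarrow>\<^sub>M config_space"
  proof (rule measurable_config_space)
    show "(\<lambda>z. ?e z i) \<in> borel_measurable (\<Pi>\<^sub>M k\<in>J. borel)" for i
      by (cases "i \<in> J") auto
  qed
  then have "(\<lambda>\<omega>. f (?e (restrict \<omega> J))) \<in> borel_measurable (spins_sigma J)"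
    using spin_functionsD(1)[OF f] unfolding spins_sigma_def
    by (intro measurable_compose[OF measurable_vimage_algebra1] measurable_compose[of ?e _ _ f])
      (auto simp: space_PiM)
  moreover have "f (?e (restrict \<omega> J)) = f \<omega>" for \<omega>
    by (rule spin_functionsD(2)[OF f]) simp
  ultimately show "f \<in> borel_measurable (spins_sigma J)" by simp
next
  assume f: "f \<in> borel_measurable (spins_sigma J)"
  have "f x = f y" if xy: "\<forall>k\<in>J. x k = y k" for x y
  proof -
    have "f -` {f x} \<inter> space (spins_sigma J) \<in> sets (spins_sigma J)"
      using f by (rule measurable_sets) simp
    also have "sets (spins_sigma J) = {(\<lambda>\<omega>. restrict \<omega> J) -` A \<inter> UNIV |A. A \<in> sets (\<Pi>\<^sub>M k\<in>J. borel)}"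
      unfolding spins_sigma_def by (rule sets_vimage_algebra2) (auto simp: space_PiM)
    finally obtain A where A: "f -` {f x} = (\<lambda>\<omega>. restrict \<omega> J) -` A" by auto
    have "restrict y J = restrict x J" using xy by (auto simp: restrict_def)
    then have "y \<in> f -` {f x}" using A by (metis vimageI2 vimage_eq vimage_singleton_eq)
    then show ?thesis by simp
  qed
  moreover have "f \<in> borel_measurable config_space"
    using f sets_spins_sigma_subset[of J] unfolding measurable_def by auto
  ultimately show "f \<in> spin_functions J" by (simp add: spin_functions_def)
qed

text \<open>
  The functions of the spin at \<open>i\<close> and of those in \<open>K\<close> that are nondecreasing and \<open>L\<close>-Lipschitz in
  the spin at \<open>i\<close>; \<open>d = 0\<close> gives the locality and the monotonicity.
\<close>

definition incr_lipschitz ::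
  "(int ^ 'n) set \<Rightarrow> int ^ 'n \<Rightarrow> real \<Rightarrow> ((int ^ 'n \<Rightarrow> real) \<Rightarrow> real) set" where
  "incr_lipschitz K i L = {f \<in> borel_measurable config_space.
    \<forall>x y d. (\<forall>k\<in>K. x k = y k) \<longrightarrow> 0 \<le> d \<longrightarrow> x i \<le> y i + d \<longrightarrow> f x \<le> f y + L * d}"

lemma incr_lipschitzD:
  assumes "f \<in> incr_lipschitz K i L"
  shows "f \<in> borel_measurable config_space"
    "(\<And>k. k \<in> K \<Longrightarrow> x k = y k) \<Longrightarrow> 0 \<le> d \<Longrightarrow> x i \<le> y i + d \<Longrightarrow> f x \<le> f y + L * d"
  using assms by (auto simp: incr_lipschitz_def)

lemma incr_lipschitz_abs:
  assumes "f \<in> incr_lipschitz K i L" "0 \<le> L" "\<And>k. k \<in> K \<Longrightarrow> x k = y k"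
  shows "\<bar>f x - f y\<bar> \<le> L * \<bar>x i - y i\<bar>"
proof -
  have "f x \<le> f y + L * \<bar>x i - y i\<bar>" "f y \<le> f x + L * \<bar>x i - y i\<bar>"
    by (rule incr_lipschitzD(2)[OF assms(1)]; use assms(3) in simp)+
  then show ?thesis by simp
qed

lemma incr_lipschitz_spin_functions:
  assumes "f \<in> incr_lipschitz K i L"
  shows "f \<in> spin_functions (insert i K)"
  unfolding spin_functions_def
proof (intro CollectI conjI allI impI antisym)
  fix x y :: "int ^ 'a \<Rightarrow> real" assume "\<forall>k\<in>insert i K. x k = y k"
  then show "f x \<le> f y" "f y \<le> f x"
    using incr_lipschitzD(2)[OF assms, of x y 0] incr_lipschitzD(2)[OF assms, of y x 0] by auto
qed (rule incr_lipschitzD(1)[OF assms])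

section \<open>Variance of Lipschitz functions\<close>

lemma square_le_exp: "(t::real)\<^sup>2 \<le> 2 * (exp t + exp (- t))"
proof -
  have *: "t\<^sup>2 \<le> 2 * (exp t + exp (- t))" if "0 \<le> t" for t :: real
  proof -
    have "1 + t + t\<^sup>2 / 2 \<le> exp t" by (rule exp_lower_Taylor_quadratic) fact
    moreover have "1 + (- t) \<le> exp (- t)" by (rule exp_ge_add_one_self)
    ultimately show ?thesis by simp
  qed
  show ?thesis using *[of t] *[of "- t"] by (cases "0 \<le> t") (auto simp: add_ac)
qed

lemma (in prob_space) integrable_bounded_real:
  fixes f :: "'a \<Rightarrow> real"
  assumes "f \<in> borel_measurable M" "\<And>x. \<bar>f x\<bar> \<le> B"
  shows "integrable M f"
  using assms by (intro integrable_const_bound[of _ B]) auto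

lemma (in prob_space) abs_expectation_le:
  fixes f :: "'a \<Rightarrow> real"
  assumes "f \<in> borel_measurable M" "\<And>x. \<bar>f x\<bar> \<le> B"
  shows "\<bar>\<integral>x. f x \<partial>M\<bar> \<le> B"
proof -
  have "(\<integral>x. f x \<partial>M) \<le> B" "(\<integral>x. - f x \<partial>M) \<le> B"
    by (rule integral_le_const; use assms in \<open>auto intro!: integrable_bounded_real[of _ B] AE_I2 simp: abs_le_iff\<close>)+
  then show ?thesis by (simp add: abs_le_iff)
qed

text \<open>For an independent copy \<open>Y\<close> of \<open>X\<close>, twice the variance of \<open>f\<close> is at most \<open>L\<^sup>2 E (X - Y)\<^sup>2\<close>.\<close>

lemma (in prob_space) lipschitz_variance_le:
  fixes f X :: "'a \<Rightarrow> real"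
  assumes [measurable]: "f \<in> borel_measurable M" "X \<in> borel_measurable M"
    and B: "\<And>x. \<bar>f x\<bar> \<le> B" and lip: "\<And>x y. \<bar>f x - f y\<bar> \<le> L * \<bar>X x - X y\<bar>"
    and E: "(\<integral>\<^sup>+x. ennreal (exp (X x)) \<partial>M) * (\<integral>\<^sup>+x. ennreal (exp (- X x)) \<partial>M) \<le> ennreal E" "0 \<le> E"
  shows "(\<integral>x. (f x - (\<integral>y. f y \<partial>M))\<^sup>2 \<partial>M) \<le> 2 * L\<^sup>2 * E"
proof -
  \<comment> \<open>In \<open>ennreal\<close> a product with a factor 0 is finite whatever the other
    factor, so finiteness of each exponential moment requires the other one to be nonzero.\<close>
  have nz: "(\<integral>\<^sup>+x. ennreal (exp (Y x)) \<partial>M) \<noteq> 0" if [measurable]: "Y \<in> borel_measurable M" for Y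
  proof
    assume "(\<integral>\<^sup>+x. ennreal (exp (Y x)) \<partial>M) = 0"
    then have "AE x in M. ennreal (exp (Y x)) = 0" by (subst (asm) nn_integral_0_iff_AE) measurable
    then have "AE x in M. False" by (rule AE_mp) auto
    then show False by simp
  qed
  have fin: "(\<integral>\<^sup>+x. ennreal (exp (X x)) \<partial>M) < \<infinity>" "(\<integral>\<^sup>+x. ennreal (exp (- X x)) \<partial>M) < \<infinity>"
    using le_less_trans[OF E(1) ennreal_less_top] nz[of X] nz[of "\<lambda>x. - X x"]
    by (auto simp: ennreal_mult_less_top)
  then have int: "integrable M (\<lambda>x. exp (X x))" "integrable M (\<lambda>x. exp (- X x))"
    by (simp_all add: integrable_iff_bounded)
  define a where "a = (\<integral>x. exp (X x) \<partial>M)"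
  define b where "b = (\<integral>x. exp (- X x) \<partial>M)"
  have "ennreal (a * b) \<le> ennreal E"
    using E(1) int by (simp add: a_def b_def nn_integral_eq_integral ennreal_mult')
  then have ab: "a * b \<le> E" using E(2) by simp
  have f2: "integrable M (\<lambda>x. (f x)\<^sup>2)"
    using B by (intro integrable_bounded_real[of _ "B\<^sup>2"]) (auto simp: abs_le_square_iff[symmetric] intro: order_trans[OF _ abs_ge_self])
  have f1: "integrable M f" using B by (intro integrable_bounded_real[of _ B]) auto
  define m where "m = (\<integral>x. f x \<partial>M)"
  define S where "S = (\<integral>x. (f x)\<^sup>2 \<partial>M)"
  \<comment> \<open>The independent copy is realised by an iterated integral: this is the integral
    over \<open>y\<close> of \<open>(f x - f y)^2\<close>, and integrating it over \<open>x\<close>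
    gives twice the variance.\<close>
  have inner: "(f x)\<^sup>2 - 2 * f x * m + S \<le> 2 * L\<^sup>2 * (exp (X x) * b + exp (- X x) * a)" for x
  proof -
    have "(f x)\<^sup>2 - 2 * f x * m + S = (\<integral>y. (f x)\<^sup>2 - 2 * f x * f y + (f y)\<^sup>2 \<partial>M)"
      using f1 f2 by (simp add: m_def S_def prob_space)
    also have "\<dots> \<le> (\<integral>y. 2 * L\<^sup>2 * (exp (X x) * exp (- X y) + exp (- X x) * exp (X y)) \<partial>M)"
    proof (rule integral_mono)
      fix y
      have "(f x)\<^sup>2 - 2 * f x * f y + (f y)\<^sup>2 = \<bar>f x - f y\<bar>\<^sup>2" by (simp add: power2_diff)
      also have "\<dots> \<le> (L * \<bar>X x - X y\<bar>)\<^sup>2" by (intro power_mono lip) auto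
      also have "\<dots> = L\<^sup>2 * (X x - X y)\<^sup>2" by (simp add: power_mult_distrib)
      also have "\<dots> \<le> L\<^sup>2 * (2 * (exp (X x - X y) + exp (- (X x - X y))))"
        by (intro mult_left_mono square_le_exp) auto
      finally show "(f x)\<^sup>2 - 2 * f x * f y + (f y)\<^sup>2 \<le> 2 * L\<^sup>2 * (exp (X x) * exp (- X y) + exp (- X x) * exp (X y))"
        by (simp add: exp_diff exp_minus field_simps)
    qed (use f1 f2 int in auto)
    also have "\<dots> = 2 * L\<^sup>2 * (exp (X x) * b + exp (- X x) * a)"
      using int by (simp add: a_def b_def)
    finally show ?thesis .
  qed
  have "S - 2 * m * m + S = (\<integral>x. (f x)\<^sup>2 - 2 * f x * m + S \<partial>M)"
    using f1 f2 by (simp add: S_def m_def prob_space)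
  also have "\<dots> \<le> (\<integral>x. 2 * L\<^sup>2 * (exp (X x) * b + exp (- X x) * a) \<partial>M)"
    by (rule integral_mono) (use inner f1 f2 int in auto)
  also have "\<dots> = 2 * L\<^sup>2 * (2 * (a * b))"
    using int by (simp add: a_def b_def)
  also have "\<dots> \<le> 2 * L\<^sup>2 * (2 * E)"
    using ab by (intro mult_left_mono) auto
  finally have "S - m\<^sup>2 \<le> 2 * L\<^sup>2 * E" by (simp add: power2_eq_square)
  moreover have "(\<integral>x. (f x - m)\<^sup>2 \<partial>M) = S - m\<^sup>2"
    unfolding power2_diff using f1 f2 by (simp add: S_def m_def[symmetric] prob_space) (simp add: power2_eq_square)
  ultimately show ?thesis by (simp add: m_def)
qed

context convex_spins
begin

abbreviation gibbs_mean ::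
  "(int ^ 'n) set \<Rightarrow> ((int ^ 'n \<Rightarrow> real) \<Rightarrow> real) \<Rightarrow> (int ^ 'n \<Rightarrow> real) \<Rightarrow> real" where
  "gibbs_mean \<Lambda> f \<eta> \<equiv> (\<integral>x. f x \<partial>gibbs_kernel V W \<beta> \<Lambda> \<eta>)"

lemma measurable_gibbs_mean:
  assumes "finite \<Lambda>" "f \<in> borel_measurable config_space"
  shows "gibbs_mean \<Lambda> f \<in> borel_measurable config_space"
  using measurable_compose[OF measurable_gibbs_kernel[OF assms(1)]
      integral_measurable_subprob_algebra[OF assms(2)]] .

lemma abs_gibbs_mean_le:
  assumes "finite \<Lambda>" "f \<in> borel_measurable config_space" "\<And>x. \<bar>f x\<bar> \<le> B"
  shows "\<bar>gibbs_mean \<Lambda> f \<eta>\<bar> \<le> B"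
proof -
  interpret prob_space "gibbs_kernel V W \<beta> \<Lambda> \<eta>" by (rule prob_space_gibbs_kernel) fact
  show ?thesis using assms by (intro abs_expectation_le) auto
qed

text \<open>
  The growth per bond that is allowed for the shifts \<open>d\<close>, hence the rate of decay of correlations;
  the \<open>+ 1\<close> only avoids a division by zero when \<open>w = 0\<close>.
\<close>

definition decay_rate :: "'n::finite itself \<Rightarrow> real" where
  "decay_rate n = 1 + v / (w * coordination_number n + 1)"

lemma decay_rate_gt_1: "1 < decay_rate n"
  using v_pos w_nonneg by (simp add: decay_rate_def add_nonneg_pos)

lemma decay_rate_le: "w * coordination_number n * (decay_rate n - 1) \<le> v"
proof -
  have "0 \<le> w * coordination_number n" using w_nonneg by simp
  then show ?thesis using v_pos by (simp add: decay_rate_def field_simps)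
qed

text \<open>What is lost is the shift at the single site \<open>i\<close>, however large
  \<open>d\<close> is where the boundary conditions differ. Exponential decay and insensitivity to
  distant boundary conditions both come from choosing \<open>d\<close> small at
  \<open>i\<close>.\<close>

lemma gibbs_mean_incr_lipschitz:
  fixes d \<eta> \<eta>' :: "int ^ 'n \<Rightarrow> real"
  assumes "finite \<Lambda>" and f: "f \<in> incr_lipschitz K i L" and "K \<inter> \<Lambda> = {}"
    and B: "\<And>x. \<bar>f x\<bar> \<le> B"
    and d: "\<And>i. 0 \<le> d i" "\<And>i j. neighbours i j \<Longrightarrow> d j \<le> decay_rate TYPE('n) * d i"
    and out: "\<And>i. i \<notin> \<Lambda> \<Longrightarrow> \<eta>' i \<le> \<eta> i + d i"
    and K: "\<And>k. k \<in> K \<Longrightarrow> \<eta>' k = \<eta> k"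
  shows "gibbs_mean \<Lambda> f \<eta>' \<le> gibbs_mean \<Lambda> f \<eta> + L * d i"
proof -
  interpret p: prob_space "gibbs_kernel V W \<beta> \<Lambda> \<eta>" by (rule prob_space_gibbs_kernel) fact
  interpret p': prob_space "gibbs_kernel V W \<beta> \<Lambda> \<eta>'" by (rule prob_space_gibbs_kernel) fact
  \<comment> \<open>The comparison concerns \<open>ennreal\<close> integrands; adding
    \<open>C\<close> makes both sides nonnegative.\<close>
  define C where "C = B + \<bar>L * d i\<bar>"
  note [measurable] = incr_lipschitzD(1)[OF f]
  have C: "0 \<le> f x + C" "0 \<le> f x + L * d i + C" for x
    using B[of x] by (auto simp: C_def abs_le_iff)
  have one: "measure (gibbs_kernel V W \<beta> \<Lambda> \<eta>) UNIV = 1" "measure (gibbs_kernel V W \<beta> \<Lambda> \<eta>') UNIV = 1"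
    using p.prob_space p'.prob_space by auto
  have int: "integrable (gibbs_kernel V W \<beta> \<Lambda> \<eta>) f" "integrable (gibbs_kernel V W \<beta> \<Lambda> \<eta>') f"
    using B by (auto intro!: p.integrable_bounded_real[of _ B] p'.integrable_bounded_real[of _ B])
  have "(\<integral>\<^sup>+x. ennreal (f x + C) \<partial>gibbs_kernel V W \<beta> \<Lambda> \<eta>') \<le>
      (\<integral>\<^sup>+x. ennreal (f x + L * d i + C) \<partial>gibbs_kernel V W \<beta> \<Lambda> \<eta>)"
  proof (rule nn_integral_gibbs_kernel_mono[OF \<open>finite \<Lambda>\<close> less_imp_le[OF decay_rate_gt_1] decay_rate_le d out])
    fix x y assume xy: "\<And>i. i \<notin> \<Lambda> \<Longrightarrow> x i = \<eta>' i \<and> y i = \<eta> i" "\<And>i. x i \<le> y i + d i"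
    have "x k = y k" if "k \<in> K" for k
    proof -
      have "k \<notin> \<Lambda>" using that \<open>K \<inter> \<Lambda> = {}\<close> by auto
      then show ?thesis using xy(1) K[OF that] by simp
    qed
    then have "f x \<le> f y + L * d i"
      using xy(2) d(1) by (intro incr_lipschitzD(2)[OF f])
    then show "ennreal (f x + C) \<le> ennreal (f y + L * d i + C)" by (intro ennreal_leI) simp
  qed auto
  then have "ennreal (gibbs_mean \<Lambda> f \<eta>' + C) \<le> ennreal (gibbs_mean \<Lambda> f \<eta> + L * d i + C)"
    using C int by (simp add: nn_integral_eq_integral one)
  moreover have "0 \<le> (\<integral>x. f x + L * d i + C \<partial>gibbs_kernel V W \<beta> \<Lambda> \<eta>)"
    using C by (intro Bochner_Integration.integral_nonneg)
  then have "0 \<le> gibbs_mean \<Lambda> f \<eta> + L * d i + C"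
    using int by (simp add: one)
  ultimately show ?thesis by (simp add: ennreal_le_iff)
qed

lemma gibbs_mean_variance_le:
  fixes f :: "(int ^ 'n \<Rightarrow> real) \<Rightarrow> real"
  assumes "finite \<Lambda>" "i \<in> \<Lambda>" and [measurable]: "f \<in> borel_measurable config_space"
    and B: "\<And>x. \<bar>f x\<bar> \<le> B" and lip: "\<And>x y. (\<And>k. k \<notin> \<Lambda> \<Longrightarrow> x k = y k) \<Longrightarrow> \<bar>f x - f y\<bar> \<le> L * \<bar>x i - y i\<bar>"
  shows "gibbs_mean \<Lambda> (\<lambda>x. (f x - gibbs_mean \<Lambda> f x)\<^sup>2) \<eta> \<le> 2 * L\<^sup>2 * exp (1 / (\<beta> * v))"
proof -
  interpret p: prob_space "gibbs_kernel V W \<beta> \<Lambda> \<eta>" by (rule prob_space_gibbs_kernel) fact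
  note [measurable] = measurable_gibbs_mean[OF \<open>finite \<Lambda>\<close> assms(3)] measurable_config_component
  \<comment> \<open>Resetting the spins outside \<Lambda> to \<eta> changes nothing under the
    kernel, and it makes the Lipschitz bound hold for all pairs of configurations, as
    \<open>lipschitz_variance_le\<close> demands.\<close>
  define e where "e x = (\<lambda>k. if k \<in> \<Lambda> then x k else \<eta> k)" for x
  have [measurable]: "e \<in> config_space \<rightarrow>\<^sub>M config_space"
    by (rule measurable_config_space) (simp add: e_def)
  have e: "e x = x" if "\<And>k. k \<notin> \<Lambda> \<Longrightarrow> x k = \<eta> k" for x
    using that by (auto simp: e_def)
  have fe: "gibbs_mean \<Lambda> f \<eta> = gibbs_mean \<Lambda> (\<lambda>x. f (e x)) \<eta>"
    using e by (intro integral_gibbs_kernel_cong) auto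
  have "gibbs_mean \<Lambda> (\<lambda>x. (f x - gibbs_mean \<Lambda> f x)\<^sup>2) \<eta> =
    gibbs_mean \<Lambda> (\<lambda>x. (f (e x) - gibbs_mean \<Lambda> (\<lambda>x. f (e x)) \<eta>)\<^sup>2) \<eta>"
    unfolding fe[symmetric]
  proof (rule integral_gibbs_kernel_cong)
    fix x assume x: "\<And>i. i \<notin> \<Lambda> \<Longrightarrow> x i = \<eta> i"
    show "(f x - gibbs_mean \<Lambda> f x)\<^sup>2 = (f (e x) - gibbs_mean \<Lambda> f \<eta>)\<^sup>2"
      using gibbs_kernel_cong[of \<Lambda> x \<eta> V W \<beta>] x e[OF x] by simp
  qed measurable
  also have "\<dots> \<le> 2 * L\<^sup>2 * exp (1 / (\<beta> * v))"
  proof (rule p.lipschitz_variance_le)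
    show "\<bar>f (e x) - f (e y)\<bar> \<le> L * \<bar>x i - y i\<bar>" for x y
      using lip[of "e x" "e y"] \<open>i \<in> \<Lambda>\<close> by (simp add: e_def)
    show "(\<integral>\<^sup>+ x. ennreal (exp (x i)) \<partial>gibbs_kernel V W \<beta> \<Lambda> \<eta>) *
      (\<integral>\<^sup>+ x. ennreal (exp (- x i)) \<partial>gibbs_kernel V W \<beta> \<Lambda> \<eta>) \<le> ennreal (exp (1 / (\<beta> * v)))"
      by (rule gibbs_kernel_exp_le) fact+
  qed (use B in auto)
  finally show ?thesis .
qed

end

section \<open>Infinite volume\<close>

locale gibbs_state = convex_spins V V' W W' v w \<beta>
  for V V' W W' :: "real \<Rightarrow> real" and v w \<beta> :: real +
  fixes \<mu> :: "(int ^ 'n \<Rightarrow> real) measure"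
  assumes equilibrium: "equilibrium_state V W \<beta> \<mu>"
begin

lemma prob_space_\<mu>: "prob_space \<mu>"
  and sets_\<mu> [simp, measurable_cong]: "sets \<mu> = sets config_space"
  and DLR: "finite \<Lambda> \<Longrightarrow> A \<in> sets config_space \<Longrightarrow>
    AE \<eta> in \<mu>. real_cond_exp \<mu> (spins_sigma (- \<Lambda>)) (indicator A) \<eta> =
      measure (gibbs_kernel V W \<beta> \<Lambda> \<eta>) A"
  and tempered: "AE \<omega> in \<mu>. \<exists>(C::real) (p::nat). \<forall>i. \<bar>\<omega> i\<bar> \<le> C * (1 + real_of_int (l1_norm i)) ^ p"
  using equilibrium unfolding equilibrium_state_def gibbs_measure_def by blast+

sublocale prob_space \<mu> by (rule prob_space_\<mu>)

lemma space_\<mu> [simp]: "space \<mu> = UNIV"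
  using sets_eq_imp_space_eq[OF sets_\<mu>] by simp

lemma sigma_finite_subalgebra_spins: "sigma_finite_subalgebra \<mu> (spins_sigma J)"
proof -
  have "finite_measure_subalgebra \<mu> (spins_sigma J)"
    using sets_spins_sigma_subset[of J] by unfold_locales (simp add: subalgebra_def)
  then show ?thesis by (rule finite_measure_subalgebra_is_sigma_finite)
qed

text \<open>Integrating the DLR equations. The almost sure identities, with a null set for each
  event, become a single identity of measures.\<close>

lemma bind_gibbs_kernel:
  assumes "finite \<Lambda>"
  shows "\<mu> \<bind> gibbs_kernel V W \<beta> \<Lambda> = \<mu>"
proof (rule measure_eqI)
  have K: "gibbs_kernel V W \<beta> \<Lambda> \<in> \<mu> \<rightarrow>\<^sub>M subprob_algebra config_space"
    using measurable_gibbs_kernel[OF assms] by (simp cong: measurable_cong_sets)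
  show s: "sets (\<mu> \<bind> gibbs_kernel V W \<beta> \<Lambda>) = sets \<mu>"
    using sets_bind[of \<mu> "gibbs_kernel V W \<beta> \<Lambda>" config_space] by simp
  fix A assume "A \<in> sets (\<mu> \<bind> gibbs_kernel V W \<beta> \<Lambda>)"
  then have A: "A \<in> sets config_space" using s by simp
  interpret sigma_finite_subalgebra \<mu> "spins_sigma (- \<Lambda>)" by (rule sigma_finite_subalgebra_spins)
  have ind: "integrable \<mu> (indicator A :: _ \<Rightarrow> real)"
    using A by (intro integrable_bounded_real[of _ 1]) (auto simp: indicator_def)
  have kernel: "emeasure (gibbs_kernel V W \<beta> \<Lambda> \<eta>) A = ennreal (measure (gibbs_kernel V W \<beta> \<Lambda> \<eta>) A)" for \<eta>
  proof -
    interpret p: prob_space "gibbs_kernel V W \<beta> \<Lambda> \<eta>" by (rule prob_space_gibbs_kernel) fact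
    show ?thesis by (rule p.emeasure_eq_measure)
  qed
  have "emeasure (\<mu> \<bind> gibbs_kernel V W \<beta> \<Lambda>) A = (\<integral>\<^sup>+\<eta>. ennreal (measure (gibbs_kernel V W \<beta> \<Lambda> \<eta>) A) \<partial>\<mu>)"
    using emeasure_bind[OF _ K A] by (simp add: kernel)
  also have "\<dots> = (\<integral>\<^sup>+\<eta>. ennreal (real_cond_exp \<mu> (spins_sigma (- \<Lambda>)) (indicator A) \<eta>) \<partial>\<mu>)"
    using DLR[OF assms A] by (intro nn_integral_cong_AE) auto
  also have "\<dots> = ennreal (\<integral>\<eta>. real_cond_exp \<mu> (spins_sigma (- \<Lambda>)) (indicator A) \<eta> \<partial>\<mu>)"
    using DLR[OF assms A] real_cond_exp_int(1)[OF ind] by (intro nn_integral_eq_integral) auto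
  also have "\<dots> = ennreal (\<integral>\<eta>. indicator A \<eta> \<partial>\<mu>)"
    by (simp add: real_cond_exp_int(2)[OF ind])
  also have "\<dots> = emeasure \<mu> A"
    using A by (simp add: emeasure_eq_measure)
  finally show "emeasure (\<mu> \<bind> gibbs_kernel V W \<beta> \<Lambda>) A = emeasure \<mu> A" .
qed

lemma integral_gibbs_mean:
  assumes "finite \<Lambda>" and [measurable]: "f \<in> borel_measurable config_space" and B: "\<And>x. \<bar>f x\<bar> \<le> B"
  shows "(\<integral>x. gibbs_mean \<Lambda> f x \<partial>\<mu>) = (\<integral>x. f x \<partial>\<mu>)"
proof -
  note [measurable] = measurable_gibbs_mean[OF \<open>finite \<Lambda>\<close> assms(2)]
  have K: "gibbs_kernel V W \<beta> \<Lambda> \<in> \<mu> \<rightarrow>\<^sub>M subprob_algebra config_space"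
    using measurable_gibbs_kernel[OF assms(1)] by (simp cong: measurable_cong_sets)
  have fB: "0 \<le> f x + B" "0 \<le> gibbs_mean \<Lambda> f x + B" for x
    using B[of x] abs_gibbs_mean_le[OF assms, of x] by (auto simp: abs_le_iff)
  have int: "integrable \<mu> f" "integrable \<mu> (gibbs_mean \<Lambda> f)"
    using B abs_gibbs_mean_le[OF assms] by (auto intro!: integrable_bounded_real[of _ B])
  have inner: "(\<integral>\<^sup>+y. ennreal (f y + B) \<partial>gibbs_kernel V W \<beta> \<Lambda> x) = ennreal (gibbs_mean \<Lambda> f x + B)" for x
  proof -
    interpret p: prob_space "gibbs_kernel V W \<beta> \<Lambda> x" by (rule prob_space_gibbs_kernel) fact
    have one: "measure (gibbs_kernel V W \<beta> \<Lambda> x) UNIV = 1" using p.prob_space by simp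
    have "integrable (gibbs_kernel V W \<beta> \<Lambda> x) f"
      using B by (auto intro!: p.integrable_bounded_real[of _ B])
    then show ?thesis using fB by (simp add: nn_integral_eq_integral one)
  qed
  have "(\<integral>\<^sup>+x. ennreal (f x + B) \<partial>\<mu>) = (\<integral>\<^sup>+x. ennreal (f x + B) \<partial>(\<mu> \<bind> gibbs_kernel V W \<beta> \<Lambda>))"
    by (simp add: bind_gibbs_kernel[OF assms(1)])
  also have "\<dots> = (\<integral>\<^sup>+x. ennreal (gibbs_mean \<Lambda> f x + B) \<partial>\<mu>)"
    by (subst nn_integral_bind[OF _ K]) (auto simp: inner)
  finally have "ennreal ((\<integral>x. f x \<partial>\<mu>) + B) = ennreal ((\<integral>x. gibbs_mean \<Lambda> f x \<partial>\<mu>) + B)"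
    using fB int prob_space by (simp add: nn_integral_eq_integral)
  moreover have "0 \<le> (\<integral>x. f x + B \<partial>\<mu>)" "0 \<le> (\<integral>x. gibbs_mean \<Lambda> f x + B \<partial>\<mu>)"
    using fB by (intro Bochner_Integration.integral_nonneg; simp)+
  ultimately show ?thesis
    using int prob_space by simp
qed

text \<open>The kernel does not move the spins outside \<Lambda>, so \<open>g\<close> is constant
  under it and can be pulled out. Together with invariance this is the conditional expectation
  property of the kernel.\<close>

lemma integral_gibbs_mean_mult:
  assumes "finite \<Lambda>" and [measurable]: "f \<in> borel_measurable config_space" and B: "\<And>x. \<bar>f x\<bar> \<le> B"
    and g: "g \<in> spin_functions (- \<Lambda>)" and C: "\<And>x. \<bar>g x\<bar> \<le> C"
  shows "(\<integral>x. gibbs_mean \<Lambda> f x * g x \<partial>\<mu>) = (\<integral>x. f x * g x \<partial>\<mu>)"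
proof -
  note [measurable] = spin_functionsD(1)[OF g]
  have "\<bar>f x * g x\<bar> \<le> B * C" for x
    unfolding abs_mult using B[of x] C[of x] by (intro mult_mono) auto
  then have "(\<integral>x. f x * g x \<partial>\<mu>) = (\<integral>x. gibbs_mean \<Lambda> (\<lambda>x. f x * g x) x \<partial>\<mu>)"
    using assms(1) by (intro integral_gibbs_mean[symmetric]) auto
  moreover have "gibbs_mean \<Lambda> (\<lambda>x. f x * g x) x = gibbs_mean \<Lambda> f x * g x" for x
  proof -
    have "gibbs_mean \<Lambda> (\<lambda>x. f x * g x) x = gibbs_mean \<Lambda> (\<lambda>y. f y * g x) x"
    proof (intro integral_gibbs_kernel_cong)
      fix y assume "\<And>i. i \<notin> \<Lambda> \<Longrightarrow> y i = x i"
      then have "g y = g x" by (intro spin_functionsD(2)[OF g]) auto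
      then show "f y * g y = f y * g x" by simp
    qed auto
    then show ?thesis by simp
  qed
  ultimately show ?thesis by simp
qed

lemma real_cond_exp_spins:
  assumes [measurable]: "f \<in> borel_measurable config_space" and B: "\<And>x. \<bar>f x\<bar> \<le> B"
    and g: "g \<in> spin_functions J" and C: "\<And>x. \<bar>g x\<bar> \<le> C"
  shows "(\<integral>x. real_cond_exp \<mu> (spins_sigma J) f x * g x \<partial>\<mu>) = (\<integral>x. f x * g x \<partial>\<mu>)"
proof -
  interpret sigma_finite_subalgebra \<mu> "spins_sigma J" by (rule sigma_finite_subalgebra_spins)
  note [measurable] = spin_functionsD(1)[OF g]
  have "\<bar>g x * f x\<bar> \<le> C * B" for x
    unfolding abs_mult using B[of x] C[of x] by (intro mult_mono) auto
  then have "integrable \<mu> (\<lambda>x. g x * f x)"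
    by (intro integrable_bounded_real[of _ "C * B"]) auto
  then show ?thesis
    using real_cond_exp_intg(2)[of g f] g by (simp add: spin_functions_iff_measurable mult_ac)
qed

end

text \<open>Taking the \<open>p\<close>-th root of \<open>s\<close> reduces the claim to a linear
  function, where it is Bernoulli's inequality; \<open>c\<close> is chosen with
  \<open>1 \<le> c\<close> and \<open>1 \<le> c * (t - 1)\<close>.\<close>

lemma polynomial_le_exponential:
  fixes s :: real
  assumes "1 < s"
  obtains c where "0 < c" "\<And>m::nat. (1 + real m) ^ p \<le> c * s ^ m"
proof (cases "p = 0")
  case True
  with assms show ?thesis by (intro that[of 1]) auto
next
  case False
  define t where "t = root p s"
  have t: "1 < t" "t ^ p = s" using assms False by (auto simp: t_def)
  define c where "c = max 1 (1 / (t - 1))"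
  have "1 + real m \<le> c * t ^ m" for m
  proof -
    have "1 + real m \<le> c * (1 + real m * (t - 1))"
    proof -
      have "1 \<le> c * (t - 1)"
        using t mult_right_mono[of "1 / (t - 1)" c "t - 1"] by (simp add: c_def)
      then have "real m * 1 \<le> real m * (c * (t - 1))" by (intro mult_left_mono) auto
      moreover have "1 \<le> c" by (simp add: c_def)
      ultimately show ?thesis by (simp add: algebra_simps)
    qed
    also have "\<dots> \<le> c * t ^ m"
      using Bernoulli_inequality[of "t - 1" m] t by (intro mult_left_mono) (auto simp: c_def)
    finally show ?thesis .
  qed
  then have "(1 + real m) ^ p \<le> (c * t ^ m) ^ p" for m
    by (intro power_mono) auto
  also have "(c * t ^ m) ^ p = c ^ p * s ^ m" for m
    by (simp add: power_mult_distrib t(2)[symmetric] power_mult[symmetric] mult.commute)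
  finally show ?thesis by (intro that[of "c ^ p"]) (simp_all add: c_def)
qed

text \<open>The spins in \<open>J\<close>, of which there may be infinitely many, are never
  resampled: they belong to the boundary condition.\<close>

definition l1_box :: "(int ^ 'n) set \<Rightarrow> nat \<Rightarrow> (int ^ 'n) set" where
  "l1_box J N = {k. l1_norm k \<le> int N} - J"

text \<open>With this boundary condition a mean over \<open>l1_box J N\<close> depends only on the
  spins in \<open>J\<close>. The price, replacing the other spins outside the box by 0, is
  controlled by \<open>box_mean_tempered\<close>.\<close>

definition zero_ext :: "(int ^ 'n) set \<Rightarrow> (int ^ 'n \<Rightarrow> real) \<Rightarrow> int ^ 'n \<Rightarrow> real" where
  "zero_ext J x = (\<lambda>k. if k \<in> J then x k else 0)"

lemma finite_l1_box: "finite (l1_box J N)"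
  unfolding l1_box_def using finite_l1_ball by auto

lemma measurable_zero_ext [measurable]: "zero_ext J \<in> config_space \<rightarrow>\<^sub>M config_space"
proof (rule measurable_config_space)
  fix i show "(\<lambda>x. zero_ext J x i) \<in> borel_measurable config_space"
    using measurable_config_component by (cases "i \<in> J") (auto simp: zero_ext_def)
qed

context gibbs_state
begin

section \<open>Means over growing boxes\<close>

lemma box_mean_spin_functions:
  assumes "f \<in> borel_measurable config_space"
  shows "(\<lambda>x. gibbs_mean (l1_box J N) f (zero_ext J x)) \<in> spin_functions J"
proof -
  have "gibbs_mean (l1_box J N) f (zero_ext J x) = gibbs_mean (l1_box J N) f (zero_ext J y)"
    if "\<forall>k\<in>J. x k = y k" for x y
  proof -
    have "zero_ext J x = zero_ext J y" using that by (auto simp: zero_ext_def)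
    then show ?thesis by simp
  qed
  then show ?thesis
    unfolding spin_functions_def
    using measurable_compose[OF measurable_zero_ext measurable_gibbs_mean[OF finite_l1_box assms]] by auto
qed

lemma box_mean_incr_lipschitz:
  fixes d x y :: "int ^ 'n \<Rightarrow> real"
  assumes f: "f \<in> incr_lipschitz K i L" and "K \<subseteq> J" and B: "\<And>x. \<bar>f x\<bar> \<le> B"
    and d: "\<And>i. 0 \<le> d i" "\<And>i j. neighbours i j \<Longrightarrow> d j \<le> decay_rate TYPE('n) * d i"
    and le: "\<And>k. k \<in> J \<Longrightarrow> x k \<le> y k + d k" and eq: "\<And>k. k \<in> K \<Longrightarrow> x k = y k"
  shows "gibbs_mean (l1_box J N) f (zero_ext J x) \<le> gibbs_mean (l1_box J N) f (zero_ext J y) + L * d i"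
proof (rule gibbs_mean_incr_lipschitz[OF finite_l1_box f _ B d])
  show "K \<inter> l1_box J N = {}" using \<open>K \<subseteq> J\<close> by (auto simp: l1_box_def)
  show "zero_ext J x k \<le> zero_ext J y k + d k" for k
    using le d(1) by (auto simp: zero_ext_def)
  show "zero_ext J x k = zero_ext J y k" if "k \<in> K" for k
    using that eq by (auto simp: zero_ext_def)
qed

lemma power_l1_norm_neighbours:
  assumes "neighbours i j" "1 \<le> (q::real)"
  shows "q ^ nat (l1_norm (j - z)) \<le> q * q ^ nat (l1_norm (i - z))"
proof -
  have "l1_norm (j - z) \<le> l1_norm (j - i) + l1_norm (i - z)"
    using l1_norm_triangle[of "j - i" "i - z"] by simp
  then have "nat (l1_norm (j - z)) \<le> Suc (nat (l1_norm (i - z)))"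
    using assms(1) by (simp add: neighbours_def)
  then show ?thesis using power_increasing[OF _ assms(2)] by fastforce
qed

text \<open>
  Temperedness: the boundary condition outside a large box is dominated by a shift \<open>d\<close> that grows
  at the admissible rate and is tiny at \<open>i\<close>, so that freezing it to zero hardly matters.
\<close>

lemma box_mean_tempered:
  fixes x :: "int ^ 'n \<Rightarrow> real"
  assumes f: "f \<in> incr_lipschitz K i L" and "0 \<le> L" and "K \<subseteq> J" and B: "\<And>x. \<bar>f x\<bar> \<le> B"
    and x: "\<And>k. \<bar>x k\<bar> \<le> C * (1 + real_of_int (l1_norm k)) ^ p"
  shows "(\<lambda>N. gibbs_mean (l1_box J N) f x - gibbs_mean (l1_box J N) f (zero_ext J x)) \<longlonglongrightarrow> 0"
proof -
  define q where "q = decay_rate TYPE('n)"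
  define s where "s = sqrt q"
  have q: "1 < q" using decay_rate_gt_1 by (simp add: q_def)
  then have s: "1 < s" "q = s * s" by (auto simp: s_def)
  obtain c where c: "0 < c" "\<And>m::nat. (1 + real m) ^ p \<le> c * s ^ m"
    using polynomial_le_exponential[OF s(1)] by blast
  have xs: "\<bar>x k\<bar> \<le> \<bar>C\<bar> * c * s ^ nat (l1_norm k)" for k
  proof -
    have "\<bar>x k\<bar> \<le> \<bar>C\<bar> * (1 + real (nat (l1_norm k))) ^ p"
      using x[of k] l1_norm_nonneg[of k] by (auto intro: order_trans[OF _ mult_right_mono[of C "\<bar>C\<bar>"]])
    also have "\<dots> \<le> \<bar>C\<bar> * (c * s ^ nat (l1_norm k))"
      by (intro mult_left_mono c) auto
    finally show ?thesis by (simp add: mult.assoc)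
  qed
  \<comment> \<open>Outside the box and \<open>J\<close> the norm is at least \<open>N\<close>, so
    \<open>q ^ |k| / s ^ N\<close> is at least \<open>s ^ |k|\<close> and dominates the tempered
    spin there; at the fixed site \<open>i\<close> it tends to 0. The square root splits the rate
    \<open>q\<close> between these two demands.\<close>
  define d where "d N k = \<bar>C\<bar> * c / s ^ N * q ^ nat (l1_norm (k - 0))" for N and k :: "int ^ 'n"
  have d_nonneg: "0 \<le> d N k" for N k using c q s by (simp add: d_def)
  have d_slow: "d N j \<le> q * d N k" if "neighbours k j" for N k j
  proof -
    have "\<bar>C\<bar> * c / s ^ N * q ^ nat (l1_norm (j - 0)) \<le> \<bar>C\<bar> * c / s ^ N * (q * q ^ nat (l1_norm (k - 0)))"
      using c s by (intro mult_left_mono power_l1_norm_neighbours[OF that less_imp_le[OF q]]) auto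
    then show ?thesis by (simp add: d_def mult_ac)
  qed
  have out: "x k \<le> zero_ext J x k + d N k" "zero_ext J x k \<le> x k + d N k" if "k \<notin> l1_box J N" for N and k :: "int ^ 'n"
  proof -
    have "\<bar>x k\<bar> \<le> d N k" if "k \<notin> J"
    proof -
      have N: "N \<le> nat (l1_norm k)" using that \<open>k \<notin> l1_box J N\<close> by (simp add: l1_box_def)
      have "\<bar>x k\<bar> * s ^ N \<le> (\<bar>C\<bar> * c * s ^ nat (l1_norm k)) * s ^ nat (l1_norm k)"
        using s N c by (intro mult_mono xs power_increasing) auto
      also have "\<dots> = \<bar>C\<bar> * c * q ^ nat (l1_norm k)"
        by (simp add: s(2) power_mult_distrib)
      finally show ?thesis using s by (simp add: d_def pos_le_divide_eq)
    qed
    then show "x k \<le> zero_ext J x k + d N k" "zero_ext J x k \<le> x k + d N k"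
      using d_nonneg[of N k] by (auto simp: zero_ext_def abs_le_iff)
  qed
  have bound: "norm (gibbs_mean (l1_box J N) f x - gibbs_mean (l1_box J N) f (zero_ext J x)) \<le> L * d N i" for N
  proof -
    have K: "K \<inter> l1_box J N = {}" using \<open>K \<subseteq> J\<close> by (auto simp: l1_box_def)
    have eq: "k \<in> K \<Longrightarrow> x k = zero_ext J x k" for k using \<open>K \<subseteq> J\<close> by (auto simp: zero_ext_def)
    have "gibbs_mean (l1_box J N) f x \<le> gibbs_mean (l1_box J N) f (zero_ext J x) + L * d N i"
      by (rule gibbs_mean_incr_lipschitz[OF finite_l1_box f K B d_nonneg d_slow[unfolded q_def] out(1) eq])
    moreover have "gibbs_mean (l1_box J N) f (zero_ext J x) \<le> gibbs_mean (l1_box J N) f x + L * d N i"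
      by (rule gibbs_mean_incr_lipschitz[OF finite_l1_box f K B d_nonneg d_slow[unfolded q_def] out(2) eq[symmetric]])
    ultimately show ?thesis by simp
  qed
  have "(\<lambda>N. L * (\<bar>C\<bar> * c * inverse (s ^ N) * q ^ nat (l1_norm (i - 0)))) \<longlonglongrightarrow> L * (\<bar>C\<bar> * c * 0 * q ^ nat (l1_norm (i - 0)))"
    by (intro tendsto_intros LIMSEQ_inverse_realpow_zero s)
  then have "(\<lambda>N. L * d N i) \<longlonglongrightarrow> 0"
    by (simp add: d_def divide_inverse)
  then show ?thesis
    by (rule Lim_null_comparison[OF always_eventually, rotated]) (use bound in auto)
qed

text \<open>The constants of temperedness depend on the configuration, so the pointwise limit has no
  uniform rate; boundedness and dominated convergence still give convergence in mean.\<close>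

lemma box_mean_L1:
  fixes f :: "(int ^ 'n \<Rightarrow> real) \<Rightarrow> real"
  assumes f: "f \<in> incr_lipschitz K i L" and "0 \<le> L" and "K \<subseteq> J" and B: "\<And>x. \<bar>f x\<bar> \<le> B"
  shows "(\<lambda>N. \<integral>x. \<bar>gibbs_mean (l1_box J N) f x - gibbs_mean (l1_box J N) f (zero_ext J x)\<bar> \<partial>\<mu>) \<longlonglongrightarrow> 0"
proof -
  note fm = incr_lipschitzD(1)[OF f]
  note [measurable] = fm measurable_gibbs_mean[OF finite_l1_box fm] spin_functionsD(1)[OF box_mean_spin_functions[OF fm]]
  have "(\<lambda>N. \<integral>x. \<bar>gibbs_mean (l1_box J N) f x - gibbs_mean (l1_box J N) f (zero_ext J x)\<bar> \<partial>\<mu>) \<longlonglongrightarrow> (\<integral>x. 0 \<partial>\<mu>)"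
  proof (rule integral_dominated_convergence[where w = "\<lambda>_. 2 * B"])
    show "AE x in \<mu>. (\<lambda>N. \<bar>gibbs_mean (l1_box J N) f x - gibbs_mean (l1_box J N) f (zero_ext J x)\<bar>) \<longlonglongrightarrow> 0"
      using tempered
    proof eventually_elim
      case (elim x)
      then obtain C p where "\<And>k. \<bar>x k\<bar> \<le> C * (1 + real_of_int (l1_norm k)) ^ p" by blast
      then show ?case
        by (intro tendsto_rabs_zero box_mean_tempered[OF f \<open>0 \<le> L\<close> \<open>K \<subseteq> J\<close> B])
    qed
    show "AE x in \<mu>. norm \<bar>gibbs_mean (l1_box J N) f x - gibbs_mean (l1_box J N) f (zero_ext J x)\<bar> \<le> 2 * B" for N
    proof (rule AE_I2)
      fix x
      show "norm \<bar>gibbs_mean (l1_box J N) f x - gibbs_mean (l1_box J N) f (zero_ext J x)\<bar> \<le> 2 * B"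
        using abs_gibbs_mean_le[OF finite_l1_box fm B, of J N x]
          abs_gibbs_mean_le[OF finite_l1_box fm B, of J N "zero_ext J x"] by simp
    qed
  qed auto
  then show ?thesis by simp
qed

lemma l1_box_disjoint: "J \<subseteq> - l1_box J N"
  by (auto simp: l1_box_def)

lemma integral_box_mean_mult:
  fixes f :: "(int ^ 'n \<Rightarrow> real) \<Rightarrow> real"
  assumes "f \<in> borel_measurable config_space" "\<And>x. \<bar>f x\<bar> \<le> B"
    and g: "g \<in> spin_functions J" and "\<And>x. \<bar>g x\<bar> \<le> C"
  shows "(\<integral>x. gibbs_mean (l1_box J N) f x * g x \<partial>\<mu>) = (\<integral>x. f x * g x \<partial>\<mu>)"
  using g spin_functions_mono[OF l1_box_disjoint]
  by (intro integral_gibbs_mean_mult[OF finite_l1_box assms(1,2) _ assms(4)]) blast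

text \<open>The kernel mean \<open>g N\<close> conditions on more than the spins in
  \<open>J\<close>, but against functions of these spins it integrates like \<open>f\<close>, and so
  does the conditional expectation. The L1 distance of \<open>h N\<close> to the latter is therefore
  at most its distance to \<open>g N\<close>.\<close>

lemma box_mean_tendsto_cond_exp:
  fixes f :: "(int ^ 'n \<Rightarrow> real) \<Rightarrow> real"
  assumes f: "f \<in> incr_lipschitz K i L" and "0 \<le> L" and "K \<subseteq> J" and B: "\<And>x. \<bar>f x\<bar> \<le> B"
  shows "(\<lambda>N. \<integral>x. norm (gibbs_mean (l1_box J N) f (zero_ext J x) - real_cond_exp \<mu> (spins_sigma J) f x) \<partial>\<mu>)
    \<longlonglongrightarrow> 0"
proof -
  interpret sigma_finite_subalgebra \<mu> "spins_sigma J" by (rule sigma_finite_subalgebra_spins)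
  note fm [measurable] = incr_lipschitzD(1)[OF f]
  define e where "e = real_cond_exp \<mu> (spins_sigma J) f"
  define h where "h N x = gibbs_mean (l1_box J N) f (zero_ext J x)" for N x
  define g where "g N x = gibbs_mean (l1_box J N) f x" for N x
  have e: "e \<in> spin_functions J"
    by (simp add: e_def spin_functions_iff_measurable borel_measurable_cond_exp)
  have h: "h N \<in> spin_functions J" for N
    unfolding h_def[abs_def] by (rule box_mean_spin_functions) measurable
  have hB: "\<bar>h N x\<bar> \<le> B" and gB: "\<bar>g N x\<bar> \<le> B" for N x
    unfolding h_def g_def by (rule abs_gibbs_mean_le[OF finite_l1_box fm B])+
  have g: "g N \<in> borel_measurable config_space" for N
    unfolding g_def[abs_def] by (rule measurable_gibbs_mean[OF finite_l1_box fm])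
  note [measurable] = spin_functionsD(1)[OF e] spin_functionsD(1)[OF h] g
  have fi: "integrable \<mu> f" using B by (intro integrable_bounded_real[of _ B]) auto
  have ei: "integrable \<mu> e" unfolding e_def by (rule real_cond_exp_int(1)[OF fi])
  have hi: "integrable \<mu> (h N)" for N using hB by (intro integrable_bounded_real[of _ B]) auto
  have gi: "integrable \<mu> (g N)" for N using gB by (intro integrable_bounded_real[of _ B]) auto
  have le: "(\<integral>x. norm (h N x - e x) \<partial>\<mu>) \<le> (\<integral>x. \<bar>g N x - h N x\<bar> \<partial>\<mu>)" for N
  proof -
    \<comment> \<open>The sign that realises the L1 norm depends on the spins in \<open>J\<close>
      only, so it is an admissible test function.\<close>
    define s where "s x = sgn (e x - h N x)" for x
    have "s x = s y" if "\<forall>k\<in>J. x k = y k" for x y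
      using that spin_functionsD(2)[OF e, of x y] spin_functionsD(2)[OF h, of x y N] by (simp add: s_def)
    moreover have [measurable]: "s \<in> borel_measurable config_space" unfolding s_def by measurable
    ultimately have s: "s \<in> spin_functions J" by (auto simp: spin_functions_def)
    have s1: "\<bar>s x\<bar> \<le> 1" for x by (simp add: s_def abs_sgn_eq)
    have mult: "integrable \<mu> (\<lambda>x. u x * s x)" if u: "integrable \<mu> u" for u
    proof (rule Bochner_Integration.integrable_bound[OF u])
      have [measurable]: "u \<in> borel_measurable \<mu>" using u by simp
      show "(\<lambda>x. u x * s x) \<in> borel_measurable \<mu>" by measurable
      show "AE x in \<mu>. norm (u x * s x) \<le> norm (u x)"
        using s1 by (intro AE_I2) (simp add: abs_mult mult_left_le)
    qed
    have "(\<integral>x. norm (h N x - e x) \<partial>\<mu>) = (\<integral>x. e x * s x - h N x * s x \<partial>\<mu>)"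
      by (intro Bochner_Integration.integral_cong) (auto simp: s_def sgn_if algebra_simps)
    also have "\<dots> = (\<integral>x. e x * s x \<partial>\<mu>) - (\<integral>x. h N x * s x \<partial>\<mu>)"
      by (intro Bochner_Integration.integral_diff mult ei hi)
    also have "(\<integral>x. e x * s x \<partial>\<mu>) = (\<integral>x. f x * s x \<partial>\<mu>)"
      unfolding e_def by (rule real_cond_exp_spins[OF fm B s s1])
    also have "\<dots> = (\<integral>x. g N x * s x \<partial>\<mu>)"
      unfolding g_def by (rule integral_box_mean_mult[OF fm B s s1, symmetric])
    also have "(\<integral>x. g N x * s x \<partial>\<mu>) - (\<integral>x. h N x * s x \<partial>\<mu>) = (\<integral>x. g N x * s x - h N x * s x \<partial>\<mu>)"
      by (intro Bochner_Integration.integral_diff[symmetric] mult gi hi)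
    also have "\<dots> \<le> (\<integral>x. \<bar>g N x - h N x\<bar> \<partial>\<mu>)"
    proof (rule integral_mono)
      show "g N x * s x - h N x * s x \<le> \<bar>g N x - h N x\<bar>" for x
      proof -
        have "(g N x - h N x) * s x \<le> \<bar>g N x - h N x\<bar> * \<bar>s x\<bar>" by (metis abs_ge_self abs_mult)
        also have "\<dots> \<le> \<bar>g N x - h N x\<bar>" using s1[of x] by (simp add: mult_left_le)
        finally show ?thesis by (simp add: algebra_simps)
      qed
    qed (intro Bochner_Integration.integrable_diff mult integrable_abs gi hi)+
    finally show ?thesis .
  qed
  have lim: "(\<lambda>N. \<integral>x. \<bar>g N x - h N x\<bar> \<partial>\<mu>) \<longlonglongrightarrow> 0"
    unfolding g_def h_def by (rule box_mean_L1[OF assms])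
  have "(\<lambda>N. \<integral>x. norm (h N x - e x) \<partial>\<mu>) \<longlonglongrightarrow> 0"
  proof (rule Lim_null_comparison[OF always_eventually lim], rule allI)
    fix N
    have "0 \<le> (\<integral>x. norm (h N x - e x) \<partial>\<mu>)" by (rule Bochner_Integration.integral_nonneg) simp
    then show "norm (\<integral>x. norm (h N x - e x) \<partial>\<mu>) \<le> (\<integral>x. \<bar>g N x - h N x\<bar> \<partial>\<mu>)"
      using le[of N] by (simp only: real_norm_def abs_of_nonneg)
  qed
  then show ?thesis unfolding h_def e_def .
qed

text \<open>The comparison must hold for every pair of configurations, since the result is fed into
  the same argument again. A limsup of box means inherits it pointwise, and along an almost surely
  convergent subsequence it is a version of the conditional expectation.\<close>

lemma conditional_version:
  fixes f :: "(int ^ 'n \<Rightarrow> real) \<Rightarrow> real"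
  assumes f: "f \<in> incr_lipschitz K i L" and "0 \<le> L" and "K \<subseteq> J" and B: "\<And>x. \<bar>f x\<bar> \<le> B"
  obtains g where "g \<in> spin_functions J" "\<And>x. \<bar>g x\<bar> \<le> B"
    "\<And>x y d. (\<And>i. 0 \<le> d i) \<Longrightarrow> (\<And>i j. neighbours i j \<Longrightarrow> d j \<le> decay_rate TYPE('n) * d i) \<Longrightarrow>
      (\<And>k. k \<in> J \<Longrightarrow> x k \<le> y k + d k) \<Longrightarrow> (\<And>k. k \<in> K \<Longrightarrow> x k = y k) \<Longrightarrow> g x \<le> g y + L * d i"
    "\<And>\<psi> C. \<psi> \<in> spin_functions J \<Longrightarrow> (\<And>x. \<bar>\<psi> x\<bar> \<le> C) \<Longrightarrow> (\<integral>x. g x * \<psi> x \<partial>\<mu>) = (\<integral>x. f x * \<psi> x \<partial>\<mu>)"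
proof -
  interpret sigma_finite_subalgebra \<mu> "spins_sigma J" by (rule sigma_finite_subalgebra_spins)
  note fm [measurable] = incr_lipschitzD(1)[OF f]
  define e where "e = real_cond_exp \<mu> (spins_sigma J) f"
  define h where "h N x = gibbs_mean (l1_box J N) f (zero_ext J x)" for N x
  have e: "e \<in> spin_functions J"
    by (simp add: e_def spin_functions_iff_measurable borel_measurable_cond_exp)
  have h: "h N \<in> spin_functions J" for N
    unfolding h_def[abs_def] by (rule box_mean_spin_functions) measurable
  have hB: "\<bar>h N x\<bar> \<le> B" for N x
    unfolding h_def by (rule abs_gibbs_mean_le[OF finite_l1_box fm B])
  note [measurable] = spin_functionsD(1)[OF e] spin_functionsD(1)[OF h]
  have fi: "integrable \<mu> f" using B by (intro integrable_bounded_real[of _ B]) auto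
  have ei: "integrable \<mu> e" unfolding e_def by (rule real_cond_exp_int(1)[OF fi])
  have hi: "integrable \<mu> (h N)" for N using hB by (intro integrable_bounded_real[of _ B]) auto
  have "\<exists>r :: nat \<Rightarrow> nat. strict_mono r \<and> (AE x in \<mu>. (\<lambda>n. h (r n) x - e x) \<longlonglongrightarrow> 0)"
  proof (rule tendsto_L1_AE_subseq)
    show "(\<lambda>N. \<integral>x. norm (h N x - e x) \<partial>\<mu>) \<longlonglongrightarrow> 0"
      unfolding h_def e_def by (rule box_mean_tendsto_cond_exp[OF assms])
  qed (use hi ei in auto)
  then obtain r :: "nat \<Rightarrow> nat" where r: "AE x in \<mu>. (\<lambda>n. h (r n) x - e x) \<longlonglongrightarrow> 0" by blast
  \<comment> \<open>In \<open>ereal\<close> the limsup exists at every configuration, including the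
    null set where the sequence need not converge; the bound \<open>B\<close> makes it real.\<close>
  define G where "G x = limsup (\<lambda>n. ereal (h (r n) x))" for x
  define g where "g x = real_of_ereal (G x)" for x
  have [measurable]: "G \<in> borel_measurable config_space" unfolding G_def[abs_def] by measurable
  have GB: "G x \<le> ereal B" "ereal (- B) \<le> G x" for x
  proof -
    show "G x \<le> ereal B" unfolding G_def
      by (rule Limsup_bounded) (use hB[of _ x] in \<open>auto simp: abs_le_iff\<close>)
    show "ereal (- B) \<le> G x" unfolding G_def
      by (rule order_trans[OF _ Liminf_le_Limsup])
        (use hB[of _ x] in \<open>auto intro!: Liminf_bounded simp: abs_le_iff minus_le_iff\<close>)
  qed
  have Gg: "G x = ereal (g x)" for x
    using GB[of x] by (cases "G x") (auto simp: g_def)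
  show thesis
  proof (rule that[of g])
    show gJ: "g \<in> spin_functions J"
    proof -
      have "g x = g y" if "\<forall>k\<in>J. x k = y k" for x y
      proof -
        have "h N x = h N y" for N using that by (intro spin_functionsD(2)[OF h]) auto
        then show ?thesis by (simp add: g_def G_def)
      qed
      moreover have "g \<in> borel_measurable config_space" unfolding g_def[abs_def] by measurable
      ultimately show ?thesis by (auto simp: spin_functions_def)
    qed
    show "\<bar>g x\<bar> \<le> B" for x using GB[of x] by (simp add: Gg abs_le_iff minus_le_iff)
    show "g x \<le> g y + L * d i" if d: "\<And>i. 0 \<le> d i" "\<And>i j. neighbours i j \<Longrightarrow> d j \<le> decay_rate TYPE('n) * d i"
      and xy: "\<And>k. k \<in> J \<Longrightarrow> x k \<le> y k + d k" "\<And>k. k \<in> K \<Longrightarrow> x k = y k" for x y d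
    proof -
      have "G x \<le> limsup (\<lambda>n. ereal (L * d i) + ereal (h (r n) y))"
        unfolding G_def h_def
        using box_mean_incr_lipschitz[OF f \<open>K \<subseteq> J\<close> B d xy]
        by (intro Limsup_mono always_eventually allI) (simp add: add.commute)
      also have "\<dots> = ereal (L * d i) + G y"
        unfolding G_def by (rule ereal_limsup_lim_add) auto
      finally show ?thesis by (simp add: Gg add.commute)
    qed
    show "(\<integral>x. g x * \<psi> x \<partial>\<mu>) = (\<integral>x. f x * \<psi> x \<partial>\<mu>)"
      if \<psi>: "\<psi> \<in> spin_functions J" "\<And>x. \<bar>\<psi> x\<bar> \<le> C" for \<psi> C
    proof -
      note [measurable] = spin_functionsD(1)[OF \<psi>(1)] spin_functionsD(1)[OF gJ]
      have "AE x in \<mu>. g x = e x"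
        using r
      proof eventually_elim
        case (elim x)
        then have "(\<lambda>n. h (r n) x) \<longlonglongrightarrow> e x" by (simp add: LIM_zero_iff)
        then have "G x = ereal (e x)"
          unfolding G_def by (intro lim_imp_Limsup) auto
        then show ?case by (simp add: g_def)
      qed
      then have "(\<integral>x. g x * \<psi> x \<partial>\<mu>) = (\<integral>x. e x * \<psi> x \<partial>\<mu>)"
        by (intro integral_cong_AE) auto
      also have "\<dots> = (\<integral>x. f x * \<psi> x \<partial>\<mu>)"
        unfolding e_def by (rule real_cond_exp_spins[OF fm B \<psi>])
      finally show ?thesis .
    qed
  qed
qed

section \<open>Orthogonal projection and conditional variance\<close>

lemma integrable_mult_bounded:
  fixes f g :: "(int ^ 'n \<Rightarrow> real) \<Rightarrow> real"
  assumes [measurable]: "f \<in> borel_measurable \<mu>" "g \<in> borel_measurable \<mu>"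
    and "\<And>x. \<bar>f x\<bar> \<le> A" "\<And>x. \<bar>g x\<bar> \<le> B"
  shows "integrable \<mu> (\<lambda>x. f x * g x)"
proof (rule integrable_bounded_real[of _ "A * B"])
  show "\<bar>f x * g x\<bar> \<le> A * B" for x
    unfolding abs_mult using assms(3,4)[of x] by (intro mult_mono) auto
qed measurable

text \<open>Pythagoras: \<open>f - g\<close> is orthogonal to \<open>g - h\<close>, which is an
  admissible test function.\<close>

lemma projection_optimal:
  fixes f :: "(int ^ 'n \<Rightarrow> real) \<Rightarrow> real"
  assumes fm: "f \<in> borel_measurable config_space" and B: "\<And>x. \<bar>f x\<bar> \<le> B"
    and g: "g \<in> spin_functions K" and C: "\<And>x. \<bar>g x\<bar> \<le> C"
    and h: "h \<in> spin_functions K" and D: "\<And>x. \<bar>h x\<bar> \<le> D"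
    and proj: "\<And>\<psi> D. \<psi> \<in> spin_functions K \<Longrightarrow> (\<And>x. \<bar>\<psi> x\<bar> \<le> D) \<Longrightarrow> (\<integral>x. g x * \<psi> x \<partial>\<mu>) = (\<integral>x. f x * \<psi> x \<partial>\<mu>)"
  shows "(\<integral>x. (f x - g x)\<^sup>2 \<partial>\<mu>) \<le> (\<integral>x. (f x - h x)\<^sup>2 \<partial>\<mu>)"
proof -
  have gh: "(\<lambda>x. g x - h x) \<in> spin_functions K" by (rule spin_functions_diff[OF g h])
  note [measurable] = fm spin_functionsD(1)[OF g] spin_functionsD(1)[OF h]
  have bounds: "\<bar>f x - g x\<bar> \<le> B + C" "\<bar>g x - h x\<bar> \<le> C + D" for x
    using B[of x] C[of x] D[of x] by (auto simp: abs_le_iff)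
  note int2 = integrable_mult_bounded
  have i: "integrable \<mu> (\<lambda>x. (f x - g x) * (f x - g x))" "integrable \<mu> (\<lambda>x. (f x - g x) * (g x - h x))"
    "integrable \<mu> (\<lambda>x. (g x - h x) * (g x - h x))"
    "integrable \<mu> (\<lambda>x. f x * (g x - h x))" "integrable \<mu> (\<lambda>x. g x * (g x - h x))"
    by (rule int2[OF _ _ bounds(1) bounds(1)] int2[OF _ _ bounds(1) bounds(2)]
        int2[OF _ _ bounds(2) bounds(2)] int2[OF _ _ B bounds(2)] int2[OF _ _ C bounds(2)]; measurable)+
  have "(\<integral>x. (f x - g x) * (g x - h x) \<partial>\<mu>) =
      (\<integral>x. f x * (g x - h x) - g x * (g x - h x) \<partial>\<mu>)"
    by (simp add: left_diff_distrib)
  also have "\<dots> = 0"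
    using i(4,5) proj[OF gh bounds(2)] by simp
  finally have 0: "(\<integral>x. (f x - g x) * (g x - h x) \<partial>\<mu>) = 0" .
  have "(\<integral>x. (f x - h x)\<^sup>2 \<partial>\<mu>) = (\<integral>x. (f x - g x) * (f x - g x) +
      2 * ((f x - g x) * (g x - h x)) + (g x - h x) * (g x - h x) \<partial>\<mu>)"
    by (intro Bochner_Integration.integral_cong) (auto simp: power2_eq_square algebra_simps)
  also have "\<dots> = (\<integral>x. (f x - g x) * (f x - g x) \<partial>\<mu>) + (\<integral>x. (g x - h x) * (g x - h x) \<partial>\<mu>)"
    using i(1-3) 0 by simp
  also have "\<dots> \<ge> (\<integral>x. (f x - g x) * (f x - g x) \<partial>\<mu>)" by simp
  finally show ?thesis by (simp add: power2_eq_square)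
qed

text \<open>By optimality \<open>g\<close> may be replaced by the box mean \<open>h N\<close>. Split
  \<open>f - h N\<close> at the kernel mean \<open>m N\<close>: the first part is an average of
  finite-volume variances as soon as the box contains \<open>i\<close>, the second is bounded and
  tends to 0 in L1. The inequality \<open>(a + b)^2 \<le> 2 * a^2 + 2 * b^2\<close> turns the
  constant 2 into 4.\<close>

lemma conditional_variance_le:
  fixes f :: "(int ^ 'n \<Rightarrow> real) \<Rightarrow> real"
  assumes f: "f \<in> incr_lipschitz K i L" and "0 \<le> L" and "i \<notin> K" and B: "\<And>x. \<bar>f x\<bar> \<le> B"
    and g: "g \<in> spin_functions K" and gC: "\<And>x. \<bar>g x\<bar> \<le> C"
    and proj: "\<And>\<psi> D. \<psi> \<in> spin_functions K \<Longrightarrow> (\<And>x. \<bar>\<psi> x\<bar> \<le> D) \<Longrightarrow> (\<integral>x. g x * \<psi> x \<partial>\<mu>) = (\<integral>x. f x * \<psi> x \<partial>\<mu>)"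
  shows "(\<integral>x. (f x - g x)\<^sup>2 \<partial>\<mu>) \<le> 4 * L\<^sup>2 * exp (1 / (\<beta> * v))"
proof -
  let ?E = "exp (1 / (\<beta> * v))"
  note fm [measurable] = incr_lipschitzD(1)[OF f]
  define h where "h N x = gibbs_mean (l1_box K N) f (zero_ext K x)" for N x
  define m where "m N x = gibbs_mean (l1_box K N) f x" for N x
  have h: "h N \<in> spin_functions K" for N
    unfolding h_def[abs_def] by (rule box_mean_spin_functions) measurable
  have hB: "\<bar>h N x\<bar> \<le> B" and mB: "\<bar>m N x\<bar> \<le> B" for N x
    unfolding h_def m_def by (rule abs_gibbs_mean_le[OF finite_l1_box fm B])+
  have m: "m N \<in> borel_measurable config_space" for N
    unfolding m_def[abs_def] by (rule measurable_gibbs_mean[OF finite_l1_box fm])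
  note [measurable] = spin_functionsD(1)[OF g] spin_functionsD(1)[OF h] m
  have B0: "0 \<le> B" "0 \<le> C" using B[of undefined] gC[of undefined] by auto
  have bounds: "\<bar>f x - g x\<bar> \<le> B + C" "\<bar>g x - h N x\<bar> \<le> B + C" "\<bar>f x - m N x\<bar> \<le> 2 * B"
      "\<bar>m N x - h N x\<bar> \<le> 2 * B" "\<bar>f x - h N x\<bar> \<le> 2 * B" for x N
    using B[of x] gC[of x] hB[of N x] mB[of N x] by (auto simp: abs_le_iff)
  have opt: "(\<integral>x. (f x - g x)\<^sup>2 \<partial>\<mu>) \<le> (\<integral>x. (f x - h N x)\<^sup>2 \<partial>\<mu>)" for N
    by (rule projection_optimal[OF fm B g gC h hB]) (use proj in auto)
  have var: "(\<integral>x. (f x - m N x)\<^sup>2 \<partial>\<mu>) \<le> 2 * L\<^sup>2 * ?E" if N: "l1_norm i \<le> int N" for N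
  proof -
    have sq: "\<bar>(f x - m N x)\<^sup>2\<bar> \<le> (2 * B)\<^sup>2" for x
      using power_mono[OF bounds(3)[of x N] abs_ge_zero, of 2] by simp
    have "(\<integral>x. (f x - m N x)\<^sup>2 \<partial>\<mu>) = (\<integral>x. gibbs_mean (l1_box K N) (\<lambda>x. (f x - m N x)\<^sup>2) x \<partial>\<mu>)"
      by (rule integral_gibbs_mean[OF finite_l1_box _ sq, symmetric]) measurable
    also have "\<dots> \<le> 2 * L\<^sup>2 * ?E"
    proof (rule integral_le_const)
      have "gibbs_mean (l1_box K N) (\<lambda>x. (f x - m N x)\<^sup>2) \<in> borel_measurable config_space"
        by (rule measurable_gibbs_mean[OF finite_l1_box]) measurable
      moreover have "\<bar>gibbs_mean (l1_box K N) (\<lambda>x. (f x - m N x)\<^sup>2) x\<bar> \<le> (2 * B)\<^sup>2" for x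
        by (rule abs_gibbs_mean_le[OF finite_l1_box _ sq]) measurable
      ultimately show "integrable \<mu> (gibbs_mean (l1_box K N) (\<lambda>x. (f x - m N x)\<^sup>2))"
        by (intro integrable_bounded_real[of _ "(2 * B)\<^sup>2"]) auto
      show "AE x in \<mu>. gibbs_mean (l1_box K N) (\<lambda>x. (f x - m N x)\<^sup>2) x \<le> 2 * L\<^sup>2 * ?E"
      proof (rule AE_I2)
        fix x
        show "gibbs_mean (l1_box K N) (\<lambda>x. (f x - m N x)\<^sup>2) x \<le> 2 * L\<^sup>2 * ?E"
          unfolding m_def
        proof (rule gibbs_mean_variance_le[OF finite_l1_box _ fm B])
          show "i \<in> l1_box K N" using N \<open>i \<notin> K\<close> by (simp add: l1_box_def)
          show "\<bar>f x - f y\<bar> \<le> L * \<bar>x i - y i\<bar>" if "\<And>k. k \<notin> l1_box K N \<Longrightarrow> x k = y k" for x y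
            using that by (intro incr_lipschitz_abs[OF f \<open>0 \<le> L\<close>]) (auto simp: l1_box_def)
        qed
      qed
    qed
    finally show ?thesis .
  qed
  define \<delta> where "\<delta> N = (\<integral>x. \<bar>m N x - h N x\<bar> \<partial>\<mu>)" for N
  have "\<delta> \<longlonglongrightarrow> 0"
    unfolding \<delta>_def[abs_def] m_def h_def by (rule box_mean_L1[OF f \<open>0 \<le> L\<close> order_refl B])
  then have lim: "(\<lambda>N. 4 * L\<^sup>2 * ?E + 4 * B * \<delta> N) \<longlonglongrightarrow> 4 * L\<^sup>2 * ?E + 4 * B * 0"
    by (intro tendsto_intros)
  have "(\<integral>x. (f x - g x)\<^sup>2 \<partial>\<mu>) \<le> 4 * L\<^sup>2 * ?E + 4 * B * \<delta> N" if N: "N \<ge> nat (l1_norm i)" for N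
  proof -
    have i: "integrable \<mu> (\<lambda>x. (f x - m N x) * (f x - m N x))" "integrable \<mu> (\<lambda>x. m N x - h N x)"
        "integrable \<mu> (\<lambda>x. (f x - h N x) * (f x - h N x))"
      by ((rule integrable_mult_bounded[OF _ _ bounds(3) bounds(3)] integrable_mult_bounded[OF _ _ bounds(5) bounds(5)]
          integrable_bounded_real[OF _ bounds(4)]; measurable)+)
    have "(\<integral>x. (f x - h N x)\<^sup>2 \<partial>\<mu>) \<le> (\<integral>x. 2 * (f x - m N x)\<^sup>2 + 4 * B * \<bar>m N x - h N x\<bar> \<partial>\<mu>)"
    proof (rule integral_mono)
      fix x
      have "(f x - h N x)\<^sup>2 \<le> 2 * (f x - m N x)\<^sup>2 + 2 * (m N x - h N x)\<^sup>2"
        using sum_squares_bound[of "f x - m N x" "m N x - h N x"]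
        by (simp add: power2_eq_square algebra_simps)
      also have "(m N x - h N x)\<^sup>2 = \<bar>m N x - h N x\<bar> * \<bar>m N x - h N x\<bar>" by (simp add: power2_eq_square)
      also have "\<dots> \<le> 2 * B * \<bar>m N x - h N x\<bar>" by (intro mult_right_mono bounds) auto
      finally show "(f x - h N x)\<^sup>2 \<le> 2 * (f x - m N x)\<^sup>2 + 4 * B * \<bar>m N x - h N x\<bar>" by simp
    qed (use i in \<open>auto simp: power2_eq_square\<close>)
    also have "\<dots> = 2 * (\<integral>x. (f x - m N x)\<^sup>2 \<partial>\<mu>) + 4 * B * \<delta> N"
      using i(1,2) by (simp add: \<delta>_def power2_eq_square)
    also have "\<dots> \<le> 2 * (2 * L\<^sup>2 * ?E) + 4 * B * \<delta> N"
      using N by (intro add_right_mono mult_left_mono var) auto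
    finally show ?thesis using opt[of N] by simp
  qed
  then have "\<exists>M. \<forall>N\<ge>M. (\<integral>x. (f x - g x)\<^sup>2 \<partial>\<mu>) \<le> 4 * L\<^sup>2 * ?E + 4 * B * \<delta> N" by blast
  from LIMSEQ_le_const[OF lim this] show ?thesis by simp
qed

end

section \<open>Contraction\<close>

context prob_space
begin

definition L2 :: "('a \<Rightarrow> real) set" where
  "L2 = {f \<in> borel_measurable M. integrable M (\<lambda>x. (f x)\<^sup>2)}"

lemma L2_mult_integrable:
  assumes "f \<in> L2" "g \<in> L2"
  shows "integrable M (\<lambda>x. f x * g x)"
proof (rule Bochner_Integration.integrable_bound)
  show "integrable M (\<lambda>x. (f x)\<^sup>2 + (g x)\<^sup>2)" using assms by (simp add: L2_def)
  have "\<bar>f x * g x\<bar> \<le> (f x)\<^sup>2 + (g x)\<^sup>2" for x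
    using sum_squares_bound[of "f x" "g x"] sum_squares_bound[of "- f x" "g x"] by (simp add: abs_le_iff)
  then show "AE x in M. norm (f x * g x) \<le> norm ((f x)\<^sup>2 + (g x)\<^sup>2)" by simp
qed (use assms in \<open>auto simp: L2_def\<close>)

lemma L2_integrable: "f \<in> L2 \<Longrightarrow> integrable M f"
  using L2_mult_integrable[of f "\<lambda>_. 1"] by (simp add: L2_def)

lemma L2_bounded:
  assumes "f \<in> borel_measurable M" "\<And>x. \<bar>f x\<bar> \<le> B"
  shows "f \<in> L2"
proof -
  have "\<bar>(f x)\<^sup>2\<bar> \<le> B\<^sup>2" for x using power_mono[OF assms(2)[of x] abs_ge_zero, of 2] by simp
  then show ?thesis using assms(1) by (auto simp: L2_def intro!: integrable_bounded_real[of _ "B\<^sup>2"])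
qed

lemma L2_cmult: "f \<in> L2 \<Longrightarrow> (\<lambda>x. c * f x) \<in> L2"
  by (auto simp: L2_def power_mult_distrib)

lemma L2_add:
  assumes "f \<in> L2" "g \<in> L2"
  shows "(\<lambda>x. f x + g x) \<in> L2"
  using assms L2_mult_integrable[OF assms] by (auto simp: L2_def power2_sum mult.assoc)

lemma L2_diff:
  assumes "f \<in> L2" "g \<in> L2"
  shows "(\<lambda>x. f x - g x) \<in> L2"
  using L2_add[OF assms(1) L2_cmult[OF assms(2), of "- 1"]] by simp

definition norm2 :: "('a \<Rightarrow> real) \<Rightarrow> real" where
  "norm2 f = sqrt (\<integral>x. (f x)\<^sup>2 \<partial>M)"

lemma norm2_nonneg [simp]: "0 \<le> norm2 f"
  by (simp add: norm2_def)

lemma norm2_power2: "(norm2 f)\<^sup>2 = (\<integral>x. (f x)\<^sup>2 \<partial>M)"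
  by (simp add: norm2_def)

lemma Cauchy_Schwarz_L2:
  assumes "f \<in> L2" "g \<in> L2"
  shows "\<bar>\<integral>x. f x * g x \<partial>M\<bar> \<le> norm2 f * norm2 g"
proof -
  define F where "F = (\<integral>x. (f x)\<^sup>2 \<partial>M)"
  define G where "G = (\<integral>x. (g x)\<^sup>2 \<partial>M)"
  define H where "H = (\<integral>x. f x * g x \<partial>M)"
  have i: "integrable M (\<lambda>x. (f x)\<^sup>2)" "integrable M (\<lambda>x. (g x)\<^sup>2)" "integrable M (\<lambda>x. f x * g x)"
    using assms L2_mult_integrable[OF assms] by (auto simp: L2_def)
  have *: "0 \<le> a\<^sup>2 * F - 2 * (a * b) * H + b\<^sup>2 * G" for a b
  proof -
    have "0 \<le> (\<integral>x. (a * f x - b * g x)\<^sup>2 \<partial>M)" by simp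
    also have "\<dots> = (\<integral>x. a\<^sup>2 * (f x)\<^sup>2 - 2 * (a * b) * (f x * g x) + b\<^sup>2 * (g x)\<^sup>2 \<partial>M)"
      by (intro Bochner_Integration.integral_cong) (auto simp: power2_diff power_mult_distrib)
    also have "\<dots> = a\<^sup>2 * F - 2 * (a * b) * H + b\<^sup>2 * G"
      using i by (simp add: F_def G_def H_def)
    finally show ?thesis .
  qed
  have G0: "0 \<le> G" "0 \<le> F" by (auto simp: G_def F_def)
  have "H\<^sup>2 \<le> F * G"
  proof (cases "G = 0")
    case True
    have "H = 0"
    proof (rule ccontr)
      assume "H \<noteq> 0"
      \<comment> \<open>When \<open>G = 0\<close> the quadratic form is affine in \<open>b\<close>;
        this \<open>b\<close> gives it the value -1.\<close>
      have "0 \<le> F - 2 * ((F + 1) / (2 * H)) * H" using *[of 1 "(F + 1) / (2 * H)"] True by simp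
      then show False using \<open>H \<noteq> 0\<close> by simp
    qed
    then show ?thesis using True by simp
  next
    case False
    have "0 \<le> G * (F * G - H\<^sup>2)"
      using *[of G H] by (simp add: power2_eq_square algebra_simps)
    then show ?thesis using False G0 by (simp add: zero_le_mult_iff)
  qed
  then have "sqrt (H\<^sup>2) \<le> sqrt (F * G)" by (rule real_sqrt_le_mono)
  then show ?thesis by (simp add: F_def G_def H_def norm2_def real_sqrt_mult)
qed

lemma norm2_triangle:
  assumes "f \<in> L2" "g \<in> L2"
  shows "norm2 (\<lambda>x. f x + g x) \<le> norm2 f + norm2 g"
proof (rule power2_le_imp_le)
  have i: "integrable M (\<lambda>x. (f x)\<^sup>2)" "integrable M (\<lambda>x. (g x)\<^sup>2)" "integrable M (\<lambda>x. f x * g x)"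
    using assms L2_mult_integrable[OF assms] by (auto simp: L2_def)
  have "(norm2 (\<lambda>x. f x + g x))\<^sup>2 = (\<integral>x. (f x)\<^sup>2 + (g x)\<^sup>2 + 2 * (f x * g x) \<partial>M)"
    by (simp add: norm2_power2 power2_sum mult.assoc)
  also have "\<dots> = (norm2 f)\<^sup>2 + (norm2 g)\<^sup>2 + 2 * (\<integral>x. f x * g x \<partial>M)"
    using i by (simp add: norm2_power2)
  also have "\<dots> \<le> (norm2 f)\<^sup>2 + (norm2 g)\<^sup>2 + 2 * (norm2 f * norm2 g)"
    using Cauchy_Schwarz_L2[OF assms] by simp
  finally show "(norm2 (\<lambda>x. f x + g x))\<^sup>2 \<le> (norm2 f + norm2 g)\<^sup>2"
    by (simp add: power2_sum)
qed simp

lemma norm2_minus_commute: "norm2 (\<lambda>x. f x - g x) = norm2 (\<lambda>x. g x - f x)"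
  by (simp add: norm2_def power2_commute)

lemma norm2_cmult: "norm2 (\<lambda>x. c * f x) = \<bar>c\<bar> * norm2 f"
  by (simp add: norm2_def power_mult_distrib real_sqrt_mult)

lemma norm2_triangle_diff:
  assumes "f \<in> L2" "g \<in> L2" "h \<in> L2"
  shows "norm2 (\<lambda>x. f x - h x) \<le> norm2 (\<lambda>x. f x - g x) + norm2 (\<lambda>x. g x - h x)"
  using norm2_triangle[OF L2_diff[OF assms(1,2)] L2_diff[OF assms(2,3)]] by simp

end

text \<open>Log-convexity turns a bound on the exponential growth rate into a bound on the first ratio.\<close>

lemma log_convex_ratio_le:
  fixes a :: "nat \<Rightarrow> real"
  assumes nonneg: "\<And>n. 0 \<le> a n" and convex: "\<And>n. (a (Suc n))\<^sup>2 \<le> a n * a (Suc (Suc n))"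
    and bound: "\<And>n. a n \<le> C * r ^ n" and "0 < r"
  shows "a 1 \<le> r * a 0"
proof (rule ccontr)
  assume "\<not> a 1 \<le> r * a 0"
  then have less: "r * a 0 < a 1" by simp
  have "a 0 \<noteq> 0" using convex[of 0] less by auto
  then have a0: "0 < a 0" using nonneg[of 0] by simp
  \<comment> \<open>Log-convexity makes successive ratios nondecreasing, so the sequence grows at
    least like the powers of its first ratio \<open>t\<close>, which exceeds
    \<open>r\<close>.\<close>
  define t where "t = a 1 / a 0"
  have t: "r < t" using less a0 by (simp add: t_def pos_less_divide_eq)
  have step: "0 < a n \<and> t * a n \<le> a (Suc n)" for n
  proof (induction n)
    case 0
    then show ?case using a0 by (simp add: t_def)
  next
    case (Suc n)
    then have pos: "0 < a n" by blast
    with t \<open>0 < r\<close> have "0 < t * a n" by (intro mult_pos_pos) auto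
    also have "\<dots> \<le> a (Suc n)" using Suc by blast
    finally have pos': "0 < a (Suc n)" .
    have "t * a n * a (Suc n) \<le> (a (Suc n))\<^sup>2"
      unfolding power2_eq_square using Suc pos' by (intro mult_right_mono) auto
    also have "\<dots> \<le> a n * a (Suc (Suc n))" by (rule convex)
    finally have "a n * (t * a (Suc n)) \<le> a n * a (Suc (Suc n))" by (simp add: mult_ac)
    then show ?case using pos pos' by (simp add: mult_le_cancel_left_pos)
  qed
  have lower: "t ^ n * a 0 \<le> a n" for n
  proof (induction n)
    case (Suc n)
    have "t ^ Suc n * a 0 \<le> t * a n" using Suc t \<open>0 < r\<close> by (simp add: mult.assoc)
    also have "\<dots> \<le> a (Suc n)" using step by blast
    finally show ?case .
  qed simp
  obtain n where n: "C / a 0 < (t / r) ^ n"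
    using real_arch_pow[of "t / r" "C / a 0"] t \<open>0 < r\<close> by auto
  have "t ^ n * a 0 \<le> C * r ^ n" using lower bound order_trans by blast
  then have "(t / r) ^ n \<le> C / a 0" using a0 \<open>0 < r\<close> by (simp add: power_divide field_simps)
  then show False using n by simp
qed

context gibbs_state
begin

text \<open>Bounded differences of increasing Lipschitz functions; they are dense in \<open>L\<^sup>2\<close>.\<close>

definition lipschitz_diff ::
  "(int ^ 'n) set \<Rightarrow> int ^ 'n \<Rightarrow> real \<Rightarrow> real \<Rightarrow> ((int ^ 'n \<Rightarrow> real) \<Rightarrow> real) set" where
  "lipschitz_diff K i L B = {\<lambda>x. f x - g x | f g.
    f \<in> incr_lipschitz K i L \<and> g \<in> incr_lipschitz K i L \<and> (\<forall>x. \<bar>f x\<bar> \<le> B) \<and> (\<forall>x. \<bar>g x\<bar> \<le> B)}"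

lemma lipschitz_diff_spin_functions:
  assumes "u \<in> lipschitz_diff K i L B"
  shows "u \<in> spin_functions (insert i K)" "\<bar>u x\<bar> \<le> 2 * B"
proof -
  obtain f g where u: "u = (\<lambda>x. f x - g x)" and fg: "f \<in> incr_lipschitz K i L" "g \<in> incr_lipschitz K i L"
    "\<And>x. \<bar>f x\<bar> \<le> B" "\<And>x. \<bar>g x\<bar> \<le> B"
    using assms unfolding lipschitz_diff_def by blast
  show "u \<in> spin_functions (insert i K)"
    unfolding u using incr_lipschitz_spin_functions[OF fg(1)] incr_lipschitz_spin_functions[OF fg(2)]
    by (rule spin_functions_diff)
  show "\<bar>u x\<bar> \<le> 2 * B"
    using fg(3,4)[of x] by (simp add: u abs_le_iff)
qed

text \<open>Conditional expectation in weak form, as an identity against bounded tests. That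
  \<open>g\<close> is itself a function of the spins in \<open>J\<close> is recorded
  separately.\<close>

definition is_projection ::
  "(int ^ 'n) set \<Rightarrow> ((int ^ 'n \<Rightarrow> real) \<Rightarrow> real) \<Rightarrow> ((int ^ 'n \<Rightarrow> real) \<Rightarrow> real) \<Rightarrow> bool" where
  "is_projection J f g \<longleftrightarrow> (\<forall>\<psi>\<in>spin_functions J. (\<exists>C. \<forall>x. \<bar>\<psi> x\<bar> \<le> C) \<longrightarrow>
    (\<integral>x. g x * \<psi> x \<partial>\<mu>) = (\<integral>x. f x * \<psi> x \<partial>\<mu>))"

lemma is_projectionI:
  assumes "\<And>\<psi> C. \<psi> \<in> spin_functions J \<Longrightarrow> (\<And>x. \<bar>\<psi> x\<bar> \<le> C) \<Longrightarrow>
    (\<integral>x. g x * \<psi> x \<partial>\<mu>) = (\<integral>x. f x * \<psi> x \<partial>\<mu>)"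
  shows "is_projection J f g"
  using assms unfolding is_projection_def by blast

lemma is_projectionD:
  assumes "is_projection J f g" "\<psi> \<in> spin_functions J" "\<And>x. \<bar>\<psi> x\<bar> \<le> C"
  shows "(\<integral>x. g x * \<psi> x \<partial>\<mu>) = (\<integral>x. f x * \<psi> x \<partial>\<mu>)"
  using assms unfolding is_projection_def by blast

lemma is_projection_diff:
  assumes p: "is_projection J f f'" "is_projection J g g'"
    and m: "f \<in> borel_measurable config_space" "g \<in> borel_measurable config_space"
      "f' \<in> borel_measurable config_space" "g' \<in> borel_measurable config_space"
    and B: "\<And>x. \<bar>f x\<bar> \<le> B" "\<And>x. \<bar>g x\<bar> \<le> B" "\<And>x. \<bar>f' x\<bar> \<le> B" "\<And>x. \<bar>g' x\<bar> \<le> B"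
  shows "is_projection J (\<lambda>x. f x - g x) (\<lambda>x. f' x - g' x)"
proof (rule is_projectionI)
  fix \<psi> C assume \<psi>: "\<psi> \<in> spin_functions J" "\<And>x. \<bar>\<psi> x\<bar> \<le> (C::real)"
  note [measurable] = m spin_functionsD(1)[OF \<psi>(1)]
  have "integrable \<mu> (\<lambda>x. f x * \<psi> x)" "integrable \<mu> (\<lambda>x. g x * \<psi> x)"
    "integrable \<mu> (\<lambda>x. f' x * \<psi> x)" "integrable \<mu> (\<lambda>x. g' x * \<psi> x)"
    by (rule integrable_mult_bounded[OF _ _ B(1) \<psi>(2)] integrable_mult_bounded[OF _ _ B(2) \<psi>(2)]
        integrable_mult_bounded[OF _ _ B(3) \<psi>(2)] integrable_mult_bounded[OF _ _ B(4) \<psi>(2)]; measurable)+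
  then show "(\<integral>x. (f' x - g' x) * \<psi> x \<partial>\<mu>) = (\<integral>x. (f x - g x) * \<psi> x \<partial>\<mu>)"
    using is_projectionD[OF p(1) \<psi>] is_projectionD[OF p(2) \<psi>]
    by (simp add: left_diff_distrib)
qed

text \<open>The value at \<open>i\<close> of the shift that equals 1 at \<open>j\<close> and
  decreases by the factor \<open>decay_rate\<close> per unit of distance.\<close>

definition \<kappa> :: "int ^ 'n \<Rightarrow> int ^ 'n \<Rightarrow> real" where
  "\<kappa> i j = 1 / decay_rate TYPE('n) ^ nat (l1_norm (i - j))"

lemma \<kappa>_pos: "0 < \<kappa> i j"
  using decay_rate_gt_1[where n = "TYPE('n)"] by (simp add: \<kappa>_def)

lemma \<kappa>_commute: "\<kappa> i j = \<kappa> j i"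
  by (simp add: \<kappa>_def l1_norm_minus_commute[of i])

lemma projection_incr_lipschitz:
  assumes f: "f \<in> incr_lipschitz K i L" and "0 \<le> L" and B: "\<And>x. \<bar>f x\<bar> \<le> B"
  obtains g where "g \<in> incr_lipschitz K j (\<kappa> i j * L)" "\<And>x. \<bar>g x\<bar> \<le> B" "is_projection (insert j K) f g"
proof -
  let ?q = "decay_rate TYPE('n)"
  have q: "1 < ?q" by (rule decay_rate_gt_1)
  obtain g where g: "g \<in> spin_functions (insert j K)" "\<And>x. \<bar>g x\<bar> \<le> B"
    and gl: "\<And>x y d. (\<And>i. 0 \<le> d i) \<Longrightarrow> (\<And>i j. neighbours i j \<Longrightarrow> d j \<le> ?q * d i) \<Longrightarrow>
      (\<And>k. k \<in> insert j K \<Longrightarrow> x k \<le> y k + d k) \<Longrightarrow> (\<And>k. k \<in> K \<Longrightarrow> x k = y k) \<Longrightarrow> g x \<le> g y + L * d i"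
    and gp: "\<And>\<psi> C. \<psi> \<in> spin_functions (insert j K) \<Longrightarrow> (\<And>x. \<bar>\<psi> x\<bar> \<le> C) \<Longrightarrow>
      (\<integral>x. g x * \<psi> x \<partial>\<mu>) = (\<integral>x. f x * \<psi> x \<partial>\<mu>)"
    using conditional_version[OF f \<open>0 \<le> L\<close> subset_insertI B] by blast
  show thesis
  proof (rule that[of g])
    show "g \<in> incr_lipschitz K j (\<kappa> i j * L)"
      unfolding incr_lipschitz_def
    proof (intro CollectI conjI allI impI)
      show "g \<in> borel_measurable config_space" by (rule spin_functionsD(1)[OF g(1)])
      fix x y :: "int ^ 'n \<Rightarrow> real" and \<delta> assume K: "\<forall>k\<in>K. x k = y k" and \<delta>: "0 \<le> \<delta>" "x j \<le> y j + \<delta>"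
      \<comment> \<open>Height \<delta> at \<open>j\<close>, falling off as fast as the condition
        per bond permits. On \<open>K\<close> nonnegativity suffices, because \<open>x\<close> and
        \<open>y\<close> agree there, and at \<open>i\<close> the value is
        \<open>\<kappa> i j * \<delta>\<close>.\<close>
      define d where "d k = \<delta> / ?q ^ nat (l1_norm (k - j))" for k
      have "g x \<le> g y + L * d i"
      proof (rule gl)
        show d0: "0 \<le> d k" for k using \<delta> q by (simp add: d_def)
        show "d k' \<le> ?q * d k" if "neighbours k k'" for k k'
        proof -
          have "?q ^ nat (l1_norm (k - j)) \<le> ?q * ?q ^ nat (l1_norm (k' - j))"
            using that q by (intro power_l1_norm_neighbours) (auto simp: neighbours_commute)
          then have "\<delta> * ?q ^ nat (l1_norm (k - j)) \<le> \<delta> * (?q * ?q ^ nat (l1_norm (k' - j)))"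
            using \<delta> by (intro mult_left_mono)
          then show ?thesis using q by (simp add: d_def field_simps)
        qed
        show "x k \<le> y k + d k" if "k \<in> insert j K" for k
          using that \<delta> d0[of k] K by (auto simp: d_def l1_norm_def)
        show "k \<in> K \<Longrightarrow> x k = y k" for k using K by blast
      qed
      then show "g x \<le> g y + \<kappa> i j * L * \<delta>" by (simp add: d_def \<kappa>_def)
    qed
    show "\<bar>g x\<bar> \<le> B" for x by (rule g)
    show "is_projection (insert j K) f g" by (rule is_projectionI) (rule gp)
  qed
qed

lemma projection_lipschitz_diff:
  assumes "u \<in> lipschitz_diff K i L B" and "0 \<le> L"
  shows "\<exists>u'. u' \<in> lipschitz_diff K j (\<kappa> i j * L) B \<and> is_projection (insert j K) u u'"
proof -
  obtain f g where u: "u = (\<lambda>x. f x - g x)" and fg: "f \<in> incr_lipschitz K i L" "g \<in> incr_lipschitz K i L"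
    "\<And>x. \<bar>f x\<bar> \<le> B" "\<And>x. \<bar>g x\<bar> \<le> B"
    using assms unfolding lipschitz_diff_def by blast
  obtain f' where f': "f' \<in> incr_lipschitz K j (\<kappa> i j * L)" "\<And>x. \<bar>f' x\<bar> \<le> B" "is_projection (insert j K) f f'"
    using projection_incr_lipschitz[OF fg(1) \<open>0 \<le> L\<close> fg(3)] by blast
  obtain g' where g': "g' \<in> incr_lipschitz K j (\<kappa> i j * L)" "\<And>x. \<bar>g' x\<bar> \<le> B" "is_projection (insert j K) g g'"
    using projection_incr_lipschitz[OF fg(2) \<open>0 \<le> L\<close> fg(4)] by blast
  have "is_projection (insert j K) u (\<lambda>x. f' x - g' x)"
    unfolding u by (rule is_projection_diff[OF f'(3) g'(3) incr_lipschitzD(1) incr_lipschitzD(1)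
        incr_lipschitzD(1) incr_lipschitzD(1), OF fg(1,2) f'(1) g'(1) fg(3,4) f'(2) g'(2)])
  moreover have "(\<lambda>x. f' x - g' x) \<in> lipschitz_diff K j (\<kappa> i j * L) B"
    unfolding lipschitz_diff_def using f' g' by blast
  ultimately show ?thesis by blast
qed

lemma projection_K_incr_lipschitz:
  assumes f: "f \<in> incr_lipschitz K i L" and "0 \<le> L" and B: "\<And>x. \<bar>f x\<bar> \<le> B"
  obtains g where "g \<in> spin_functions K" "\<And>x. \<bar>g x\<bar> \<le> B" "is_projection K f g"
proof (rule conditional_version[OF f \<open>0 \<le> L\<close> order_refl B])
  fix g
  assume g: "g \<in> spin_functions K" "\<And>x. \<bar>g x\<bar> \<le> B"
    and gp: "\<And>\<psi> C. \<psi> \<in> spin_functions K \<Longrightarrow> (\<And>x. \<bar>\<psi> x\<bar> \<le> C) \<Longrightarrow>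
      (\<integral>x. g x * \<psi> x \<partial>\<mu>) = (\<integral>x. f x * \<psi> x \<partial>\<mu>)"
  show thesis by (rule that[OF g is_projectionI[OF gp]])
qed

text \<open>The variance bound involves \<open>L\<close> but not the sup bound \<open>B\<close>:
  along the iteration \<open>B\<close> stays fixed while \<open>L\<close> decays. The constant 16 is
  \<open>2 * 4 + 2 * 4\<close>, from the two monotone parts.\<close>

lemma projection_K_lipschitz_diff:
  assumes "u \<in> lipschitz_diff K i L B" and "0 \<le> L" and "i \<notin> K"
  obtains c where "c \<in> spin_functions K" "\<And>x. \<bar>c x\<bar> \<le> 2 * B" "is_projection K u c"
    "(\<integral>x. (u x - c x)\<^sup>2 \<partial>\<mu>) \<le> 16 * L\<^sup>2 * exp (1 / (\<beta> * v))"
proof -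
  obtain f g where u: "u = (\<lambda>x. f x - g x)" and fg: "f \<in> incr_lipschitz K i L" "g \<in> incr_lipschitz K i L"
    "\<And>x. \<bar>f x\<bar> \<le> B" "\<And>x. \<bar>g x\<bar> \<le> B"
    using assms unfolding lipschitz_diff_def by blast
  obtain f' where f': "f' \<in> spin_functions K" "\<And>x. \<bar>f' x\<bar> \<le> B" "is_projection K f f'"
    using projection_K_incr_lipschitz[OF fg(1) \<open>0 \<le> L\<close> fg(3)] by blast
  obtain g' where g': "g' \<in> spin_functions K" "\<And>x. \<bar>g' x\<bar> \<le> B" "is_projection K g g'"
    using projection_K_incr_lipschitz[OF fg(2) \<open>0 \<le> L\<close> fg(4)] by blast
  note [measurable] = incr_lipschitzD(1)[OF fg(1)] incr_lipschitzD(1)[OF fg(2)]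
    spin_functionsD(1)[OF f'(1)] spin_functionsD(1)[OF g'(1)]
  show thesis
  proof (rule that[of "\<lambda>x. f' x - g' x"])
    show "(\<lambda>x. f' x - g' x) \<in> spin_functions K" by (rule spin_functions_diff[OF f'(1) g'(1)])
    show "\<bar>f' x - g' x\<bar> \<le> 2 * B" for x using f'(2)[of x] g'(2)[of x] by (simp add: abs_le_iff)
    show "is_projection K u (\<lambda>x. f' x - g' x)"
      unfolding u by (rule is_projection_diff[OF f'(3) g'(3) _ _ _ _ fg(3,4) f'(2) g'(2)]) measurable
    have b: "\<bar>f x - f' x\<bar> \<le> 2 * B" "\<bar>g x - g' x\<bar> \<le> 2 * B" for x
      using fg(3,4)[of x] f'(2)[of x] g'(2)[of x] by (auto simp: abs_le_iff)
    have b': "\<bar>u x - (f' x - g' x)\<bar> \<le> 4 * B" for x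
      unfolding u using b[of x] by (auto simp: abs_le_iff)
    have [measurable]: "u \<in> borel_measurable config_space" unfolding u by measurable
    have i: "integrable \<mu> (\<lambda>x. (f x - f' x) * (f x - f' x))" "integrable \<mu> (\<lambda>x. (g x - g' x) * (g x - g' x))"
      "integrable \<mu> (\<lambda>x. (u x - (f' x - g' x)) * (u x - (f' x - g' x)))"
      by (rule integrable_mult_bounded[OF _ _ b(1) b(1)] integrable_mult_bounded[OF _ _ b(2) b(2)]
          integrable_mult_bounded[OF _ _ b' b']; measurable)+
    have "(\<integral>x. (u x - (f' x - g' x))\<^sup>2 \<partial>\<mu>) \<le> (\<integral>x. 2 * (f x - f' x)\<^sup>2 + 2 * (g x - g' x)\<^sup>2 \<partial>\<mu>)"
    proof (rule integral_mono)
      show "(u x - (f' x - g' x))\<^sup>2 \<le> 2 * (f x - f' x)\<^sup>2 + 2 * (g x - g' x)\<^sup>2" for x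
        using sum_squares_bound[of "f x - f' x" "- (g x - g' x)"]
        by (simp add: u power2_eq_square algebra_simps)
    qed (use i in \<open>auto simp: power2_eq_square\<close>)
    also have "\<dots> = 2 * (\<integral>x. (f x - f' x)\<^sup>2 \<partial>\<mu>) + 2 * (\<integral>x. (g x - g' x)\<^sup>2 \<partial>\<mu>)"
      using i by (simp add: power2_eq_square)
    also have "\<dots> \<le> 2 * (4 * L\<^sup>2 * exp (1 / (\<beta> * v))) + 2 * (4 * L\<^sup>2 * exp (1 / (\<beta> * v)))"
      by (intro add_mono mult_left_mono conditional_variance_le[OF fg(1) \<open>0 \<le> L\<close> \<open>i \<notin> K\<close> fg(3) f'(1,2)]
          conditional_variance_le[OF fg(2) \<open>0 \<le> L\<close> \<open>i \<notin> K\<close> fg(4) g'(1,2)]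
          is_projectionD[OF f'(3)] is_projectionD[OF g'(3)]) auto
    finally show "(\<integral>x. (u x - (f' x - g' x))\<^sup>2 \<partial>\<mu>) \<le> 16 * L\<^sup>2 * exp (1 / (\<beta> * v))" by simp
  qed
qed

lemma spin_functions_L2:
  assumes "f \<in> spin_functions J" "\<And>x. \<bar>f x\<bar> \<le> B"
  shows "f \<in> L2"
  using spin_functionsD(1)[OF assms(1)] assms(2) by (intro L2_bounded[of _ B]) auto

text \<open>The last inequality contains neither \<open>L\<close> nor \<open>B\<close>: they enter
  only the prefactor of the decay of the iterates. This uniformity is what allows the extension to
  all of L2.\<close>

lemma projection_contraction:
  assumes u: "u \<in> lipschitz_diff K i L B" and L: "0 \<le> L" and ij: "i \<notin> K" "j \<notin> K"
  obtains c u' where "c \<in> spin_functions K" "\<And>x. \<bar>c x\<bar> \<le> 2 * B" "is_projection K u c"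
    "u' \<in> lipschitz_diff K j (\<kappa> i j * L) B" "is_projection (insert j K) u u'"
    "norm2 (\<lambda>x. u' x - c x) \<le> \<kappa> i j * norm2 (\<lambda>x. u x - c x)"
proof -
  define s where "s n = (if even n then i else j)" for n :: nat
  define Ln where "Ln n = \<kappa> i j ^ n * L" for n
  have s: "\<kappa> (s n) (s (Suc n)) = \<kappa> i j" "s (Suc (Suc n)) = s n" "s n \<notin> K" for n
    using ij by (auto simp: s_def \<kappa>_commute)
  have Ln: "0 \<le> Ln n" for n using L \<kappa>_pos[of i j] by (simp add: Ln_def)
  \<comment> \<open>Projections are only known to exist, so the sequence is obtained by dependent
    choice; the clause for \<open>n = 0\<close> pins its start to \<open>u\<close>.\<close>
  have "\<exists>U. \<forall>n. (U n \<in> lipschitz_diff K (s n) (Ln n) B \<and> (n = 0 \<longrightarrow> U n = u)) \<and>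
      is_projection (insert (s (Suc n)) K) (U n) (U (Suc n))"
  proof (rule dependent_nat_choice)
    show "\<exists>x. x \<in> lipschitz_diff K (s 0) (Ln 0) B \<and> (0 = 0 \<longrightarrow> x = u)"
      using u by (intro exI[of _ u]) (simp add: s_def Ln_def)
    fix x n assume x: "x \<in> lipschitz_diff K (s n) (Ln n) B \<and> (n = 0 \<longrightarrow> x = u)"
    have "\<kappa> (s n) (s (Suc n)) * Ln n = Ln (Suc n)" unfolding s(1) by (simp add: Ln_def)
    then show "\<exists>y. (y \<in> lipschitz_diff K (s (Suc n)) (Ln (Suc n)) B \<and> (Suc n = 0 \<longrightarrow> y = u)) \<and>
        is_projection (insert (s (Suc n)) K) x y"
      using projection_lipschitz_diff[of x K "s n" "Ln n" B "s (Suc n)"] x Ln by auto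
  qed
  then obtain U where U: "\<And>n. U n \<in> lipschitz_diff K (s n) (Ln n) B" and U0: "U 0 = u"
    and Up: "\<And>n. is_projection (insert (s (Suc n)) K) (U n) (U (Suc n))"
    by auto
  obtain c where c: "c \<in> spin_functions K" "\<And>x. \<bar>c x\<bar> \<le> 2 * B" "is_projection K u c"
    using projection_K_lipschitz_diff[OF u L ij(1)] by blast
  \<comment> \<open>Tower property: every iterate has the same conditional mean given the spins in
    \<open>K\<close>.\<close>
  have Uc: "is_projection K (U n) c" for n
  proof (induction n)
    case (Suc n)
    show ?case
    proof (rule is_projectionI)
      fix \<psi> C assume \<psi>: "\<psi> \<in> spin_functions K" "\<And>x. \<bar>\<psi> x\<bar> \<le> (C::real)"
      have "\<psi> \<in> spin_functions (insert (s (Suc n)) K)"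
        using \<psi>(1) spin_functions_mono[OF subset_insertI] by blast
      then show "(\<integral>x. c x * \<psi> x \<partial>\<mu>) = (\<integral>x. U (Suc n) x * \<psi> x \<partial>\<mu>)"
        using is_projectionD[OF Suc \<psi>] is_projectionD[OF Up _ \<psi>(2)] by simp
    qed
  qed (simp add: U0 c(3))
  have Um: "U n \<in> spin_functions (insert (s n) K)" "\<bar>U n x\<bar> \<le> 2 * B" for n x
    using lipschitz_diff_spin_functions[OF U] by auto
  define V where "V n x = U n x - c x" for n x
  define a where "a n = (\<integral>x. (V n x)\<^sup>2 \<partial>\<mu>)" for n
  have V: "V n \<in> spin_functions (insert (s n) K)" for n
  proof -
    have "c \<in> spin_functions (insert (s n) K)"
      using c(1) spin_functions_mono[OF subset_insertI] by blast
    then show ?thesis unfolding V_def[abs_def] by (rule spin_functions_diff[OF Um(1)])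
  qed
  have VB: "\<bar>V n x\<bar> \<le> 4 * B" for n x
    using Um(2)[of n x] c(2)[of x] by (simp add: V_def abs_le_iff)
  have VL2: "V n \<in> L2" for n by (rule spin_functions_L2[OF V VB])
  have cL2: "c \<in> L2" by (rule spin_functions_L2[OF c(1,2)])
  have UL2: "U n \<in> L2" for n by (rule spin_functions_L2[OF Um])
  have shift: "(\<integral>x. V n x * \<psi> x \<partial>\<mu>) = (\<integral>x. V (Suc n) x * \<psi> x \<partial>\<mu>)"
    if \<psi>: "\<psi> \<in> spin_functions (insert (s (Suc n)) K)" "\<And>x. \<bar>\<psi> x\<bar> \<le> C" for n \<psi> C
  proof -
    have "\<psi> \<in> L2" by (rule spin_functions_L2[OF \<psi>])
    then have "integrable \<mu> (\<lambda>x. U n x * \<psi> x)" "integrable \<mu> (\<lambda>x. U (Suc n) x * \<psi> x)" "integrable \<mu> (\<lambda>x. c x * \<psi> x)"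
      by (intro L2_mult_integrable UL2 cL2; assumption)+
    then show ?thesis
      using is_projectionD[OF Up \<psi>] by (simp add: V_def left_diff_distrib)
  qed
  have "a 1 \<le> (\<kappa> i j)\<^sup>2 * a 0"
  proof (rule log_convex_ratio_le[of a "16 * L\<^sup>2 * exp (1 / (\<beta> * v))"])
    show "0 \<le> a n" for n by (simp add: a_def)
    show "0 < (\<kappa> i j)\<^sup>2" using \<kappa>_pos[of i j] by simp
    show "(a (Suc n))\<^sup>2 \<le> a n * a (Suc (Suc n))" for n
    proof -
      \<comment> \<open>Self-adjointness of the projections. \<open>V (Suc n)\<close> is an
        admissible test for the step from \<open>n\<close>, and \<open>V n\<close> for the step from
        \<open>Suc n\<close>, because the sites alternate. The squared norm thus becomes the inner
        product of \<open>V n\<close> with \<open>V (Suc (Suc n))\<close>.\<close>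
      have "a (Suc n) = (\<integral>x. V (Suc n) x * V (Suc n) x \<partial>\<mu>)" by (simp add: a_def power2_eq_square)
      also have "\<dots> = (\<integral>x. V n x * V (Suc n) x \<partial>\<mu>)" by (rule shift[OF V VB, symmetric])
      also have "\<dots> = (\<integral>x. V (Suc n) x * V n x \<partial>\<mu>)" by (simp add: mult.commute)
      also have "\<dots> = (\<integral>x. V (Suc (Suc n)) x * V n x \<partial>\<mu>)"
        using V[of n] by (intro shift[OF _ VB]) (simp add: s(2))
      finally have "\<bar>a (Suc n)\<bar> \<le> norm2 (V (Suc (Suc n))) * norm2 (V n)"
        using Cauchy_Schwarz_L2[OF VL2 VL2] by simp
      then have "\<bar>a (Suc n)\<bar>\<^sup>2 \<le> (norm2 (V (Suc (Suc n))) * norm2 (V n))\<^sup>2"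
        by (rule power_mono) simp
      also have "\<dots> = a n * a (Suc (Suc n))"
        by (simp add: power_mult_distrib norm2_power2 a_def)
      finally show ?thesis by simp
    qed
    show "a n \<le> 16 * L\<^sup>2 * exp (1 / (\<beta> * v)) * ((\<kappa> i j)\<^sup>2) ^ n" for n
    proof -
      obtain h where h: "h \<in> spin_functions K" "\<And>x. \<bar>h x\<bar> \<le> 2 * B"
        "(\<integral>x. (U n x - h x)\<^sup>2 \<partial>\<mu>) \<le> 16 * (Ln n)\<^sup>2 * exp (1 / (\<beta> * v))"
        using projection_K_lipschitz_diff[OF U Ln s(3)] by blast
      \<comment> \<open>The variance bound comes with some centring \<open>h\<close>, not
        necessarily \<open>c\<close>; optimality of \<open>c\<close> transfers the bound.\<close>
      have "a n \<le> (\<integral>x. (U n x - h x)\<^sup>2 \<partial>\<mu>)"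
        unfolding a_def V_def
        by (rule projection_optimal[OF spin_functionsD(1)[OF Um(1)] Um(2) c(1,2) h(1,2) is_projectionD[OF Uc]])
      also note h(3)
      finally show ?thesis
        by (simp add: Ln_def power_mult_distrib power_mult[symmetric] mult_ac)
    qed
  qed
  then have "(norm2 (V 1))\<^sup>2 \<le> (\<kappa> i j * norm2 (V 0))\<^sup>2"
    by (simp add: norm2_power2 power_mult_distrib a_def)
  then have "norm2 (V 1) \<le> \<kappa> i j * norm2 (V 0)"
    by (rule power2_le_imp_le) (intro mult_nonneg_nonneg less_imp_le[OF \<kappa>_pos] norm2_nonneg)
  then have le: "norm2 (\<lambda>x. U 1 x - c x) \<le> \<kappa> i j * norm2 (\<lambda>x. u x - c x)"
    by (simp add: V_def[abs_def] U0)
  have s1: "s 1 = j" "Ln 1 = \<kappa> i j * L" by (simp_all add: s_def Ln_def)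
  show thesis
  proof (rule that[OF c _ _ le])
    show "U 1 \<in> lipschitz_diff K j (\<kappa> i j * L) B" using U[of 1] unfolding s1 .
    show "is_projection (insert j K) u (U 1)" using Up[of 0] by (simp add: U0 s1[simplified])
  qed
qed

end

section \<open>Density\<close>

lemma incr_lipschitz_add:
  assumes "f \<in> incr_lipschitz K i L" "g \<in> incr_lipschitz K i L'"
  shows "(\<lambda>x. f x + g x) \<in> incr_lipschitz K i (L + L')"
  unfolding incr_lipschitz_def
proof (intro CollectI conjI allI impI)
  show "(\<lambda>x. f x + g x) \<in> borel_measurable config_space"
    using incr_lipschitzD(1)[OF assms(1)] incr_lipschitzD(1)[OF assms(2)] by measurable
  fix x y :: "int ^ 'a \<Rightarrow> real" and d assume "\<forall>k\<in>K. x k = y k" "0 \<le> d" "x i \<le> y i + d"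
  then show "f x + g x \<le> f y + g y + (L + L') * d"
    using incr_lipschitzD(2)[OF assms(1), of x y d] incr_lipschitzD(2)[OF assms(2), of x y d]
    by (simp add: distrib_right)
qed

lemma incr_lipschitz_cmult:
  assumes "f \<in> incr_lipschitz K i L" "0 \<le> c"
  shows "(\<lambda>x. c * f x) \<in> incr_lipschitz K i (c * L)"
  unfolding incr_lipschitz_def
proof (intro CollectI conjI allI impI)
  show "(\<lambda>x. c * f x) \<in> borel_measurable config_space"
    using incr_lipschitzD(1)[OF assms(1)] by measurable
  fix x y :: "int ^ 'a \<Rightarrow> real" and d assume "\<forall>k\<in>K. x k = y k" "0 \<le> d" "x i \<le> y i + d"
  then have "f x \<le> f y + L * d" by (intro incr_lipschitzD(2)[OF assms(1)]) auto
  from mult_left_mono[OF this \<open>0 \<le> c\<close>] show "c * f x \<le> c * f y + c * L * d"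
    by (simp add: algebra_simps)
qed

lemma incr_lipschitz_const: "(\<lambda>_. c) \<in> incr_lipschitz K i 0"
  by (simp add: incr_lipschitz_def)

context gibbs_state
begin

lemma lipschitz_diffI:
  assumes "f \<in> incr_lipschitz K i L" "g \<in> incr_lipschitz K i L" "\<And>x. \<bar>f x\<bar> \<le> B" "\<And>x. \<bar>g x\<bar> \<le> B"
  shows "(\<lambda>x. f x - g x) \<in> lipschitz_diff K i L B"
  unfolding lipschitz_diff_def using assms by auto

lemma lipschitz_diff_add:
  assumes "u \<in> lipschitz_diff K i L B" "u' \<in> lipschitz_diff K i L' B'"
  shows "(\<lambda>x. u x + u' x) \<in> lipschitz_diff K i (L + L') (B + B')"
proof -
  obtain f g where u: "u = (\<lambda>x. f x - g x)" and fg: "f \<in> incr_lipschitz K i L" "g \<in> incr_lipschitz K i L"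
    "\<And>x. \<bar>f x\<bar> \<le> B" "\<And>x. \<bar>g x\<bar> \<le> B"
    using assms(1) unfolding lipschitz_diff_def by blast
  obtain f' g' where u': "u' = (\<lambda>x. f' x - g' x)" and fg': "f' \<in> incr_lipschitz K i L'" "g' \<in> incr_lipschitz K i L'"
    "\<And>x. \<bar>f' x\<bar> \<le> B'" "\<And>x. \<bar>g' x\<bar> \<le> B'"
    using assms(2) unfolding lipschitz_diff_def by blast
  have b: "\<bar>f x + f' x\<bar> \<le> B + B'" "\<bar>g x + g' x\<bar> \<le> B + B'" for x
    using fg(3,4)[of x] fg'(3,4)[of x] by linarith+
  have eq: "(\<lambda>x. u x + u' x) = (\<lambda>x. (f x + f' x) - (g x + g' x))" by (simp add: u u' fun_eq_iff)
  show ?thesis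
    unfolding eq by (intro lipschitz_diffI incr_lipschitz_add fg fg' b)
qed

lemma lipschitz_diff_cmult:
  assumes "u \<in> lipschitz_diff K i L B"
  shows "(\<lambda>x. c * u x) \<in> lipschitz_diff K i (\<bar>c\<bar> * L) (\<bar>c\<bar> * B)"
proof -
  obtain f g where u: "u = (\<lambda>x. f x - g x)" and fg: "f \<in> incr_lipschitz K i L" "g \<in> incr_lipschitz K i L"
    "\<And>x. \<bar>f x\<bar> \<le> B" "\<And>x. \<bar>g x\<bar> \<le> B"
    using assms(1) unfolding lipschitz_diff_def by blast
  have b: "\<bar>\<bar>c\<bar> * f x\<bar> \<le> \<bar>c\<bar> * B" "\<bar>\<bar>c\<bar> * g x\<bar> \<le> \<bar>c\<bar> * B" for x
    using fg(3,4)[of x] by (auto simp: abs_mult intro: mult_left_mono)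
  have m: "(\<lambda>x. \<bar>c\<bar> * f x) \<in> incr_lipschitz K i (\<bar>c\<bar> * L)" "(\<lambda>x. \<bar>c\<bar> * g x) \<in> incr_lipschitz K i (\<bar>c\<bar> * L)"
    by (rule incr_lipschitz_cmult[OF fg(1)] incr_lipschitz_cmult[OF fg(2)]; simp)+
  show ?thesis
  proof (cases "0 \<le> c")
    case True
    then have eq: "(\<lambda>x. c * u x) = (\<lambda>x. \<bar>c\<bar> * f x - \<bar>c\<bar> * g x)" by (simp add: u fun_eq_iff algebra_simps)
    show ?thesis unfolding eq by (intro lipschitz_diffI m b)
  next
    case False
    then have eq: "(\<lambda>x. c * u x) = (\<lambda>x. \<bar>c\<bar> * g x - \<bar>c\<bar> * f x)" by (simp add: u fun_eq_iff algebra_simps)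
    show ?thesis unfolding eq by (intro lipschitz_diffI m b)
  qed
qed

lemma lipschitz_diff_L2: "u \<in> lipschitz_diff K i L B \<Longrightarrow> u \<in> L2"
  by (rule spin_functions_L2[OF lipschitz_diff_spin_functions])

text \<open>The L2 closure of the Lipschitz differences. \<open>L\<close> and \<open>B\<close> may
  blow up as the error shrinks, which is harmless because the contraction factor depends on
  neither.\<close>

definition approximable :: "(int ^ 'n) set \<Rightarrow> int ^ 'n \<Rightarrow> ((int ^ 'n \<Rightarrow> real) \<Rightarrow> real) set" where
  "approximable K i = {f \<in> L2. \<forall>\<epsilon>>0. \<exists>L B u. 0 \<le> L \<and> u \<in> lipschitz_diff K i L B \<and> norm2 (\<lambda>x. f x - u x) < \<epsilon>}"

lemma approximable_L2: "f \<in> approximable K i \<Longrightarrow> f \<in> L2"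
  by (simp add: approximable_def)

lemma approximableD:
  assumes "f \<in> approximable K i" "0 < \<epsilon>"
  obtains L B u where "0 \<le> L" "u \<in> lipschitz_diff K i L B" "norm2 (\<lambda>x. f x - u x) < \<epsilon>"
  using assms unfolding approximable_def by blast

lemma approximable_lipschitz_diff:
  assumes "u \<in> lipschitz_diff K i L B" "0 \<le> L"
  shows "u \<in> approximable K i"
  unfolding approximable_def
proof (intro CollectI conjI allI impI lipschitz_diff_L2[OF assms(1)])
  fix \<epsilon> :: real assume "0 < \<epsilon>"
  then have "norm2 (\<lambda>x. u x - u x) < \<epsilon>" by (simp add: norm2_def)
  then show "\<exists>L B u'. 0 \<le> L \<and> u' \<in> lipschitz_diff K i L B \<and> norm2 (\<lambda>x. u x - u' x) < \<epsilon>"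
    using assms by blast
qed

lemma approximable_const: "(\<lambda>_. c) \<in> approximable K i"
proof -
  have "(\<lambda>_. c) \<in> lipschitz_diff K i 0 \<bar>c\<bar>"
    unfolding lipschitz_diff_def
    by (intro CollectI exI[of _ "\<lambda>_. c"] exI[of _ "\<lambda>_. 0"]) (simp add: incr_lipschitz_const)
  then show ?thesis by (rule approximable_lipschitz_diff) simp
qed

lemma approximable_add:
  assumes f: "f \<in> approximable K i" and g: "g \<in> approximable K i"
  shows "(\<lambda>x. f x + g x) \<in> approximable K i"
  unfolding approximable_def
proof (intro CollectI conjI allI impI)
  show "(\<lambda>x. f x + g x) \<in> L2" using assms by (intro L2_add approximable_L2)
  fix \<epsilon> :: real assume "0 < \<epsilon>"
  then have e: "0 < \<epsilon> / 2" by simp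
  obtain L B u where u: "0 \<le> L" "u \<in> lipschitz_diff K i L B" "norm2 (\<lambda>x. f x - u x) < \<epsilon> / 2"
    using approximableD[OF f e] .
  obtain L' B' u' where u': "0 \<le> L'" "u' \<in> lipschitz_diff K i L' B'" "norm2 (\<lambda>x. g x - u' x) < \<epsilon> / 2"
    using approximableD[OF g e] .
  have "norm2 (\<lambda>x. (f x - u x) + (g x - u' x)) \<le> norm2 (\<lambda>x. f x - u x) + norm2 (\<lambda>x. g x - u' x)"
    using approximable_L2[OF f] approximable_L2[OF g] lipschitz_diff_L2[OF u(2)] lipschitz_diff_L2[OF u'(2)]
    by (intro norm2_triangle L2_diff)
  then have "norm2 (\<lambda>x. (f x + g x) - (u x + u' x)) < \<epsilon>"
    using u(3) u'(3) by (simp add: algebra_simps)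
  then show "\<exists>L B w. 0 \<le> L \<and> w \<in> lipschitz_diff K i L B \<and> norm2 (\<lambda>x. f x + g x - w x) < \<epsilon>"
    using lipschitz_diff_add[OF u(2) u'(2)] u(1) u'(1)
    by (intro exI[of _ "L + L'"] exI[of _ "B + B'"] exI[of _ "\<lambda>x. u x + u' x"]) auto
qed

lemma approximable_cmult:
  assumes f: "f \<in> approximable K i"
  shows "(\<lambda>x. c * f x) \<in> approximable K i"
  unfolding approximable_def
proof (intro CollectI conjI allI impI)
  show "(\<lambda>x. c * f x) \<in> L2" using assms by (intro L2_cmult approximable_L2)
  fix \<epsilon> :: real assume "0 < \<epsilon>"
  then have e: "0 < \<epsilon> / (\<bar>c\<bar> + 1)" by simp
  obtain L B u where u: "0 \<le> L" "u \<in> lipschitz_diff K i L B" "norm2 (\<lambda>x. f x - u x) < \<epsilon> / (\<bar>c\<bar> + 1)"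
    using approximableD[OF f e] .
  have "norm2 (\<lambda>x. c * f x - c * u x) = \<bar>c\<bar> * norm2 (\<lambda>x. f x - u x)"
    by (simp add: norm2_cmult flip: right_diff_distrib)
  also have "\<dots> \<le> (\<bar>c\<bar> + 1) * norm2 (\<lambda>x. f x - u x)" by (intro mult_right_mono) auto
  also have "\<dots> < \<epsilon>" using u(3) by (simp add: pos_less_divide_eq mult.commute)
  finally show "\<exists>L B w. 0 \<le> L \<and> w \<in> lipschitz_diff K i L B \<and> norm2 (\<lambda>x. c * f x - w x) < \<epsilon>"
    using lipschitz_diff_cmult[OF u(2), of c] u(1)
    by (intro exI[of _ "\<bar>c\<bar> * L"] exI[of _ "\<bar>c\<bar> * B"] exI[of _ "\<lambda>x. c * u x"]) auto
qed

lemma approximable_sum: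
  assumes "finite I" "\<And>k. k \<in> I \<Longrightarrow> f k \<in> approximable K i"
  shows "(\<lambda>x. \<Sum>k\<in>I. f k x) \<in> approximable K i"
  using assms by (induction I rule: finite_induct) (auto simp: approximable_const approximable_add)

lemma approximable_limit:
  assumes f: "f \<in> L2" and g: "\<And>n. g n \<in> approximable K i"
    and lim: "(\<lambda>n. \<integral>x. (f x - g n x)\<^sup>2 \<partial>\<mu>) \<longlonglongrightarrow> 0"
  shows "f \<in> approximable K i"
  unfolding approximable_def
proof (intro CollectI conjI allI impI f)
  fix \<epsilon> :: real assume "0 < \<epsilon>"
  then have e: "0 < \<epsilon> / 2" by simp
  have "(\<lambda>n. norm2 (\<lambda>x. f x - g n x)) \<longlonglongrightarrow> sqrt 0"
    unfolding norm2_def by (intro tendsto_intros lim)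
  then have "eventually (\<lambda>n. norm2 (\<lambda>x. f x - g n x) < \<epsilon> / 2) sequentially"
    using e by (intro order_tendstoD) auto
  then obtain n where n: "norm2 (\<lambda>x. f x - g n x) < \<epsilon> / 2" by (auto simp: eventually_sequentially)
  obtain L B u where u: "0 \<le> L" "u \<in> lipschitz_diff K i L B" "norm2 (\<lambda>x. g n x - u x) < \<epsilon> / 2"
    using approximableD[OF g e] .
  have "norm2 (\<lambda>x. f x - u x) \<le> norm2 (\<lambda>x. f x - g n x) + norm2 (\<lambda>x. g n x - u x)"
    by (rule norm2_triangle_diff[OF f approximable_L2[OF g] lipschitz_diff_L2[OF u(2)]])
  then have "norm2 (\<lambda>x. f x - u x) < \<epsilon>" using n u(3) by simp
  then show "\<exists>L B w. 0 \<le> L \<and> w \<in> lipschitz_diff K i L B \<and> norm2 (\<lambda>x. f x - w x) < \<epsilon>"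
    using u by blast
qed

lemma approximable_cylinder:
  assumes A: "A \<in> sets (spins_sigma K)"
  shows "indicator (A \<inter> {\<omega>. a < \<omega> i}) \<in> approximable K i"
proof (rule approximable_limit)
  have A': "A \<in> sets config_space" using A sets_spins_sigma_subset by blast
  note [measurable] = A' measurable_config_component
  have cyl: "A \<inter> {\<omega>. a < \<omega> i} \<in> sets config_space"
  proof -
    have "{\<omega> \<in> space config_space. a < \<omega> i} \<in> sets config_space"
      by measurable
    then show ?thesis using A' by auto
  qed
  show L2: "indicator (A \<inter> {\<omega>. a < \<omega> i}) \<in> L2"
    using cyl by (intro L2_bounded[of _ 1]) (auto simp: indicator_def)
  \<comment> \<open>Ramps that start at \<open>a\<close> with slope \<open>n\<close>. They vanish at
    \<open>a\<close> itself, so their limit is the indicator of the open half-line.\<close>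
  define g where "g n \<omega> = indicator A \<omega> * max 0 (min 1 (real n * (\<omega> i - a)))" for n \<omega>
  have gm [measurable]: "g n \<in> borel_measurable config_space" for n
    unfolding g_def[abs_def] by measurable
  have gb: "\<bar>g n x\<bar> \<le> 1" for n x by (auto simp: g_def indicator_def)
  have IA: "indicator A \<in> spin_functions K"
    using A by (simp add: spin_functions_iff_measurable)
  have "g n \<in> incr_lipschitz K i (real n)" for n
    unfolding incr_lipschitz_def
  proof (intro CollectI conjI allI impI gm)
    fix x y :: "int ^ 'n \<Rightarrow> real" and d assume xy: "\<forall>k\<in>K. x k = y k" and d: "0 \<le> d" "x i \<le> y i + d"
    have I: "indicator A x = (indicator A y :: real)"
      using xy by (intro spin_functionsD(2)[OF IA]) auto
    have "real n * (x i - a) \<le> real n * (y i - a) + real n * d"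
      using mult_left_mono[OF d(2), of "real n"] by (simp add: algebra_simps)
    moreover have "0 \<le> real n * d" using d by simp
    ultimately have "max 0 (min 1 (real n * (x i - a))) \<le> max 0 (min 1 (real n * (y i - a))) + real n * d"
      by (auto simp: max_def min_def)
    then show "g n x \<le> g n y + real n * d"
      unfolding g_def I using \<open>0 \<le> real n * d\<close> by (auto simp: indicator_def)
  qed
  then have "g n \<in> lipschitz_diff K i (real n) 1" for n
    using lipschitz_diffI[of "g n" K i "real n" "\<lambda>_. 0" 1] gb incr_lipschitz_cmult[OF incr_lipschitz_const[of 0 K i], of "real n"]
    by (simp add: incr_lipschitz_def)
  then show "g n \<in> approximable K i" for n
    by (rule approximable_lipschitz_diff) simp
  have "(\<lambda>n. \<integral>x. (indicator (A \<inter> {\<omega>. a < \<omega> i}) x - g n x)\<^sup>2 \<partial>\<mu>) \<longlonglongrightarrow> (\<integral>x. 0 \<partial>\<mu>)"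
  proof (rule integral_dominated_convergence[where w = "\<lambda>_. 4"])
    show "AE x in \<mu>. (\<lambda>n. (indicator (A \<inter> {\<omega>. a < \<omega> i}) x - g n x)\<^sup>2) \<longlonglongrightarrow> 0"
    proof (rule AE_I2)
      fix x
      show "(\<lambda>n. (indicator (A \<inter> {\<omega>. a < \<omega> i}) x - g n x)\<^sup>2) \<longlonglongrightarrow> 0"
      proof (cases "a < x i")
        case True
        obtain m where m: "1 < real m * (x i - a)"
          using reals_Archimedean3[of "x i - a"] True by auto
        have "(indicator (A \<inter> {\<omega>. a < \<omega> i}) x - g n x)\<^sup>2 = 0" if "m \<le> n" for n
        proof -
          have "real m * (x i - a) \<le> real n * (x i - a)" using that True by (intro mult_right_mono) auto
          then have "min 1 (real n * (x i - a)) = 1" using m by simp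
          then show ?thesis using True by (auto simp: g_def indicator_def)
        qed
        then show ?thesis
          by (intro tendsto_eventually) (auto simp: eventually_sequentially)
      next
        case False
        then have "real n * (x i - a) \<le> 0" for n by (simp add: mult_nonneg_nonpos)
        then have "min 1 (real n * (x i - a)) \<le> 0" for n using min.coboundedI2 by blast
        then have "g n x = 0" for n by (simp add: g_def max_absorb1)
        then show ?thesis using False by (simp add: indicator_def)
      qed
    qed
    show "AE x in \<mu>. norm ((indicator (A \<inter> {\<omega>. a < \<omega> i}) x - g n x)\<^sup>2) \<le> 4" for n
    proof (rule AE_I2)
      fix x
      have "\<bar>indicator (A \<inter> {\<omega>. a < \<omega> i}) x - g n x\<bar> \<le> 2"
        using gb[of n x] by (auto simp: indicator_def)
      from power_mono[OF this abs_ge_zero, of 2]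
      show "norm ((indicator (A \<inter> {\<omega>. a < \<omega> i}) x - g n x)\<^sup>2) \<le> 4" by simp
    qed
    show "(\<lambda>x. (indicator (A \<inter> {\<omega>. a < \<omega> i}) x - g n x)\<^sup>2) \<in> borel_measurable \<mu>" for n
      using cyl by measurable
  qed auto
  then show "(\<lambda>n. \<integral>x. (indicator (A \<inter> {\<omega>. a < \<omega> i}) x - g n x)\<^sup>2 \<partial>\<mu>) \<longlonglongrightarrow> 0" by simp
qed

end

lemma space_spin_sigma [simp]: "space (spin_sigma i) = UNIV"
  by (simp add: spin_sigma_def)

lemma sets_spin_sigma: "sets (spin_sigma i) = {(\<lambda>\<omega>. \<omega> i) -` A |A. A \<in> sets borel}"
  using sets_vimage_algebra2[of "\<lambda>\<omega>. \<omega> i" UNIV borel] by (simp add: spin_sigma_def)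

lemma space_join_sigma [simp]: "space (join_sigma (spin_sigma i) H) = UNIV"
  by (simp add: join_sigma_def)

lemma sets_join_sigma: "sets (join_sigma (spin_sigma i) H) = sigma_sets UNIV (sets (spin_sigma i) \<union> sets H)"
  by (simp add: join_sigma_def)

lemma join_sigma_subset:
  assumes F: "sigma_algebra UNIV F"
    and "\<And>A. A \<in> sets borel \<Longrightarrow> (\<lambda>\<omega>. \<omega> i) -` A \<in> F" "sets (spins_sigma K) \<subseteq> F"
  shows "sets (join_sigma (spin_sigma i) (spins_sigma K)) \<subseteq> F"
  unfolding sets_join_sigma using assms(2,3)
  by (intro sigma_algebra.sigma_sets_subset[OF F]) (auto simp: sets_spin_sigma)

lemma join_sigma_subset_config: "sets (join_sigma (spin_sigma i) (spins_sigma K)) \<subseteq> sets config_space"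
proof (rule join_sigma_subset)
  show "sigma_algebra UNIV (sets config_space)"
    using sets.sigma_algebra_axioms[of config_space] by simp
  show "(\<lambda>\<omega>. \<omega> i) -` A \<in> sets config_space" if "A \<in> sets borel" for A
    using measurable_sets[OF measurable_config_component that] by simp
qed (rule sets_spins_sigma_subset)

lemma measurable_join_sigma_config:
  "f \<in> borel_measurable (join_sigma (spin_sigma i) (spins_sigma K)) \<Longrightarrow> f \<in> borel_measurable config_space"
  using join_sigma_subset_config[of i K] unfolding measurable_def by auto

lemma join_sigma_absorb:
  assumes "i \<in> K"
  shows "sets (join_sigma (spin_sigma i) (spins_sigma K)) \<subseteq> sets (spins_sigma K)"
proof (rule join_sigma_subset)
  show "sigma_algebra UNIV (sets (spins_sigma K))"
    using sets.sigma_algebra_axioms[of "spins_sigma K"] by simp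
  have "(\<lambda>\<omega>. \<omega> i) \<in> spin_functions K"
    using assms by (simp add: spin_functions_def measurable_config_component)
  then show "(\<lambda>\<omega>. \<omega> i) -` A \<in> sets (spins_sigma K)" if "A \<in> sets borel" for A
    using measurable_sets[OF _ that, of "\<lambda>\<omega>. \<omega> i" "spins_sigma K"] by (simp add: spin_functions_iff_measurable)
qed simp

lemma join_sigma_subset_cylinders:
  "sets (join_sigma (spin_sigma i) (spins_sigma K)) \<subseteq>
    sigma_sets UNIV {A \<inter> {\<omega>. a < \<omega> i} |A a. A \<in> sets (spins_sigma K)}" (is "_ \<subseteq> sigma_sets UNIV ?G")
proof (rule join_sigma_subset)
  show sa: "sigma_algebra UNIV (sigma_sets UNIV ?G)"
    by (rule sigma_algebra_sigma_sets) auto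
  interpret sigma_algebra UNIV "sigma_sets UNIV ?G" by (rule sa)
  have "(\<lambda>\<omega>. \<omega> i) \<in> borel_measurable (sigma UNIV ?G)"
    unfolding borel_measurable_iff_greater
  proof
    fix a
    have "UNIV \<inter> {\<omega>. a < \<omega> i} \<in> ?G"
      using sets.top[of "spins_sigma K"] by auto
    then show "{\<omega> \<in> space (sigma UNIV ?G). a < \<omega> i} \<in> sets (sigma UNIV ?G)"
      by (auto intro: sigma_sets.Basic)
  qed
  then show "(\<lambda>\<omega>. \<omega> i) -` A \<in> sigma_sets UNIV ?G" if "A \<in> sets borel" for A
    using measurable_sets[OF _ that, of "\<lambda>\<omega>. \<omega> i" "sigma UNIV ?G"] by simp
  show "sets (spins_sigma K) \<subseteq> sigma_sets UNIV ?G"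
  proof
    fix A assume A: "A \<in> sets (spins_sigma K)"
    have "(\<Union>n::nat. A \<inter> {\<omega>. - real n < \<omega> i}) \<in> sigma_sets UNIV ?G"
      using A by (intro countable_UN) (auto intro!: sigma_sets.Basic)
    also have "(\<Union>n::nat. A \<inter> {\<omega>. - real n < \<omega> i}) = A"
      using reals_Archimedean2 by (auto simp: minus_less_iff)
    finally show "A \<in> sigma_sets UNIV ?G" .
  qed
qed

context gibbs_state
begin

text \<open>Dynkin's theorem: a closed linear space containing the constants yields closure under
  complements and disjoint unions, and the cylinders are stable under intersection.\<close>

lemma approximable_indicator:
  assumes "A \<in> sets (join_sigma (spin_sigma i) (spins_sigma K))"
  shows "indicator A \<in> approximable K i"
proof -
  let ?G = "{A \<inter> {\<omega>. a < \<omega> i} |A a. A \<in> sets (spins_sigma K)}"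
  have "Int_stable ?G"
  proof (rule Int_stableI)
    fix C D assume "C \<in> ?G" "D \<in> ?G"
    then obtain A a B b where *: "A \<in> sets (spins_sigma K)" "B \<in> sets (spins_sigma K)"
      "C = A \<inter> {\<omega>. a < \<omega> i}" "D = B \<inter> {\<omega>. b < \<omega> i}" by blast
    then have "C \<inter> D = (A \<inter> B) \<inter> {\<omega>. max a b < \<omega> i}" by auto
    then show "C \<inter> D \<in> ?G" using * by blast
  qed
  moreover have "?G \<subseteq> Pow UNIV" by simp
  moreover have "A \<in> sigma_sets UNIV ?G"
    using assms join_sigma_subset_cylinders by blast
  ultimately show ?thesis
  proof (induction rule: sigma_sets_induct_disjoint)
    case (basic A)
    then show ?case using approximable_cylinder by blast
  next
    case empty
    then show ?case using approximable_const[of 0] by simp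
  next
    case (compl A)
    have "(\<lambda>x. 1 + (- 1) * indicator A x) \<in> approximable K i"
      by (intro approximable_add approximable_const approximable_cmult compl)
    moreover have "(\<lambda>x. 1 + (- 1) * indicator A x) = (indicator (UNIV - A) :: _ \<Rightarrow> real)"
      by (auto simp: indicator_def)
    ultimately show ?case by simp
  next
    case (union A)
    have Am: "A n \<in> sets config_space" for n
    proof -
      have "?G \<subseteq> sets config_space"
      proof -
        have "{\<omega> \<in> space config_space. a < \<omega> i} \<in> sets config_space" for a
          using measurable_config_component[of i] by (simp add: borel_measurable_iff_greater)
        then show ?thesis using sets_spins_sigma_subset by auto
      qed
      then have "sigma_sets UNIV ?G \<subseteq> sets config_space"
        using sets.sigma_sets_subset[of ?G config_space] by simp
      then show ?thesis using union(2) by blast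
    qed
    note [measurable] = Am
    define g where "g n = (\<lambda>x. \<Sum>k<n. indicator (A k) x :: real)" for n
    have g_eq: "g n x = indicator (\<Union>k<n. A k) x" for n x
      proof -
      have "disjoint_family_on A {..<n}" using union(1) by (rule disjoint_family_on_mono[OF subset_UNIV])
      then show ?thesis unfolding g_def by (intro indicator_UN_disjoint[symmetric]) auto
    qed
    have [measurable]: "g n \<in> borel_measurable config_space" for n unfolding g_def by measurable
    show ?case
    proof (rule approximable_limit)
      show "indicator (\<Union>n. A n) \<in> L2"
        using Am by (intro L2_bounded[of _ 1]) (auto simp: indicator_def)
      show "g n \<in> approximable K i" for n
        unfolding g_def using union(3) by (intro approximable_sum) auto
      have "(\<lambda>n. \<integral>x. (indicator (\<Union>n. A n) x - g n x)\<^sup>2 \<partial>\<mu>) \<longlonglongrightarrow> (\<integral>x. 0 \<partial>\<mu>)"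
      proof (rule integral_dominated_convergence[where w = "\<lambda>_. 1"])
        show "AE x in \<mu>. (\<lambda>n. (indicator (\<Union>n. A n) x - g n x)\<^sup>2) \<longlonglongrightarrow> 0"
        proof (rule AE_I2)
          fix x
          show "(\<lambda>n. (indicator (\<Union>n. A n) x - g n x)\<^sup>2) \<longlonglongrightarrow> 0"
          proof (cases "x \<in> (\<Union>n. A n)")
            case True
            then obtain m where "x \<in> A m" by blast
            then have "(indicator (\<Union>n. A n) x - g n x)\<^sup>2 = 0" if "Suc m \<le> n" for n
              using that by (auto simp: g_eq indicator_def)
            then show ?thesis
              by (intro tendsto_eventually) (auto simp: eventually_sequentially)
          next
            case False
            then show ?thesis by (simp add: g_eq indicator_def)
          qed
        qed
        show "AE x in \<mu>. norm ((indicator (\<Union>n. A n) x - g n x)\<^sup>2) \<le> 1" for n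
          by (rule AE_I2) (auto simp: g_eq indicator_def)
      qed auto
      then show "(\<lambda>n. \<integral>x. (indicator (\<Union>n. A n) x - g n x)\<^sup>2 \<partial>\<mu>) \<longlonglongrightarrow> 0" by simp
    qed
  qed
qed

lemma L2_approximable:
  assumes f: "f \<in> borel_measurable (join_sigma (spin_sigma i) (spins_sigma K))" and "f \<in> L2"
  shows "f \<in> approximable K i"
proof -
  let ?F = "join_sigma (spin_sigma i) (spins_sigma K)"
  obtain s where s: "\<And>n. simple_function ?F (s n)" "\<And>x. (\<lambda>n. s n x) \<longlonglongrightarrow> f x"
    "\<And>n x. \<bar>s n x\<bar> \<le> 2 * \<bar>f x\<bar>"
    using borel_measurable_implies_sequence_metric[OF f, of 0] by (auto simp: dist_real_def)
  note [measurable] = measurable_join_sigma_config[OF f]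
    measurable_join_sigma_config[OF borel_measurable_simple_function[OF s(1)]]
  show ?thesis
  proof (rule approximable_limit[OF \<open>f \<in> L2\<close>])
    show "s n \<in> approximable K i" for n
    proof -
      have fin: "finite (range (s n))" using simple_functionD(1)[OF s(1)[of n]] by simp
      have eq: "s n = (\<lambda>x. \<Sum>y\<in>range (s n). y * indicator (s n -` {y}) x)"
      proof (rule ext)
        fix x
        have "(\<Sum>y\<in>range (s n). y * indicator (s n -` {y}) x) = (\<Sum>y\<in>{s n x}. y * indicator (s n -` {y}) x)"
          using fin by (intro sum.mono_neutral_right) (auto simp: indicator_def)
        then show "s n x = (\<Sum>y\<in>range (s n). y * indicator (s n -` {y}) x)" by simp
      qed
      show ?thesis
      proof (subst eq, rule approximable_sum[OF fin])
        show "(\<lambda>x. y * indicator (s n -` {y}) x) \<in> approximable K i" for y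
          using simple_functionD(2)[OF s(1)[of n], of "{y}"]
          by (intro approximable_cmult approximable_indicator) simp
      qed
    qed
    have "(\<lambda>n. \<integral>x. (f x - s n x)\<^sup>2 \<partial>\<mu>) \<longlonglongrightarrow> (\<integral>x. 0 \<partial>\<mu>)"
    \<comment> \<open>The simple functions satisfy \<open>|s n x| \<le> 2 * |f x|\<close>, so the
      error is at most three times \<open>|f x|\<close>.\<close>
    proof (rule integral_dominated_convergence[where w = "\<lambda>x. 9 * (f x)\<^sup>2"])
      show "integrable \<mu> (\<lambda>x. 9 * (f x)\<^sup>2)" using \<open>f \<in> L2\<close> by (simp add: L2_def)
      show "AE x in \<mu>. (\<lambda>n. (f x - s n x)\<^sup>2) \<longlonglongrightarrow> 0"
      proof (rule AE_I2)
        fix x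
        have "(\<lambda>n. (f x - s n x)\<^sup>2) \<longlonglongrightarrow> (f x - f x)\<^sup>2" by (intro tendsto_intros s)
        then show "(\<lambda>n. (f x - s n x)\<^sup>2) \<longlonglongrightarrow> 0" by simp
      qed
      show "AE x in \<mu>. norm ((f x - s n x)\<^sup>2) \<le> 9 * (f x)\<^sup>2" for n
      proof (rule AE_I2)
        fix x
        have "\<bar>f x - s n x\<bar> \<le> 3 * \<bar>f x\<bar>" using s(3)[of n x] by linarith
        from power_mono[OF this abs_ge_zero, of 2]
        show "norm ((f x - s n x)\<^sup>2) \<le> 9 * (f x)\<^sup>2" by (simp add: power_mult_distrib)
      qed
    qed auto
    then show "(\<lambda>n. \<integral>x. (f x - s n x)\<^sup>2 \<partial>\<mu>) \<longlonglongrightarrow> 0" by simp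
  qed
qed

text \<open>Replace \<open>f\<close> by \<open>u - c\<close>, with \<open>u\<close> a Lipschitz
  difference and \<open>c\<close> its mean given \<open>K\<close>, and \<open>g\<close> by a
  Lipschitz difference \<open>h\<close>. As \<open>h\<close> depends on the spins at
  \<open>j\<close> and in \<open>K\<close> only, \<open>u\<close> may be projected onto these, where
  the contraction applies.\<close>

lemma correlation_le:
  assumes f: "f \<in> approximable K i" and g: "g \<in> approximable K j" and ij: "i \<notin> K" "j \<notin> K"
    and centred: "\<And>\<psi> C. \<psi> \<in> spin_functions K \<Longrightarrow> (\<And>x. \<bar>\<psi> x\<bar> \<le> C) \<Longrightarrow> (\<integral>x. f x * \<psi> x \<partial>\<mu>) = 0"
  shows "\<bar>\<integral>x. f x * g x \<partial>\<mu>\<bar> \<le> \<kappa> i j * norm2 f * norm2 g"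
proof -
  have fL: "f \<in> L2" and gL: "g \<in> L2" using f g approximable_L2 by auto
  \<comment> \<open>The sum of the three error bounds obtained below; it is continuous in
    \<epsilon>, and \<open>R 0\<close> is the claimed bound.\<close>
  define R where "R \<epsilon> = 2 * \<epsilon> * norm2 g + (norm2 f + 2 * \<epsilon>) * \<epsilon> + \<kappa> i j * (norm2 f + 2 * \<epsilon>) * (norm2 g + \<epsilon>)" for \<epsilon>
  have le: "\<bar>\<integral>x. f x * g x \<partial>\<mu>\<bar> \<le> R \<epsilon>" if \<epsilon>: "0 < \<epsilon>" for \<epsilon>
  proof -
    obtain L B u where u: "0 \<le> L" "u \<in> lipschitz_diff K i L B" "norm2 (\<lambda>x. f x - u x) < \<epsilon>"
      using approximableD[OF f \<epsilon>] .
    obtain L' B' h where h: "0 \<le> L'" "h \<in> lipschitz_diff K j L' B'" "norm2 (\<lambda>x. g x - h x) < \<epsilon>"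
      using approximableD[OF g \<epsilon>] .
    obtain c w where c: "c \<in> spin_functions K" "\<And>x. \<bar>c x\<bar> \<le> 2 * B" "is_projection K u c"
      and w: "w \<in> lipschitz_diff K j (\<kappa> i j * L) B" "is_projection (insert j K) u w"
      and wc: "norm2 (\<lambda>x. w x - c x) \<le> \<kappa> i j * norm2 (\<lambda>x. u x - c x)"
      by (rule projection_contraction[OF u(2,1) ij]) blast
    have L2: "u \<in> L2" "h \<in> L2" "w \<in> L2" "c \<in> L2"
      using lipschitz_diff_L2[OF u(2)] lipschitz_diff_L2[OF h(2)] lipschitz_diff_L2[OF w(1)]
        spin_functions_L2[OF c(1,2)] by auto
    have int: "\<And>f g. f \<in> L2 \<Longrightarrow> g \<in> L2 \<Longrightarrow> integrable \<mu> (\<lambda>x. f x * g x)" by (rule L2_mult_integrable)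
    \<comment> \<open>Since \<open>f\<close> is centred, \<open>c\<close> is also the projection of
      \<open>u - f\<close>, and projecting does not increase the norm.\<close>
    have c_le: "norm2 c \<le> \<epsilon>"
    proof -
      have "(norm2 c)\<^sup>2 = (\<integral>x. c x * c x \<partial>\<mu>)" unfolding norm2_power2 by (simp add: power2_eq_square)
      also have "\<dots> = (\<integral>x. u x * c x \<partial>\<mu>) - (\<integral>x. f x * c x \<partial>\<mu>)"
        using is_projectionD[OF c(3,1,2)] centred[OF c(1,2)] by simp
      also have "\<dots> = (\<integral>x. (u x - f x) * c x \<partial>\<mu>)"
        using int[OF L2(1,4)] int[OF fL L2(4)] by (simp add: left_diff_distrib)
      also have "\<dots> \<le> norm2 (\<lambda>x. u x - f x) * norm2 c"
        using Cauchy_Schwarz_L2[OF L2_diff[OF L2(1) fL] L2(4)] by simp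
      also have "\<dots> \<le> \<epsilon> * norm2 c"
        using u(3) by (intro mult_right_mono) (auto simp: norm2_minus_commute[of u f])
      finally have "norm2 c * norm2 c \<le> \<epsilon> * norm2 c" by (simp add: power2_eq_square)
      then show ?thesis using norm2_nonneg[of c] \<open>0 < \<epsilon>\<close> by (cases "norm2 c = 0") auto
    qed
    have uc: "norm2 (\<lambda>x. f x - (u x - c x)) \<le> 2 * \<epsilon>"
      using norm2_triangle[OF L2_diff[OF fL L2(1)] L2(4)] u(3) c_le by (simp add: algebra_simps)
    have ucL: "(\<lambda>x. u x - c x) \<in> L2" by (rule L2_diff[OF L2(1,4)])
    have uc': "norm2 (\<lambda>x. u x - c x) \<le> norm2 f + 2 * \<epsilon>"
      using norm2_triangle[OF fL L2_diff[OF ucL fL]] uc by (simp add: norm2_minus_commute[of f])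
    have h': "norm2 h \<le> norm2 g + \<epsilon>"
      using norm2_triangle[OF gL L2_diff[OF L2(2) gL]] h(3) by (simp add: norm2_minus_commute[of g])
    have hm: "h \<in> spin_functions (insert j K)" "\<And>x. \<bar>h x\<bar> \<le> 2 * B'"
      using lipschitz_diff_spin_functions[OF h(2)] by auto
    have "(\<integral>x. f x * g x \<partial>\<mu>) = (\<integral>x. (f x - (u x - c x)) * g x + (u x - c x) * (g x - h x) + (u x - c x) * h x \<partial>\<mu>)"
      by (intro Bochner_Integration.integral_cong) (auto simp: algebra_simps)
    also have "\<dots> = (\<integral>x. (f x - (u x - c x)) * g x \<partial>\<mu>) + (\<integral>x. (u x - c x) * (g x - h x) \<partial>\<mu>) +
        (\<integral>x. (u x - c x) * h x \<partial>\<mu>)"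
      using int[OF L2_diff[OF fL ucL] gL] int[OF ucL L2_diff[OF gL L2(2)]] int[OF ucL L2(2)] by simp
    also have "(\<integral>x. (u x - c x) * h x \<partial>\<mu>) = (\<integral>x. (w x - c x) * h x \<partial>\<mu>)"
      using is_projectionD[OF w(2) hm] int[OF L2(1,2)] int[OF L2(3,2)] int[OF L2(4,2)]
      by (simp add: left_diff_distrib)
    finally have eq: "(\<integral>x. f x * g x \<partial>\<mu>) = (\<integral>x. (f x - (u x - c x)) * g x \<partial>\<mu>) +
        (\<integral>x. (u x - c x) * (g x - h x) \<partial>\<mu>) + (\<integral>x. (w x - c x) * h x \<partial>\<mu>)" .
    have "\<bar>\<integral>x. (f x - (u x - c x)) * g x \<partial>\<mu>\<bar> \<le> 2 * \<epsilon> * norm2 g"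
      using Cauchy_Schwarz_L2[OF L2_diff[OF fL ucL] gL] mult_right_mono[OF uc norm2_nonneg[of g]] by linarith
    moreover have "\<bar>\<integral>x. (u x - c x) * (g x - h x) \<partial>\<mu>\<bar> \<le> (norm2 f + 2 * \<epsilon>) * \<epsilon>"
    proof -
      have "norm2 (\<lambda>x. u x - c x) * norm2 (\<lambda>x. g x - h x) \<le> (norm2 f + 2 * \<epsilon>) * \<epsilon>"
        using uc' h(3) \<open>0 < \<epsilon>\<close> by (intro mult_mono) auto
      then show ?thesis using Cauchy_Schwarz_L2[OF ucL L2_diff[OF gL L2(2)]] by linarith
    qed
    moreover have "\<bar>\<integral>x. (w x - c x) * h x \<partial>\<mu>\<bar> \<le> \<kappa> i j * (norm2 f + 2 * \<epsilon>) * (norm2 g + \<epsilon>)"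
    proof -
      have "norm2 (\<lambda>x. w x - c x) \<le> \<kappa> i j * (norm2 f + 2 * \<epsilon>)"
        using wc mult_left_mono[OF uc' less_imp_le[OF \<kappa>_pos[of i j]]] by linarith
      then have "norm2 (\<lambda>x. w x - c x) * norm2 h \<le> \<kappa> i j * (norm2 f + 2 * \<epsilon>) * (norm2 g + \<epsilon>)"
        using h' \<open>0 < \<epsilon>\<close> \<kappa>_pos[of i j] by (intro mult_mono) auto
      then show ?thesis using Cauchy_Schwarz_L2[OF L2_diff[OF L2(3,4)] L2(2)] by linarith
    qed
    ultimately show ?thesis unfolding eq R_def by linarith
  qed
  have "(R \<longlongrightarrow> R 0) (at_right 0)"
    unfolding R_def[abs_def] by (intro tendsto_intros)
  then have "\<bar>\<integral>x. f x * g x \<partial>\<mu>\<bar> \<le> R 0"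
    by (rule tendsto_lowerbound) (use le in \<open>auto simp: eventually_at_filter\<close>)
  then show ?thesis by (simp add: R_def)
qed

end

section \<open>Exponential mixing\<close>

context gibbs_state
begin

text \<open>Testing against the constant 1 gives mean zero, so the standard deviation is the L2
  norm. If \<open>i\<close> lies in \<open>K\<close>, conditioning leaves \<open>f\<close> unchanged
  and being centred forces it to vanish.\<close>

lemma centred_L2D:
  assumes "f \<in> centred_L2 \<mu> (spin_sigma i) (spins_sigma K)"
  shows "f \<in> borel_measurable (join_sigma (spin_sigma i) (spins_sigma K))" "f \<in> L2"
    "sd \<mu> f = norm2 f"
    "\<And>\<psi> C. \<psi> \<in> spin_functions K \<Longrightarrow> (\<And>x. \<bar>\<psi> x\<bar> \<le> C) \<Longrightarrow> (\<integral>x. f x * \<psi> x \<partial>\<mu>) = 0"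
    "i \<in> K \<Longrightarrow> AE x in \<mu>. f x = 0"
proof -
  interpret sigma_finite_subalgebra \<mu> "spins_sigma K" by (rule sigma_finite_subalgebra_spins)
  show fF: "f \<in> borel_measurable (join_sigma (spin_sigma i) (spins_sigma K))"
    using assms unfolding centred_L2_def by auto
  have ae: "AE x in \<mu>. real_cond_exp \<mu> (spins_sigma K) f x = 0"
    using assms unfolding centred_L2_def by auto
  have fm [measurable]: "f \<in> borel_measurable config_space"
    by (rule measurable_join_sigma_config[OF fF])
  show L2: "f \<in> L2" using assms fm by (simp add: centred_L2_def L2_def)
  show cent: "(\<integral>x. f x * \<psi> x \<partial>\<mu>) = 0" if \<psi>: "\<psi> \<in> spin_functions K" "\<And>x. \<bar>\<psi> x\<bar> \<le> C" for \<psi> C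
  proof -
    note [measurable] = spin_functionsD(1)[OF \<psi>(1)]
    have "integrable \<mu> (\<lambda>x. \<psi> x * f x)"
      by (rule L2_mult_integrable[OF spin_functions_L2[OF \<psi>] L2])
    moreover have "\<psi> \<in> borel_measurable (spins_sigma K)"
      using \<psi>(1) by (simp add: spin_functions_iff_measurable)
    ultimately have "(\<integral>x. \<psi> x * f x \<partial>\<mu>) = (\<integral>x. \<psi> x * real_cond_exp \<mu> (spins_sigma K) f x \<partial>\<mu>)"
      by (intro real_cond_exp_intg(2)[symmetric]) auto
    also have "\<dots> = (\<integral>x. 0 \<partial>\<mu>)"
    proof (rule integral_cong_AE)
      have "real_cond_exp \<mu> (spins_sigma K) f \<in> spin_functions K"
        by (simp add: spin_functions_iff_measurable borel_measurable_cond_exp)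
      note [measurable] = spin_functionsD(1)[OF this]
      show "(\<lambda>x. \<psi> x * real_cond_exp \<mu> (spins_sigma K) f x) \<in> borel_measurable \<mu>" by measurable
      show "AE x in \<mu>. \<psi> x * real_cond_exp \<mu> (spins_sigma K) f x = 0" using ae by eventually_elim simp
    qed simp
    finally show ?thesis by (simp add: mult.commute)
  qed
  have "(\<lambda>_. 1) \<in> spin_functions K" by (simp add: spin_functions_def)
  from cent[OF this, of 1] have "(\<integral>x. f x \<partial>\<mu>) = 0" by simp
  then show "sd \<mu> f = norm2 f" by (simp add: sd_def norm2_def)
  show "AE x in \<mu>. f x = 0" if "i \<in> K"
  proof -
    have "f \<in> borel_measurable (spins_sigma K)"
      using fF join_sigma_absorb[OF that] unfolding measurable_def by auto
    then have "AE x in \<mu>. real_cond_exp \<mu> (spins_sigma K) f x = f x"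
      by (intro real_cond_exp_F_meas L2_integrable[OF L2])
    then show ?thesis using ae by eventually_elim simp
  qed
qed

lemma \<kappa>_le_1: "\<kappa> i j \<le> 1"
proof -
  have "1 \<le> decay_rate TYPE('n) ^ nat (l1_norm (i - j))"
    by (rule one_le_power[OF less_imp_le[OF decay_rate_gt_1]])
  then show ?thesis unfolding \<kappa>_def by (subst divide_le_eq_1_pos) auto
qed

lemma rho_cond_le: "rho_cond \<mu> (spin_sigma i) (spin_sigma j) (spins_sigma K) \<le> \<kappa> i j"
  unfolding rho_cond_def
proof (rule cInf_lower)
  have "\<bar>\<integral>x. f x * g x \<partial>\<mu>\<bar> \<le> \<kappa> i j * sd \<mu> f * sd \<mu> g"
    if f: "f \<in> centred_L2 \<mu> (spin_sigma i) (spins_sigma K)"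
      and g: "g \<in> centred_L2 \<mu> (spin_sigma j) (spins_sigma K)" for f g
  \<comment> \<open>The supremum runs over all \<open>K\<close>, including those that freeze one of
    the two spins; the correlation is then zero.\<close>
  proof (cases "i \<in> K \<or> j \<in> K")
    case True
    have "AE x in \<mu>. f x * g x = 0"
      using True
    proof
      assume "i \<in> K"
      from centred_L2D(5)[OF f this] show ?thesis by eventually_elim simp
    next
      assume "j \<in> K"
      from centred_L2D(5)[OF g this] show ?thesis by eventually_elim simp
    qed
    then have "(\<integral>x. f x * g x \<partial>\<mu>) = 0" by (rule integral_eq_zero_AE)
    moreover have "0 \<le> \<kappa> i j * sd \<mu> f * sd \<mu> g"
      unfolding centred_L2D(3)[OF f] centred_L2D(3)[OF g]
      by (intro mult_nonneg_nonneg norm2_nonneg less_imp_le[OF \<kappa>_pos])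
    ultimately show ?thesis by simp
  next
    case False
    have "f \<in> approximable K i" "g \<in> approximable K j"
      by (rule L2_approximable[OF centred_L2D(1)[OF f] centred_L2D(2)[OF f]]
          L2_approximable[OF centred_L2D(1)[OF g] centred_L2D(2)[OF g]])+
    then show ?thesis
      unfolding centred_L2D(3)[OF f] centred_L2D(3)[OF g]
      by (rule correlation_le) (use False centred_L2D(4)[OF f] in auto)
  qed
  then show "\<kappa> i j \<in> {\<epsilon> \<in> {0..1}. \<forall>f\<in>centred_L2 \<mu> (spin_sigma i) (spins_sigma K).
      \<forall>g\<in>centred_L2 \<mu> (spin_sigma j) (spins_sigma K). \<bar>\<integral>x. f x * g x \<partial>\<mu>\<bar> \<le> \<epsilon> * sd \<mu> f * sd \<mu> g}"
    using \<kappa>_le_1[of i j] less_imp_le[OF \<kappa>_pos[of i j]] by auto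
qed (auto intro: bdd_belowI[of _ 0])

lemma rho_star_le: "rho_star \<mu> i j \<le> \<kappa> i j"
  unfolding rho_star_def by (rule cSUP_least) (auto intro: rho_cond_le)

end

section \<open>Summability and decay of the mixing bound\<close>

lemma sum_power_abs_le:
  fixes r :: real
  assumes "0 \<le> r" "r < 1"
  shows "(\<Sum>m\<in>{- int N..int N}. r ^ nat \<bar>m\<bar>) \<le> 2 / (1 - r)"
proof -
  have "(\<Sum>m\<in>{- int N..int N}. r ^ nat \<bar>m\<bar>) \<le>
      (\<Sum>m\<in>int ` {..N} \<union> (\<lambda>k. - int k) ` {..N}. r ^ nat \<bar>m\<bar>)"
  proof (rule sum_mono2)
    show "{- int N..int N} \<subseteq> int ` {..N} \<union> (\<lambda>k. - int k) ` {..N}"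
    proof
      fix m assume m: "m \<in> {- int N..int N}"
      show "m \<in> int ` {..N} \<union> (\<lambda>k. - int k) ` {..N}"
      proof (cases "0 \<le> m")
        case True
        then have "m \<in> int ` {..N}" using m by (intro image_eqI[of _ _ "nat m"]) auto
        then show ?thesis by simp
      next
        case False
        then have "m \<in> (\<lambda>k. - int k) ` {..N}" using m by (intro image_eqI[of _ _ "nat (- m)"]) auto
        then show ?thesis by simp
      qed
    qed
  qed (use assms in auto)
  also have "\<dots> \<le> (\<Sum>m\<in>int ` {..N}. r ^ nat \<bar>m\<bar>) + (\<Sum>m\<in>(\<lambda>k. - int k) ` {..N}. r ^ nat \<bar>m\<bar>)"
    using assms sum.union_inter[of "int ` {..N}" "(\<lambda>k. - int k) ` {..N}" "\<lambda>m. r ^ nat \<bar>m\<bar>"]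
      sum_nonneg[of "int ` {..N} \<inter> (\<lambda>k. - int k) ` {..N}" "\<lambda>m. r ^ nat \<bar>m\<bar>"] by simp
  also have "\<dots> = 2 * (\<Sum>k\<le>N. r ^ k)"
    by (simp add: sum.reindex inj_on_def)
  also have "(\<Sum>k\<le>N. r ^ k) \<le> 1 / (1 - r)"
    using sum_le_suminf[of "\<lambda>k. r ^ k" "{..N}"] assms
    by (simp add: summable_geometric suminf_geometric)
  finally show ?thesis by simp
qed

text \<open>The power factorises over the coordinates, so over a cube its sum is a product of
  one-dimensional sums, bounded independently of the side length.\<close>

lemma summable_on_power_l1_norm:
  fixes r :: real
  assumes "0 \<le> r" "r < 1"
  shows "(\<lambda>z :: int ^ 'n. r ^ nat (l1_norm z)) summable_on A"
proof (rule nonneg_bdd_above_summable_on)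
  show "bdd_above (sum (\<lambda>z :: int ^ 'n. r ^ nat (l1_norm z)) ` {F. F \<subseteq> A \<and> finite F})"
  proof (rule bdd_aboveI2)
    fix F :: "(int ^ 'n) set" assume "F \<in> {F. F \<subseteq> A \<and> finite F}"
    then have F: "finite F" by simp
    \<comment> \<open>Any radius of a cube containing \<open>F\<close> would do; the sum dominates
      each single norm.\<close>
    define N where "N = (\<Sum>z\<in>F. nat (l1_norm z))"
    have pow: "r ^ nat (l1_norm z) = (\<Prod>k\<in>UNIV. r ^ nat \<bar>z $ k\<bar>)" for z :: "int ^ 'n"
    proof -
      have "l1_norm z = int (\<Sum>k\<in>UNIV. nat \<bar>z $ k\<bar>)" by (simp add: l1_norm_def)
      then show ?thesis by (simp only: nat_int power_sum)
    qed
    have "F \<subseteq> vec_lambda ` PiE UNIV (\<lambda>_. {- int N..int N})"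
    proof
      fix z assume "z \<in> F"
      have "\<bar>z $ k\<bar> \<le> int N" for k
      proof -
        have "\<bar>z $ k\<bar> \<le> l1_norm z" unfolding l1_norm_def by (rule member_le_sum) auto
        moreover have "nat (l1_norm z) \<le> N"
          unfolding N_def using F \<open>z \<in> F\<close> by (intro member_le_sum) auto
        ultimately show ?thesis by linarith
      qed
      then show "z \<in> vec_lambda ` PiE UNIV (\<lambda>_. {- int N..int N})"
        by (intro image_eqI[of _ _ "vec_nth z"]) (auto simp: PiE_def abs_le_iff minus_le_iff)
    qed
    then have "(\<Sum>z\<in>F. r ^ nat (l1_norm z)) \<le>
        (\<Sum>z\<in>vec_lambda ` PiE (UNIV :: 'n set) (\<lambda>_. {- int N..int N}). r ^ nat (l1_norm z))"
      using assms by (intro sum_mono2 finite_imageI finite_PiE) auto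
    also have "\<dots> = (\<Sum>g\<in>PiE (UNIV :: 'n set) (\<lambda>_. {- int N..int N}). \<Prod>k\<in>UNIV. r ^ nat \<bar>g k\<bar>)"
      unfolding pow by (subst sum.reindex) (auto simp: inj_on_def vec_lambda_inject)
    also have "\<dots> = (\<Prod>k\<in>(UNIV :: 'n set). \<Sum>m\<in>{- int N..int N}. r ^ nat \<bar>m\<bar>)"
      by (rule prod_sum_PiE[symmetric]) auto
    also have "\<dots> \<le> (\<Prod>k\<in>(UNIV :: 'n set). 2 / (1 - r))"
      using assms by (intro prod_mono conjI sum_nonneg sum_power_abs_le) auto
    finally show "(\<Sum>z\<in>F. r ^ nat (l1_norm z)) \<le> (2 / (1 - r)) ^ CARD('n)" by simp
  qed
qed (use assms in auto)

lemma exponentially_decaying_power_l1_norm: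
  assumes "1 < q"
  shows "exponentially_decaying (\<lambda>z :: int ^ 'n. (1 / q) ^ nat (l1_norm z))"
  unfolding exponentially_decaying_def
proof (intro exI[of _ "ln q"] conjI allI impI)
  show "0 < ln q" using assms by simp
  fix b' assume b': "b' < ln q"
  have "norm ((1 / q) ^ nat (l1_norm z)) \<le> 1 * norm (exp (- b' * real_of_int (l1_norm z)))" for z :: "int ^ 'n"
  proof -
    have "(1 / q) ^ nat (l1_norm z) = exp (- ln q) ^ nat (l1_norm z)"
      using assms by (simp add: exp_minus inverse_eq_divide)
    also have "\<dots> = exp (real (nat (l1_norm z)) * - ln q)" by (rule exp_of_nat_mult[symmetric])
    also have "real (nat (l1_norm z)) = real_of_int (l1_norm z)" using l1_norm_nonneg[of z] by simp
    also have "real_of_int (l1_norm z) * - ln q \<le> - b' * real_of_int (l1_norm z)"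
      using b' l1_norm_nonneg[of z] mult_left_mono[of b' "ln q" "real_of_int (l1_norm z)"] by (simp add: mult.commute)
    finally show ?thesis using assms by simp
  qed
  then show "(\<lambda>z :: int ^ 'n. (1 / q) ^ nat (l1_norm z)) \<in>
      O[filtercomap (\<lambda>z. real_of_int (l1_norm z)) at_top](\<lambda>z. exp (- b' * real_of_int (l1_norm z)))"
    by (intro bigoI[of _ 1] always_eventually allI)
qed

theorem (in gibbs_state) exponentially_rho_mixing: "exponentially_rho_mixing \<mu>"
proof -
  define q where "q = decay_rate TYPE('n)"
  have q: "1 < q" by (simp add: q_def decay_rate_gt_1)
  show ?thesis
    unfolding exponentially_rho_mixing_def
  \<comment> \<open>Distinct sites have distance at least 1, so one factor \<open>1 / q\<close>
    serves as \<open>k0\<close>.\<close>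
  proof (intro exI[of _ "1 / q"] conjI exI[of _ "\<lambda>z. (1 / q) ^ nat (l1_norm z)"] allI impI)
    show "1 / q < 1" using q by simp
    show "(1 / q) ^ nat (l1_norm z) \<in> {0..1}" for z :: "int ^ 'n"
      using q by (auto intro: power_le_one)
    show "(\<lambda>z :: int ^ 'n. (1 / q) ^ nat (l1_norm z)) summable_on - {0}"
      using q by (intro summable_on_power_l1_norm) auto
    show "exponentially_decaying (\<lambda>z :: int ^ 'n. (1 / q) ^ nat (l1_norm z))"
      by (rule exponentially_decaying_power_l1_norm[OF q])
    fix i j :: "int ^ 'n" assume "i \<noteq> j"
    have \<kappa>: "\<kappa> i j = (1 / q) ^ nat (l1_norm (j - i))"
      by (simp add: \<kappa>_def q_def power_one_over l1_norm_minus_commute[of i])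
    have "1 \<le> nat (l1_norm (j - i))"
      using l1_norm_pos[of "j - i"] \<open>i \<noteq> j\<close> by simp
    then have "(1 / q) ^ nat (l1_norm (j - i)) \<le> (1 / q) ^ 1"
      using q by (intro power_decreasing) auto
    then show "rho_star \<mu> i j \<le> min ((1 / q) ^ nat (l1_norm (j - i))) (1 / q)"
      using rho_star_le[of i j] by (simp add: \<kappa>)
  qed
qed

text \<open>Adding the tangent inequalities at \<open>x\<close> and at \<open>y\<close>.\<close>

lemma convex_deriv_mono:
  fixes f f' :: "real \<Rightarrow> real"
  assumes "convex_on UNIV f" and f: "\<And>x. (f has_real_derivative f' x) (at x)" and "x \<le> y"
  shows "f' x \<le> f' y"
proof (cases "x = y")
  case False
  have "f' a * (b - a) \<le> f b - f a" for a b
    by (rule convex_on_imp_above_tangent[OF \<open>convex_on UNIV f\<close>]) (use f in auto)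
  from this[of x y] this[of y x] have "(f' x - f' y) * (y - x) \<le> 0" by (simp add: algebra_simps)
  then show ?thesis using False \<open>x \<le> y\<close> by (auto simp: mult_le_0_iff)
qed simp

theorem theorem5p3p7:
  fixes V V' V'' W W' W'' :: "real \<Rightarrow> real"
    and v w \<beta> :: real
    and \<mu> :: "(int ^ 'n \<Rightarrow> real) measure"
  assumes "convex_on UNIV V" and "convex_on UNIV W"
    and "\<And>x. (V has_real_derivative V' x) (at x)"
    and "\<And>x. (V' has_real_derivative V'' x) (at x)"
    and "\<And>x. (W has_real_derivative W' x) (at x)"
    and "\<And>x. (W' has_real_derivative W'' x) (at x)"
    and "v > 0"
    and "\<And>x. V'' x \<ge> v"
    and "\<And>x. W'' x \<le> w"
    and "\<beta> > 0"
    and "equilibrium_state V W \<beta> \<mu>"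
  shows "exponentially_rho_mixing \<mu>"
proof -
  \<comment> \<open>The second derivatives are not assumed continuous, so the increments come from
    the mean value theorem and not from integration.\<close>
  have mvt: "\<exists>z. f' y - f' x = (y - x) * f'' z"
    if "\<And>x. (f' has_real_derivative f'' x) (at x)" "x \<le> y" for f' f'' :: "real \<Rightarrow> real" and x y
  proof (cases "x = y")
    case False
    with that have "x < y" by simp
    from MVT2[OF this, of f' f''] that(1) show ?thesis by blast
  qed simp
  interpret gibbs_state V V' W W' v w \<beta> \<mu>
  proof unfold_locales
    fix x y :: real assume "x \<le> y"
    show "v * (y - x) \<le> V' y - V' x"
    proof -
      obtain z where "V' y - V' x = (y - x) * V'' z" using mvt[OF assms(4) \<open>x \<le> y\<close>] by blast
      moreover have "(y - x) * v \<le> (y - x) * V'' z" using assms(8) \<open>x \<le> y\<close> by (intro mult_left_mono) auto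
      ultimately show ?thesis by (simp add: mult.commute)
    qed
    show "W' y - W' x \<le> w * (y - x)"
    proof -
      obtain z where "W' y - W' x = (y - x) * W'' z" using mvt[OF assms(6) \<open>x \<le> y\<close>] by blast
      moreover have "(y - x) * W'' z \<le> (y - x) * w" using assms(9) \<open>x \<le> y\<close> by (intro mult_left_mono) auto
      ultimately show ?thesis by (simp add: mult.commute)
    qed
    show "W' x \<le> W' y" by (rule convex_deriv_mono[OF assms(2,5) \<open>x \<le> y\<close>])
  qed (rule assms)+
  show ?thesis by (rule exponentially_rho_mixing)
qed

end
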